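(* Let $(A,d_A)$ be a DG algebra and $(C,d_C,h)$ a curved DG coalgebra over a field $k$ of characteristic zero. Let $\alpha:C\to A$ be a curved twisting morphism, i.e. a linear map of degree $-1$ with $\partial(\alpha)+\alpha\ast\alpha=u\circ h$. Then the free $A$-bimodule $A\otimes C\otimes A$ generated by $C$ is a chain complex, denoted $A\otimes_\alpha C\otimes_\alpha A$, with differential $$d_{A\otimes C\otimes A}+\mathrm{id}_A\otimes d_\alpha^r-d_\alpha^l\otimes\mathrm{id}_A .$$
   Context: Homological gradings, differentials of degree $-1$, Koszul sign rule. A curved DG coalgebra $(C,d_C,h)$ is a graded coassociative counital coalgebra with a coderivation $d_C$ of degree $-1$ and a linear map $h:C\to k$ of degree $-2$ such that $d_C^2=(h\otimes\mathrm{id}-\mathrm{id}\otimes h)\circ\Delta$ and $h\circ d_C=0$. $u:k\to A$ is the unit, $\mu$ the multiplication of $A$. For linear $f,g:C\to A$, $f\ast g=\mu\circ(f\otimes g)\circ\Delta$ and $\partial(f)=d_A\circ f-(-1)^{|f|}f\circ d_C$. With Sweedler notation $\Delta(c)=c'\otimes c''$, $$d_\alpha^r:C\otimes A\to C\otimes A,\quad d_\alpha^r(c\otimes a)=(-1)^{|c'|}c'\otimes\alpha(c'')a,$$ $$d_\alpha^l:A\otimes C\to A\otimes C,\quad d_\alpha^l(a\otimes c)=(-1)^{|a|}a\,\alpha(c')\otimes c''.$$ $d_{A\otimes C\otimes A}=d_A\otimes\mathrm{id}\otimes\mathrm{id}+\mathrm{id}\otimes d_C\otimes\mathrm{id}+\mathrm{id}\otimes\mathrm{id}\otimes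 d_A$. *)

theory Defs
  imports "HOL-Algebra.AbelCoset" "HOL-Algebra.Module"
begin

section \<open>Graded vector spaces\<close>

definition char_zero :: "('k, 'm) ring_scheme \<Rightarrow> bool"
  where "char_zero K \<longleftrightarrow> (\<forall>n::nat. n > 0 \<longrightarrow> [n] \<cdot>\<^bsub>K\<^esub> \<one>\<^bsub>K\<^esub> \<noteq> \<zero>\<^bsub>K\<^esub>)"

text \<open>A graded module is a module whose carrier is the internal direct sum of the submodules
  \<open>grade M n\<close>, for \<open>n\<close> an integer.\<close>

record ('k, 'v) gmodule = "('k, 'v) module" +
  grade :: "int \<Rightarrow> 'v set"

definition homogeneous_decomp ::
  "('k, 'v, 'm) gmodule_scheme \<Rightarrow> 'v \<Rightarrow> (int \<Rightarrow> 'v) \<Rightarrow> bool"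
  where "homogeneous_decomp M x f \<longleftrightarrow>
    (\<forall>n. f n \<in> grade M n) \<and> finite {n. f n \<noteq> \<zero>\<^bsub>M\<^esub>} \<and> x = finsum M f {n. f n \<noteq> \<zero>\<^bsub>M\<^esub>}"

definition homogeneous_part :: "('k, 'v, 'm) gmodule_scheme \<Rightarrow> 'v \<Rightarrow> int \<Rightarrow> 'v"
  where "homogeneous_part M x = (THE f. homogeneous_decomp M x f)"

locale graded_module = module K M
  for K :: "('k, 'l) ring_scheme" (structure) and M :: "('k, 'v, 'm) gmodule_scheme" (structure) +
  assumes grade_submodule: "submodule (grade M n) K M"
    and ex1_homogeneous_decomp: "x \<in> carrier M \<Longrightarrow> \<exists>!f. homogeneous_decomp M x f"

definition linear_maps ::
  "('k, 'l) ring_scheme \<Rightarrow> ('k, 'v, 'm) module_scheme \<Rightarrow> ('k, 'w, 'n) module_scheme \<Rightarrow> ('v \<Rightarrow> 'w) set"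
  where "linear_maps K V W = {f. (\<forall>x\<in>carrier V. f x \<in> carrier W) \<and>
    (\<forall>x\<in>carrier V. \<forall>y\<in>carrier V. f (x \<oplus>\<^bsub>V\<^esub> y) = f x \<oplus>\<^bsub>W\<^esub> f y) \<and>
    (\<forall>r\<in>carrier K. \<forall>x\<in>carrier V. f (r \<odot>\<^bsub>V\<^esub> x) = r \<odot>\<^bsub>W\<^esub> f x)}"

definition graded_maps ::
  "('k, 'l) ring_scheme \<Rightarrow> ('k, 'v, 'm) gmodule_scheme \<Rightarrow> ('k, 'w, 'n) gmodule_scheme \<Rightarrow> int
    \<Rightarrow> ('v \<Rightarrow> 'w) set"
  where "graded_maps K V W q =
    {f \<in> linear_maps K V W. \<forall>n. \<forall>x\<in>grade V n. f x \<in> grade W (n + q)}"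

text \<open>The linear endomorphism \<open>x \<mapsto> (-1)^(q |x|) x\<close>, extended to non-homogeneous \<open>x\<close>.\<close>

definition koszul :: "('k, 'v, 'm) gmodule_scheme \<Rightarrow> int \<Rightarrow> 'v \<Rightarrow> 'v"
  where "koszul M q x =
    finsum M (\<lambda>n. if even (q * n) then homogeneous_part M x n else \<ominus>\<^bsub>M\<^esub> homogeneous_part M x n)
      {n. homogeneous_part M x n \<noteq> \<zero>\<^bsub>M\<^esub>}"

definition ground :: "('k, 'l) ring_scheme \<Rightarrow> ('k, 'k) gmodule"
  where "ground K = \<lparr>carrier = carrier K, mult = mult K, one = \<one>\<^bsub>K\<^esub>, zero = \<zero>\<^bsub>K\<^esub>, add = add K,
    smult = mult K, grade = (\<lambda>n. if n = 0 then carrier K else {\<zero>\<^bsub>K\<^esub>})\<rparr>"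

locale chain_complex = graded_module K M
  for K :: "('k, 'l) ring_scheme" (structure) and M :: "('k, 'v, 'm) gmodule_scheme" (structure)
    and d :: "'v \<Rightarrow> 'v" +
  assumes diff_degree: "d \<in> graded_maps K M M (-1)"
    and diff_square: "x \<in> carrier M \<Longrightarrow> d (d x) = \<zero>\<^bsub>M\<^esub>"


section \<open>Tensor products\<close>

text \<open>The type \<open>module\<close> extends \<open>ring\<close>; where there is no multiplication, the fields \<open>mult\<close> and
  \<open>one\<close> are left unspecified.\<close>

definition free_module :: "('k, 'l) ring_scheme \<Rightarrow> 's set \<Rightarrow> ('k, 's \<Rightarrow> 'k) module"
  where "free_module K S =
    \<lparr>carrier = {f. (\<forall>s\<in>S. f s \<in> carrier K) \<and> (\<forall>s. s \<notin> S \<longrightarrow> f s = \<zero>\<^bsub>K\<^esub>) \<and> finite {s. f s \<noteq> \<zero>\<^bsub>K\<^esub>}},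
     mult = undefined, one = undefined,
     zero = (\<lambda>s. \<zero>\<^bsub>K\<^esub>), add = (\<lambda>f g s. f s \<oplus>\<^bsub>K\<^esub> g s), smult = (\<lambda>r f s. r \<otimes>\<^bsub>K\<^esub> f s)\<rparr>"

definition free_gen :: "('k, 'l) ring_scheme \<Rightarrow> 's \<Rightarrow> 's \<Rightarrow> 'k"
  where "free_gen K s = (\<lambda>t. if t = s then \<one>\<^bsub>K\<^esub> else \<zero>\<^bsub>K\<^esub>)"

definition submodule_span ::
  "('k, 'l) ring_scheme \<Rightarrow> ('k, 'v, 'm) module_scheme \<Rightarrow> 'v set \<Rightarrow> 'v set"
  where "submodule_span K M S = \<Inter>{N. submodule N K M \<and> S \<subseteq> N}"

definition quotient_module ::
  "('k, 'v, 'm) module_scheme \<Rightarrow> 'v set \<Rightarrow> ('k, 'v set) module"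
  where "quotient_module M N =
    \<lparr>carrier = a_rcosets\<^bsub>M\<^esub> N, mult = undefined, one = undefined,
     zero = N, add = set_add M, smult = (\<lambda>r X. \<Union>x\<in>X. N +>\<^bsub>M\<^esub> (r \<odot>\<^bsub>M\<^esub> x))\<rparr>"

definition bilinear_relations ::
  "('k, 'l) ring_scheme \<Rightarrow> ('k, 'a, 'm) module_scheme \<Rightarrow> ('k, 'b, 'n) module_scheme
    \<Rightarrow> ('a \<times> 'b \<Rightarrow> 'k) set"
  where "bilinear_relations K A B =
    (let F = free_module K (carrier A \<times> carrier B); e = (\<lambda>a b. free_gen K (a, b)) in
      {e (a \<oplus>\<^bsub>A\<^esub> a') b \<ominus>\<^bsub>F\<^esub> (e a b \<oplus>\<^bsub>F\<^esub> e a' b) | a a' b.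
         a \<in> carrier A \<and> a' \<in> carrier A \<and> b \<in> carrier B} \<union>
      {e a (b \<oplus>\<^bsub>B\<^esub> b') \<ominus>\<^bsub>F\<^esub> (e a b \<oplus>\<^bsub>F\<^esub> e a b') | a b b'.
         a \<in> carrier A \<and> b \<in> carrier B \<and> b' \<in> carrier B} \<union>
      {e (r \<odot>\<^bsub>A\<^esub> a) b \<ominus>\<^bsub>F\<^esub> (r \<odot>\<^bsub>F\<^esub> e a b) | r a b.
         r \<in> carrier K \<and> a \<in> carrier A \<and> b \<in> carrier B} \<union>
      {e a (r \<odot>\<^bsub>B\<^esub> b) \<ominus>\<^bsub>F\<^esub> (r \<odot>\<^bsub>F\<^esub> e a b) | r a b.
         r \<in> carrier K \<and> a \<in> carrier A \<and> b \<in> carrier B})"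

definition tensor_kernel ::
  "('k, 'l) ring_scheme \<Rightarrow> ('k, 'a, 'm) module_scheme \<Rightarrow> ('k, 'b, 'n) module_scheme
    \<Rightarrow> ('a \<times> 'b \<Rightarrow> 'k) set"
  where "tensor_kernel K A B =
    submodule_span K (free_module K (carrier A \<times> carrier B)) (bilinear_relations K A B)"

definition tensor_space ::
  "('k, 'l) ring_scheme \<Rightarrow> ('k, 'a, 'm) module_scheme \<Rightarrow> ('k, 'b, 'n) module_scheme
    \<Rightarrow> ('k, ('a \<times> 'b \<Rightarrow> 'k) set) module"
  where "tensor_space K A B =
    quotient_module (free_module K (carrier A \<times> carrier B)) (tensor_kernel K A B)"

definition pure_tensor ::
  "('k, 'l) ring_scheme \<Rightarrow> ('k, 'a, 'm) module_scheme \<Rightarrow> ('k, 'b, 'n) module_scheme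
    \<Rightarrow> 'a \<Rightarrow> 'b \<Rightarrow> ('a \<times> 'b \<Rightarrow> 'k) set"
  where "pure_tensor K A B a b =
    tensor_kernel K A B +>\<^bsub>free_module K (carrier A \<times> carrier B)\<^esub> free_gen K (a, b)"

definition tensor ::
  "('k, 'l) ring_scheme \<Rightarrow> ('k, 'a, 'm) gmodule_scheme \<Rightarrow> ('k, 'b, 'n) gmodule_scheme
    \<Rightarrow> ('k, ('a \<times> 'b \<Rightarrow> 'k) set) gmodule"
  where "tensor K A B = module.extend (tensor_space K A B)
    (gmodule.fields (\<lambda>n. submodule_span K (tensor_space K A B)
      {pure_tensor K A B a b | a b i j. a \<in> grade A i \<and> b \<in> grade B j \<and> i + j = n}))"

text \<open>For bilinear \<open>\<beta>\<close>, the linear map with \<open>a \<otimes> b \<mapsto> \<beta> a b\<close>: a class of formal combinations of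
  pairs is sent to the corresponding combination of values of \<open>\<beta>\<close>, which does not depend on the
  chosen representative.\<close>

definition tensor_lift :: "('k, 'l) ring_scheme \<Rightarrow> ('k, 'v, 'm) module_scheme
    \<Rightarrow> ('a \<Rightarrow> 'b \<Rightarrow> 'v) \<Rightarrow> ('a \<times> 'b \<Rightarrow> 'k) set \<Rightarrow> 'v"
  where "tensor_lift K V \<beta> X = (let f = (SOME f. f \<in> X) in
    finsum V (\<lambda>p. f p \<odot>\<^bsub>V\<^esub> \<beta> (fst p) (snd p)) {p. f p \<noteq> \<zero>\<^bsub>K\<^esub>})"

text \<open>The Koszul sign rule: \<open>tensor_map K A B A' B' q f g\<close> is the map \<open>f \<otimes> g\<close> from \<open>A \<otimes> B\<close> to
  \<open>A' \<otimes> B'\<close> given by \<open>a \<otimes> b \<mapsto> (-1)^(q |a|) f a \<otimes> g b\<close>, where \<open>q\<close> is the degree of \<open>g\<close>.\<close>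

definition tensor_map ::
  "('k, 'l) ring_scheme \<Rightarrow> ('k, 'a, 'm1) gmodule_scheme \<Rightarrow> ('k, 'b, 'm2) gmodule_scheme
    \<Rightarrow> ('k, 'c, 'm3) gmodule_scheme \<Rightarrow> ('k, 'd, 'm4) gmodule_scheme
    \<Rightarrow> int \<Rightarrow> ('a \<Rightarrow> 'c) \<Rightarrow> ('b \<Rightarrow> 'd) \<Rightarrow> ('a \<times> 'b \<Rightarrow> 'k) set \<Rightarrow> ('c \<times> 'd \<Rightarrow> 'k) set"
  where "tensor_map K A B A' B' q f g = tensor_lift K (tensor K A' B')
    (\<lambda>a b. pure_tensor K A' B' (f (koszul A q a)) (g b))"

text \<open>The canonical isomorphisms \<open>(A \<otimes> B) \<otimes> C \<rightarrow> A \<otimes> (B \<otimes> C)\<close> and back, and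
  \<open>k \<otimes> V \<rightarrow> V\<close>, \<open>V \<otimes> k \<rightarrow> V\<close>.\<close>

definition assoc_right ::
  "('k, 'l) ring_scheme \<Rightarrow> ('k, 'a, 'm1) gmodule_scheme \<Rightarrow> ('k, 'b, 'm2) gmodule_scheme
    \<Rightarrow> ('k, 'c, 'm3) gmodule_scheme \<Rightarrow> (('a \<times> 'b \<Rightarrow> 'k) set \<times> 'c \<Rightarrow> 'k) set
    \<Rightarrow> ('a \<times> ('b \<times> 'c \<Rightarrow> 'k) set \<Rightarrow> 'k) set"
  where "assoc_right K A B C = (let T = tensor K A (tensor K B C) in
    tensor_lift K T (\<lambda>x c. tensor_lift K T
      (\<lambda>a b. pure_tensor K A (tensor K B C) a (pure_tensor K B C b c)) x))"

definition assoc_left ::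
  "('k, 'l) ring_scheme \<Rightarrow> ('k, 'a, 'm1) gmodule_scheme \<Rightarrow> ('k, 'b, 'm2) gmodule_scheme
    \<Rightarrow> ('k, 'c, 'm3) gmodule_scheme \<Rightarrow> ('a \<times> ('b \<times> 'c \<Rightarrow> 'k) set \<Rightarrow> 'k) set
    \<Rightarrow> (('a \<times> 'b \<Rightarrow> 'k) set \<times> 'c \<Rightarrow> 'k) set"
  where "assoc_left K A B C = (let T = tensor K (tensor K A B) C in
    tensor_lift K T (\<lambda>a y. tensor_lift K T
      (\<lambda>b c. pure_tensor K (tensor K A B) C (pure_tensor K A B a b) c) y))"

definition unit_left :: "('k, 'l) ring_scheme \<Rightarrow> ('k, 'v, 'm) module_scheme
    \<Rightarrow> ('k \<times> 'v \<Rightarrow> 'k) set \<Rightarrow> 'v"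
  where "unit_left K V = tensor_lift K V (\<lambda>r x. r \<odot>\<^bsub>V\<^esub> x)"

definition unit_right :: "('k, 'l) ring_scheme \<Rightarrow> ('k, 'v, 'm) module_scheme
    \<Rightarrow> ('v \<times> 'k \<Rightarrow> 'k) set \<Rightarrow> 'v"
  where "unit_right K V = tensor_lift K V (\<lambda>x r. r \<odot>\<^bsub>V\<^esub> x)"


section \<open>DG algebras, curved DG coalgebras, curved twisting morphisms\<close>

locale dg_algebra = chain_complex K A d + ring A
  for K :: "('k, 'l) ring_scheme" (structure) and A :: "('k, 'a, 'm) gmodule_scheme" (structure)
    and d :: "'a \<Rightarrow> 'a" +
  assumes smult_mult_left:
      "\<lbrakk>r \<in> carrier K; x \<in> carrier A; y \<in> carrier A\<rbrakk>
        \<Longrightarrow> (r \<odot>\<^bsub>A\<^esub> x) \<otimes>\<^bsub>A\<^esub> y = r \<odot>\<^bsub>A\<^esub> (x \<otimes>\<^bsub>A\<^esub> y)"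
    and smult_mult_right:
      "\<lbrakk>r \<in> carrier K; x \<in> carrier A; y \<in> carrier A\<rbrakk>
        \<Longrightarrow> x \<otimes>\<^bsub>A\<^esub> (r \<odot>\<^bsub>A\<^esub> y) = r \<odot>\<^bsub>A\<^esub> (x \<otimes>\<^bsub>A\<^esub> y)"
    and one_grade: "\<one>\<^bsub>A\<^esub> \<in> grade A 0"
    and mult_grade: "\<lbrakk>x \<in> grade A i; y \<in> grade A j\<rbrakk> \<Longrightarrow> x \<otimes>\<^bsub>A\<^esub> y \<in> grade A (i + j)"
    and leibniz: "\<lbrakk>x \<in> carrier A; y \<in> carrier A\<rbrakk>
        \<Longrightarrow> d (x \<otimes>\<^bsub>A\<^esub> y) = d x \<otimes>\<^bsub>A\<^esub> y \<oplus>\<^bsub>A\<^esub> koszul A 1 x \<otimes>\<^bsub>A\<^esub> d y"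

record ('k, 'v) gcoalgebra = "('k, 'v) gmodule" +
  comult :: "'v \<Rightarrow> ('v \<times> 'v \<Rightarrow> 'k) set"
  counit :: "'v \<Rightarrow> 'k"

locale curved_dg_coalgebra = graded_module K C
  for K :: "('k, 'l) ring_scheme" (structure) and C :: "('k, 'c, 'm) gcoalgebra_scheme" (structure)
    and d :: "'c \<Rightarrow> 'c" and h :: "'c \<Rightarrow> 'k" +
  assumes comult_degree: "comult C \<in> graded_maps K C (tensor K C C) 0"
    and counit_degree: "counit C \<in> graded_maps K C (ground K) 0"
    and coassoc: "c \<in> carrier C \<Longrightarrow>
      assoc_right K C C C (tensor_map K C C (tensor K C C) C 0 (comult C) id (comult C c))
        = tensor_map K C C C (tensor K C C) 0 id (comult C) (comult C c)"
    and counit_left: "c \<in> carrier C \<Longrightarrow>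
      unit_left K C (tensor_map K C C (ground K) C 0 (counit C) id (comult C c)) = c"
    and counit_right: "c \<in> carrier C \<Longrightarrow>
      unit_right K C (tensor_map K C C C (ground K) 0 id (counit C) (comult C c)) = c"
    and diff_degree: "d \<in> graded_maps K C C (-1)"
    and coderivation: "c \<in> carrier C \<Longrightarrow>
      comult C (d c) = tensor_map K C C C C 0 d id (comult C c)
        \<oplus>\<^bsub>tensor K C C\<^esub> tensor_map K C C C C (-1) id d (comult C c)"
    and curvature_degree: "h \<in> graded_maps K C (ground K) (-2)"
    and diff_square: "c \<in> carrier C \<Longrightarrow>
      d (d c) = unit_left K C (tensor_map K C C (ground K) C 0 h id (comult C c))
        \<ominus>\<^bsub>C\<^esub> unit_right K C (tensor_map K C C C (ground K) (-2) id h (comult C c))"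
    and curvature_closed: "c \<in> carrier C \<Longrightarrow> h (d c) = \<zero>\<^bsub>K\<^esub>"

text \<open>The differential \<open>\<partial>(f) = d\<^sub>W \<circ> f - (-1)^q f \<circ> d\<^sub>V\<close> of a map \<open>f\<close> of degree \<open>q\<close> from \<open>V\<close> to \<open>W\<close>.\<close>

definition hom_diff :: "('k, 'w, 'n) gmodule_scheme \<Rightarrow> ('v \<Rightarrow> 'v) \<Rightarrow> ('w \<Rightarrow> 'w) \<Rightarrow> int
    \<Rightarrow> ('v \<Rightarrow> 'w) \<Rightarrow> 'v \<Rightarrow> 'w"
  where "hom_diff W dV dW q f x =
    (if even q then dW (f x) \<ominus>\<^bsub>W\<^esub> f (dV x) else dW (f x) \<oplus>\<^bsub>W\<^esub> f (dV x))"

text \<open>The convolution \<open>f \<star> g = \<mu> \<circ> (f \<otimes> g) \<circ> \<Delta>\<close>, where \<open>q\<close> is the degree of \<open>g\<close>.\<close>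

definition convolution :: "('k, 'l) ring_scheme \<Rightarrow> ('k, 'c, 'm) gcoalgebra_scheme
    \<Rightarrow> ('k, 'a, 'n) gmodule_scheme \<Rightarrow> int \<Rightarrow> ('c \<Rightarrow> 'a) \<Rightarrow> ('c \<Rightarrow> 'a) \<Rightarrow> 'c \<Rightarrow> 'a"
  where "convolution K C A q f g c =
    tensor_lift K A (mult A) (tensor_map K C C A A q f g (comult C c))"

definition curved_twisting_morphism :: "('k, 'l) ring_scheme
    \<Rightarrow> ('k, 'a, 'n) gmodule_scheme \<Rightarrow> ('a \<Rightarrow> 'a)
    \<Rightarrow> ('k, 'c, 'm) gcoalgebra_scheme \<Rightarrow> ('c \<Rightarrow> 'c) \<Rightarrow> ('c \<Rightarrow> 'k) \<Rightarrow> ('c \<Rightarrow> 'a) \<Rightarrow> bool"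
  where "curved_twisting_morphism K A dA C dC h \<alpha> \<longleftrightarrow>
    \<alpha> \<in> graded_maps K C A (-1) \<and>
    (\<forall>c\<in>carrier C. hom_diff A dC dA (-1) \<alpha> c \<oplus>\<^bsub>A\<^esub> convolution K C A (-1) \<alpha> \<alpha> c
      = h c \<odot>\<^bsub>A\<^esub> \<one>\<^bsub>A\<^esub>)"


section \<open>The twisted free bimodule\<close>

record ('k, 'a, 'v) gbimodule = "('k, 'v) gmodule" +
  lact :: "'a \<Rightarrow> 'v \<Rightarrow> 'v"
  ract :: "'v \<Rightarrow> 'a \<Rightarrow> 'v"

text \<open>The bimodule \<open>A \<otimes> C \<otimes> A\<close>, bracketed to the right, with \<open>x (a \<otimes> c \<otimes> b) y = x a \<otimes> c \<otimes> b y\<close>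
  (no sign occurs in either action).\<close>

definition free_bimodule :: "('k, 'l) ring_scheme \<Rightarrow> ('k, 'a, 'n) gmodule_scheme
    \<Rightarrow> ('k, 'c, 'm) gmodule_scheme
    \<Rightarrow> ('k, 'a, ('a \<times> ('c \<times> 'a \<Rightarrow> 'k) set \<Rightarrow> 'k) set) gbimodule"
  where "free_bimodule K A C = (let CA = tensor K C A in
    gmodule.extend (tensor K A CA)
      (gbimodule.fields
        (\<lambda>x. tensor_map K A CA A CA 0 (\<lambda>a. x \<otimes>\<^bsub>A\<^esub> a) id)
        (\<lambda>m y. tensor_map K A CA A CA 0 id (tensor_map K C A C A 0 id (\<lambda>b. b \<otimes>\<^bsub>A\<^esub> y)) m)))"

definition d_right :: "('k, 'l) ring_scheme \<Rightarrow> ('k, 'a, 'n) gmodule_scheme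
    \<Rightarrow> ('k, 'c, 'm) gcoalgebra_scheme \<Rightarrow> ('c \<Rightarrow> 'a)
    \<Rightarrow> ('c \<times> 'a \<Rightarrow> 'k) set \<Rightarrow> ('c \<times> 'a \<Rightarrow> 'k) set"
  where "d_right K A C \<alpha> = tensor_lift K (tensor K C A) (\<lambda>c a.
    tensor_lift K (tensor K C A)
      (\<lambda>c' c''. pure_tensor K C A (koszul C 1 c') (\<alpha> c'' \<otimes>\<^bsub>A\<^esub> a)) (comult C c))"

definition d_left :: "('k, 'l) ring_scheme \<Rightarrow> ('k, 'a, 'n) gmodule_scheme
    \<Rightarrow> ('k, 'c, 'm) gcoalgebra_scheme \<Rightarrow> ('c \<Rightarrow> 'a)
    \<Rightarrow> ('a \<times> 'c \<Rightarrow> 'k) set \<Rightarrow> ('a \<times> 'c \<Rightarrow> 'k) set"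
  where "d_left K A C \<alpha> = tensor_lift K (tensor K A C) (\<lambda>a c.
    tensor_lift K (tensor K A C)
      (\<lambda>c' c''. pure_tensor K A C (koszul A 1 a \<otimes>\<^bsub>A\<^esub> \<alpha> c') c'') (comult C c))"

definition d_tensor :: "('k, 'l) ring_scheme \<Rightarrow> ('k, 'a, 'n) gmodule_scheme \<Rightarrow> ('a \<Rightarrow> 'a)
    \<Rightarrow> ('k, 'c, 'm) gmodule_scheme \<Rightarrow> ('c \<Rightarrow> 'c)
    \<Rightarrow> ('a \<times> ('c \<times> 'a \<Rightarrow> 'k) set \<Rightarrow> 'k) set \<Rightarrow> ('a \<times> ('c \<times> 'a \<Rightarrow> 'k) set \<Rightarrow> 'k) set"
  where "d_tensor K A dA C dC x = (let CA = tensor K C A; ACA = tensor K A CA in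
    tensor_map K A CA A CA 0 dA id x
      \<oplus>\<^bsub>ACA\<^esub> tensor_map K A CA A CA (-1) id (tensor_map K C A C A 0 dC id) x
      \<oplus>\<^bsub>ACA\<^esub> tensor_map K A CA A CA (-1) id (tensor_map K C A C A (-1) id dA) x)"

text \<open>The map \<open>d_left \<otimes> id\<close> lives on \<open>(A \<otimes> C) \<otimes> A\<close> and is transported along the associativity
  isomorphism.\<close>

definition d_twisted :: "('k, 'l) ring_scheme \<Rightarrow> ('k, 'a, 'n) gmodule_scheme \<Rightarrow> ('a \<Rightarrow> 'a)
    \<Rightarrow> ('k, 'c, 'm) gcoalgebra_scheme \<Rightarrow> ('c \<Rightarrow> 'c) \<Rightarrow> ('c \<Rightarrow> 'a)
    \<Rightarrow> ('a \<times> ('c \<times> 'a \<Rightarrow> 'k) set \<Rightarrow> 'k) set \<Rightarrow> ('a \<times> ('c \<times> 'a \<Rightarrow> 'k) set \<Rightarrow> 'k) set"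
  where "d_twisted K A dA C dC \<alpha> x =
    (let AC = tensor K A C; CA = tensor K C A; ACA = tensor K A CA in
      d_tensor K A dA C dC x
        \<oplus>\<^bsub>ACA\<^esub> tensor_map K A CA A CA (-1) id (d_right K A C \<alpha>) x
        \<ominus>\<^bsub>ACA\<^esub> assoc_right K A C A
              (tensor_map K AC A AC A 0 (d_left K A C \<alpha>) id (assoc_left K A C A x)))"

end

theory Submission
  imports Defs
begin

text \<open>
  Write the differential as \<open>D = d\<^sub>1 + d\<^sub>2 + d\<^sub>3 + R - L\<close>, where \<open>d\<^sub>1\<close>, \<open>d\<^sub>2\<close>, \<open>d\<^sub>3\<close> apply \<open>d\<^sub>A\<close>, \<open>d\<^sub>C\<close>,
  \<open>d\<^sub>A\<close> to the three factors of \<open>a \<otimes> c \<otimes> b\<close>, and \<open>R\<close>, \<open>L\<close> are the twists that split \<open>c\<close> and multiply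
  one part, through \<open>\<alpha>\<close>, into \<open>b\<close> or into \<open>a\<close>. Each summand is linear of degree \<open>-1\<close>, so the point is
  that \<open>D\<close> squares to zero, which may be checked on pure tensors.

  Of the composites, most vanish or cancel in pairs. The squares of \<open>d\<^sub>1\<close> and \<open>d\<^sub>3\<close> are zero, internal
  differentials of different factors anticommute by the sign rule, and so do \<open>d\<^sub>1\<close> with \<open>R\<close> and \<open>d\<^sub>3\<close> with \<open>L\<close>; \<open>R\<close> and \<open>L\<close> anticommute by
  coassociativity. On the right,
  \<open>d\<^sub>2 R + R d\<^sub>2 + d\<^sub>3 R + R d\<^sub>3 + R R\<close> inserts \<open>\<partial>(\<alpha>) + \<alpha> \<star> \<alpha>\<close> at the second Sweedler factor
  of \<open>c\<close> (\<open>right_curvature\<close>), which the twisting equation turns into \<open>a \<otimes> c' h(c'') \<otimes> b\<close>. On the left,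
  \<open>d\<^sub>1 L + L d\<^sub>1 + d\<^sub>2 L + L d\<^sub>2 - L L\<close> gives \<open>a \<otimes> h(c') c'' \<otimes> b\<close> in the same way
  (\<open>left_curvature\<close>), and this enters \<open>D\<^sup>2\<close> with a minus sign. Finally \<open>d\<^sub>2\<^sup>2\<close>
  need not vanish: by the curvature axiom it is \<open>a \<otimes> (h(c') c'' - c' h(c'')) \<otimes> b\<close> (\<open>D2_D2\<close>), which
  is exactly what is needed to cancel the two contributions (\<open>twisted_square_zero\<close>).

  To make this a calculation with formulas, \<open>sweedler K C V \<beta> c\<close> denotes the sum of all \<open>\<beta> c' c''\<close>
  for bilinear \<open>\<beta>\<close>, and the axioms of the coalgebra become rules for such sums (\<open>sweedler_coassoc\<close>,
  \<open>sweedler_coderivation\<close>, \<open>sweedler_curvature\<close>). Signs are not computed from degrees: \<open>(-1)\<close> to the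
  degree is the linear map \<open>koszul M 1\<close>, which is an involution, anticommutes with odd maps
  (\<open>koszul_natural_odd\<close>), is multiplicative (\<open>koszul_mult\<close>) and passes through the comultiplication
  (\<open>sweedler_koszul\<close>).

  The remaining work is the universal property of the tensor product (\<open>tensor_lift_linear\<close>,
  \<open>tensor_lift_pure\<close>, \<open>linear_maps_tensor_eqI\<close>), by which all these maps are determined by their
  values at pure tensors, and the fact that a tensor product of graded modules is graded
  (\<open>tensor_graded\<close>).
\<close>

section \<open>Linear and bilinear maps\<close>

lemma linear_mapsI:
  assumes "\<And>x. x \<in> carrier V \<Longrightarrow> f x \<in> carrier W"
    and "\<And>x y. x \<in> carrier V \<Longrightarrow> y \<in> carrier V \<Longrightarrow> f (x \<oplus>\<^bsub>V\<^esub> y) = f x \<oplus>\<^bsub>W\<^esub> f y"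
    and "\<And>r x. r \<in> carrier K \<Longrightarrow> x \<in> carrier V \<Longrightarrow> f (r \<odot>\<^bsub>V\<^esub> x) = r \<odot>\<^bsub>W\<^esub> f x"
  shows "f \<in> linear_maps K V W"
  using assms by (simp add: linear_maps_def)

lemma linear_mapsD:
  assumes "f \<in> linear_maps K V W"
  shows "x \<in> carrier V \<Longrightarrow> f x \<in> carrier W"
    and "x \<in> carrier V \<Longrightarrow> y \<in> carrier V \<Longrightarrow> f (x \<oplus>\<^bsub>V\<^esub> y) = f x \<oplus>\<^bsub>W\<^esub> f y"
    and "r \<in> carrier K \<Longrightarrow> x \<in> carrier V \<Longrightarrow> f (r \<odot>\<^bsub>V\<^esub> x) = r \<odot>\<^bsub>W\<^esub> f x"
  using assms by (simp_all add: linear_maps_def)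

lemma linear_maps_comp:
  assumes "f \<in> linear_maps K U V" and "g \<in> linear_maps K V W"
  shows "(\<lambda>x. g (f x)) \<in> linear_maps K U W"
  using assms by (simp add: linear_maps_def)

lemma linear_maps_id: "id \<in> linear_maps K V V"
  by (simp add: linear_maps_def)

lemma linear_maps_cong:
  assumes "f \<in> linear_maps K V W" and "\<And>x. x \<in> carrier V \<Longrightarrow> g x = f x" and "module K V"
  shows "g \<in> linear_maps K V W"
proof -
  interpret V: module K V by fact
  show ?thesis using assms(1,2) by (simp add: linear_maps_def)
qed

lemma linear_maps_zero:
  assumes "module K V" and "module K W" and "f \<in> linear_maps K V W"
  shows "f \<zero>\<^bsub>V\<^esub> = \<zero>\<^bsub>W\<^esub>"
proof -
  interpret V: module K V by fact
  interpret W: module K W by fact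
  have "f (\<zero>\<^bsub>K\<^esub> \<odot>\<^bsub>V\<^esub> \<zero>\<^bsub>V\<^esub>) = \<zero>\<^bsub>K\<^esub> \<odot>\<^bsub>W\<^esub> f \<zero>\<^bsub>V\<^esub>"
    by (rule linear_mapsD(3)[OF assms(3)]) auto
  then show ?thesis using linear_mapsD(1)[OF assms(3)] by simp
qed

lemma linear_maps_uminus:
  assumes "module K V" and "module K W" and "f \<in> linear_maps K V W" and "x \<in> carrier V"
  shows "f (\<ominus>\<^bsub>V\<^esub> x) = \<ominus>\<^bsub>W\<^esub> f x"
proof -
  interpret V: module K V by fact
  interpret W: module K W by fact
  have "f ((\<ominus>\<^bsub>K\<^esub> \<one>\<^bsub>K\<^esub>) \<odot>\<^bsub>V\<^esub> x) = (\<ominus>\<^bsub>K\<^esub> \<one>\<^bsub>K\<^esub>) \<odot>\<^bsub>W\<^esub> f x"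
    by (rule linear_mapsD(3)[OF assms(3)]) (use assms in auto)
  then show ?thesis
    using linear_mapsD(1)[OF assms(3)] assms by (simp add: V.smult_l_minus W.smult_l_minus)
qed

lemma linear_maps_minus:
  assumes "module K V" and "module K W" and "f \<in> linear_maps K V W"
    and "x \<in> carrier V" and "y \<in> carrier V"
  shows "f (x \<ominus>\<^bsub>V\<^esub> y) = f x \<ominus>\<^bsub>W\<^esub> f y"
proof -
  interpret V: module K V by fact
  interpret W: module K W by fact
  show ?thesis
    unfolding a_minus_def using assms
    by (simp add: linear_mapsD(2)[OF assms(3)] linear_maps_uminus[OF assms(1-3)])
qed

lemma linear_maps_finsum:
  assumes "module K V" and "module K W" and "f \<in> linear_maps K V W"
    and "finite S" and "\<And>i. i \<in> S \<Longrightarrow> g i \<in> carrier V"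
  shows "f (finsum V g S) = finsum W (\<lambda>i. f (g i)) S"
  using assms(4,5)
proof (induction S rule: finite_induct)
  case empty
  interpret V: module K V by fact
  interpret W: module K W by fact
  show ?case using linear_maps_zero[OF assms(1-3)] by simp
next
  case (insert i S)
  interpret V: module K V by fact
  interpret W: module K W by fact
  have "g \<in> S \<rightarrow> carrier V" "(\<lambda>i. f (g i)) \<in> S \<rightarrow> carrier W" "g i \<in> carrier V" "f (g i) \<in> carrier W"
    using insert.prems linear_mapsD(1)[OF assms(3)] by auto
  then show ?case
    using insert by (simp add: linear_mapsD(2)[OF assms(3)] V.finsum_closed)
qed

lemma linear_maps_add:
  assumes "module K W" and "f \<in> linear_maps K V W" and "g \<in> linear_maps K V W"
  shows "(\<lambda>x. f x \<oplus>\<^bsub>W\<^esub> g x) \<in> linear_maps K V W"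
proof -
  interpret W: module K W by fact
  show ?thesis
    using linear_mapsD[OF assms(2)] linear_mapsD[OF assms(3)]
    by (intro linear_mapsI) (auto simp: W.a_ac W.smult_r_distr)
qed

lemma linear_maps_neg:
  assumes "module K W" and "f \<in> linear_maps K V W"
  shows "(\<lambda>x. \<ominus>\<^bsub>W\<^esub> f x) \<in> linear_maps K V W"
proof -
  interpret W: module K W by fact
  show ?thesis
    using linear_mapsD[OF assms(2)]
    by (intro linear_mapsI) (auto simp: W.minus_add W.smult_r_minus W.a_comm)
qed

lemma linear_maps_diff:
  assumes "module K W" and "f \<in> linear_maps K V W" and "g \<in> linear_maps K V W"
  shows "(\<lambda>x. f x \<ominus>\<^bsub>W\<^esub> g x) \<in> linear_maps K V W"
  unfolding a_minus_def by (rule linear_maps_add[OF assms(1,2) linear_maps_neg[OF assms(1,3)]])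

lemma linear_maps_const_zero:
  assumes "module K W"
  shows "(\<lambda>x. \<zero>\<^bsub>W\<^esub>) \<in> linear_maps K V W"
proof -
  interpret W: module K W by fact
  show ?thesis by (intro linear_mapsI) auto
qed

lemma linear_maps_finsum_pointwise:
  assumes W: "module K W" and "finite S" and "\<And>i. i \<in> S \<Longrightarrow> f i \<in> linear_maps K V W"
    and "module K V"
  shows "(\<lambda>x. finsum W (\<lambda>i. f i x) S) \<in> linear_maps K V W"
  using assms(2,3)
proof (induction S rule: finite_induct)
  case empty
  interpret W: module K W by fact
  show ?case using linear_maps_const_zero[OF W] by simp
next
  case (insert i S)
  interpret W: module K W by fact
  have "(\<lambda>x. f i x \<oplus>\<^bsub>W\<^esub> finsum W (\<lambda>i. f i x) S) \<in> linear_maps K V W"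
    using insert by (intro linear_maps_add[OF W]) auto
  then show ?case
  proof (rule linear_maps_cong)
    fix x assume "x \<in> carrier V"
    then show "finsum W (\<lambda>i. f i x) (insert i S) = f i x \<oplus>\<^bsub>W\<^esub> finsum W (\<lambda>i. f i x) S"
      using insert linear_mapsD(1)[OF insert.prems] by (intro W.finsum_insert) auto
  qed fact
qed

definition bilinear_maps ::
  "('k, 'l) ring_scheme \<Rightarrow> ('k, 'a, 'm) module_scheme \<Rightarrow> ('k, 'b, 'n) module_scheme
    \<Rightarrow> ('k, 'v, 'o) module_scheme \<Rightarrow> ('a \<Rightarrow> 'b \<Rightarrow> 'v) set"
  where "bilinear_maps K A B V = {\<beta>. (\<forall>a\<in>carrier A. \<beta> a \<in> linear_maps K B V) \<and>
    (\<forall>b\<in>carrier B. (\<lambda>a. \<beta> a b) \<in> linear_maps K A V)}"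

lemma bilinear_mapsI:
  assumes "\<And>a. a \<in> carrier A \<Longrightarrow> (\<lambda>b. \<beta> a b) \<in> linear_maps K B V"
    and "\<And>b. b \<in> carrier B \<Longrightarrow> (\<lambda>a. \<beta> a b) \<in> linear_maps K A V"
  shows "\<beta> \<in> bilinear_maps K A B V"
  using assms by (simp add: bilinear_maps_def)

lemma bilinear_mapsD:
  assumes "\<beta> \<in> bilinear_maps K A B V"
  shows "a \<in> carrier A \<Longrightarrow> (\<lambda>b. \<beta> a b) \<in> linear_maps K B V"
    and "b \<in> carrier B \<Longrightarrow> (\<lambda>a. \<beta> a b) \<in> linear_maps K A V"
  using assms by (simp_all add: bilinear_maps_def)

lemma bilinear_maps_closed:
  assumes "\<beta> \<in> bilinear_maps K A B V" and "a \<in> carrier A" and "b \<in> carrier B"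
  shows "\<beta> a b \<in> carrier V"
  using linear_mapsD(1)[OF bilinear_mapsD(1)[OF assms(1,2)] assms(3)] .

lemma bilinear_maps_comp:
  assumes "\<beta> \<in> bilinear_maps K A B V" and "f \<in> linear_maps K A' A" and "g \<in> linear_maps K B' B"
    and "\<phi> \<in> linear_maps K V W"
  shows "(\<lambda>a b. \<phi> (\<beta> (f a) (g b))) \<in> bilinear_maps K A' B' W"
proof (rule bilinear_mapsI)
  fix a assume "a \<in> carrier A'"
  then have "f a \<in> carrier A" using linear_mapsD(1)[OF assms(2)] by simp
  from linear_maps_comp[OF linear_maps_comp[OF assms(3) bilinear_mapsD(1)[OF assms(1) this]] assms(4)]
  show "(\<lambda>b. \<phi> (\<beta> (f a) (g b))) \<in> linear_maps K B' W" .
next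
  fix b assume "b \<in> carrier B'"
  then have "g b \<in> carrier B" using linear_mapsD(1)[OF assms(3)] by simp
  from linear_maps_comp[OF linear_maps_comp[OF assms(2) bilinear_mapsD(2)[OF assms(1) this]] assms(4)]
  show "(\<lambda>a. \<phi> (\<beta> (f a) (g b))) \<in> linear_maps K A' W" .
qed

lemma bilinear_maps_add:
  assumes "module K V" and "\<beta> \<in> bilinear_maps K A B V" and "\<gamma> \<in> bilinear_maps K A B V"
  shows "(\<lambda>a b. \<beta> a b \<oplus>\<^bsub>V\<^esub> \<gamma> a b) \<in> bilinear_maps K A B V"
proof (rule bilinear_mapsI)
  fix a assume "a \<in> carrier A"
  show "(\<lambda>b. \<beta> a b \<oplus>\<^bsub>V\<^esub> \<gamma> a b) \<in> linear_maps K B V"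
    by (rule linear_maps_add[OF assms(1) bilinear_mapsD(1)[OF assms(2)] bilinear_mapsD(1)[OF assms(3)]]) fact+
next
  fix b assume "b \<in> carrier B"
  show "(\<lambda>a. \<beta> a b \<oplus>\<^bsub>V\<^esub> \<gamma> a b) \<in> linear_maps K A V"
    by (rule linear_maps_add[OF assms(1) bilinear_mapsD(2)[OF assms(2)] bilinear_mapsD(2)[OF assms(3)]]) fact+
qed


section \<open>Spans, quotients and free modules\<close>

lemma submodule_span_superset: "S \<subseteq> submodule_span K M S"
  by (auto simp: submodule_span_def)

lemma submodule_span_least:
  assumes "submodule N K M" and "S \<subseteq> N"
  shows "submodule_span K M S \<subseteq> N"
  using assms by (auto simp: submodule_span_def)

lemma submodule_span_submodule:
  assumes "module K M" and S: "S \<subseteq> carrier M"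
  shows "submodule (submodule_span K M S) K M"
proof -
  interpret M: module K M by fact
  note E = M.submoduleE
  have zero: "\<zero>\<^bsub>M\<^esub> \<in> N" if "submodule N K M" for N
    using subgroup.one_closed[OF submodule.axioms(1)[OF that]] by simp
  show ?thesis
  proof (rule M.submoduleI)
    show "submodule_span K M S \<subseteq> carrier M"
      using submodule_span_least[OF M.carrier_is_submodule S] .
  qed (auto simp: submodule_span_def zero E)
qed

lemma submodule_vimage:
  assumes "module K V" and "module K W" and f: "f \<in> linear_maps K V W" and N: "submodule N K W"
  shows "submodule {x \<in> carrier V. f x \<in> N} K V"
proof -
  interpret V: module K V by fact
  interpret W: module K W by fact
  have "\<zero>\<^bsub>W\<^esub> \<in> N" using subgroup.one_closed[OF submodule.axioms(1)[OF N]] by simp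
  then show ?thesis
    by (intro V.submoduleI)
      (auto simp: linear_maps_zero[OF assms(1-3)] linear_maps_uminus[OF assms(1-3)]
        linear_mapsD[OF f] W.submoduleE[OF N])
qed

lemma linear_maps_span:
  assumes "module K V" and "module K W" and f: "f \<in> linear_maps K V W" and N: "submodule N K W"
    and S: "S \<subseteq> carrier V" and fS: "\<And>x. x \<in> S \<Longrightarrow> f x \<in> N" and x: "x \<in> submodule_span K V S"
  shows "f x \<in> N"
  using submodule_span_least[OF submodule_vimage[OF assms(1-4)], of S] S fS x by auto

lemma submodule_singleton_zero:
  assumes "module K M"
  shows "submodule {\<zero>\<^bsub>M\<^esub>} K M"
proof -
  interpret M: module K M by fact
  show ?thesis by (rule M.submoduleI) auto
qed

context
  fixes K :: "('k, 'l) ring_scheme" and M :: "('k, 'v, 'm) module_scheme" and N :: "'v set"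
  assumes module: "module K M" and sub: "submodule N K M"
begin

interpretation M: module K M by (fact module)

interpretation N: abelian_subgroup N M
  using submodule.axioms(1)[OF sub]
  by (intro abelian_subgroupI3 additive_subgroupI M.abelian_group_axioms)

lemma quotient_carrier: "carrier (quotient_module M N) = (\<lambda>x. N +>\<^bsub>M\<^esub> x) ` carrier M"
  by (auto simp: quotient_module_def A_RCOSETS_def')

lemma quotient_add:
  "x \<in> carrier M \<Longrightarrow> y \<in> carrier M \<Longrightarrow>
    (N +>\<^bsub>M\<^esub> x) \<oplus>\<^bsub>quotient_module M N\<^esub> (N +>\<^bsub>M\<^esub> y) = N +>\<^bsub>M\<^esub> (x \<oplus>\<^bsub>M\<^esub> y)"
  by (simp add: quotient_module_def N.a_rcos_sum)

lemma quotient_zero: "\<zero>\<^bsub>quotient_module M N\<^esub> = N +>\<^bsub>M\<^esub> \<zero>\<^bsub>M\<^esub>"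
  by (simp add: quotient_module_def N.a_rcos_const)

text \<open>All members of the coset of \<open>x\<close> have multiples in the coset of \<open>r \<odot> x\<close>, because their
  differences from \<open>x\<close> lie in the submodule; hence the union that defines the scalar action is
  a single coset.\<close>

lemma quotient_smult:
  assumes r: "r \<in> carrier K" and x: "x \<in> carrier M"
  shows "r \<odot>\<^bsub>quotient_module M N\<^esub> (N +>\<^bsub>M\<^esub> x) = N +>\<^bsub>M\<^esub> (r \<odot>\<^bsub>M\<^esub> x)"
proof -
  have "N +>\<^bsub>M\<^esub> (r \<odot>\<^bsub>M\<^esub> z) = N +>\<^bsub>M\<^esub> (r \<odot>\<^bsub>M\<^esub> x)" if z: "z \<in> N +>\<^bsub>M\<^esub> x" for z
  proof -
    have zM: "z \<in> carrier M" using N.a_elemrcos_carrier[OF x z] .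
    have "z \<oplus>\<^bsub>M\<^esub> \<ominus>\<^bsub>M\<^esub> x \<in> N" using N.a_rcos_module_imp[OF x z] .
    then have "r \<odot>\<^bsub>M\<^esub> (z \<oplus>\<^bsub>M\<^esub> \<ominus>\<^bsub>M\<^esub> x) \<in> N" using M.submoduleE(4)[OF sub] r by simp
    then have "r \<odot>\<^bsub>M\<^esub> z \<in> N +>\<^bsub>M\<^esub> (r \<odot>\<^bsub>M\<^esub> x)"
      using r x zM by (intro N.a_rcos_module_rev) (auto simp: M.smult_r_distr M.smult_r_minus)
    then show ?thesis using N.a_repr_independence'[of "r \<odot>\<^bsub>M\<^esub> z" "r \<odot>\<^bsub>M\<^esub> x"] r x by simp
  qed
  then have "(\<Union>z\<in>N +>\<^bsub>M\<^esub> x. N +>\<^bsub>M\<^esub> (r \<odot>\<^bsub>M\<^esub> z)) = N +>\<^bsub>M\<^esub> (r \<odot>\<^bsub>M\<^esub> x)"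
    using N.a_rcos_self[OF x] by (intro UN_constant_eq) blast+
  then show ?thesis by (simp add: quotient_module_def)
qed

lemma quotient_is_module: "module K (quotient_module M N)"
proof -
  note s = quotient_add quotient_zero quotient_smult
  have "abelian_group (quotient_module M N)"
  proof (rule abelian_groupI)
    fix X assume "X \<in> carrier (quotient_module M N)"
    then obtain x where x: "x \<in> carrier M" "X = N +>\<^bsub>M\<^esub> x" by (auto simp: quotient_carrier)
    have "(N +>\<^bsub>M\<^esub> \<ominus>\<^bsub>M\<^esub> x) \<oplus>\<^bsub>quotient_module M N\<^esub> X = \<zero>\<^bsub>quotient_module M N\<^esub>"
      using x by (simp add: s M.l_neg)
    then show "\<exists>Y\<in>carrier (quotient_module M N). Y \<oplus>\<^bsub>quotient_module M N\<^esub> X = \<zero>\<^bsub>quotient_module M N\<^esub>"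
      using x by (auto simp: quotient_carrier)
  qed (auto simp: quotient_carrier s M.a_ac)
  then show ?thesis
    using M.R.is_cring
    by (intro moduleI)
      (auto simp: quotient_carrier s M.smult_r_distr M.smult_l_distr M.smult_assoc1)
qed

end

lemma free_module_module:
  assumes "cring K"
  shows "module K (free_module K S)"
proof -
  interpret K: cring K by fact
  let ?F = "free_module K S"
  have fin_add: "finite {s. f s \<oplus>\<^bsub>K\<^esub> g s \<noteq> \<zero>\<^bsub>K\<^esub>}"
    if "finite {s. f s \<noteq> \<zero>\<^bsub>K\<^esub>}" "finite {s. g s \<noteq> \<zero>\<^bsub>K\<^esub>}" for f g :: "'s \<Rightarrow> _"
    by (rule finite_subset[OF _ finite_UnI[OF that]]) auto
  have fin_smult: "finite {s. r \<otimes>\<^bsub>K\<^esub> f s \<noteq> \<zero>\<^bsub>K\<^esub>}"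
    if "finite {s. f s \<noteq> \<zero>\<^bsub>K\<^esub>}" "r \<in> carrier K" for r and f :: "'s \<Rightarrow> _"
    by (rule finite_subset[OF _ that(1)]) (use that in auto)
  have val: "f s \<in> carrier K" if "f \<in> carrier ?F" for f s
    using that by (cases "s \<in> S") (auto simp: free_module_def)
  have "abelian_group ?F"
  proof (rule abelian_groupI)
    fix f assume f: "f \<in> carrier ?F"
    have "(\<lambda>s. \<ominus>\<^bsub>K\<^esub> \<one>\<^bsub>K\<^esub> \<otimes>\<^bsub>K\<^esub> f s) \<in> carrier ?F"
      using f by (auto simp: free_module_def fin_smult)
    moreover have "(\<lambda>s. \<ominus>\<^bsub>K\<^esub> \<one>\<^bsub>K\<^esub> \<otimes>\<^bsub>K\<^esub> f s) \<oplus>\<^bsub>?F\<^esub> f = \<zero>\<^bsub>?F\<^esub>"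
      using val[OF f] by (simp add: free_module_def K.l_minus K.l_neg)
    ultimately show "\<exists>g\<in>carrier ?F. g \<oplus>\<^bsub>?F\<^esub> f = \<zero>\<^bsub>?F\<^esub>" by blast
  next
    fix f g assume f: "f \<in> carrier ?F" and g: "g \<in> carrier ?F"
    show "f \<oplus>\<^bsub>?F\<^esub> g \<in> carrier ?F"
      using f g by (auto simp: free_module_def fin_add)
    show "f \<oplus>\<^bsub>?F\<^esub> g = g \<oplus>\<^bsub>?F\<^esub> f"
      using val[OF f] val[OF g] by (simp add: free_module_def K.a_comm)
    fix k assume k: "k \<in> carrier ?F"
    show "f \<oplus>\<^bsub>?F\<^esub> g \<oplus>\<^bsub>?F\<^esub> k = f \<oplus>\<^bsub>?F\<^esub> (g \<oplus>\<^bsub>?F\<^esub> k)"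
      using val[OF f] val[OF g] val[OF k] by (simp add: free_module_def K.a_assoc)
  next
    fix f assume f: "f \<in> carrier ?F"
    show "\<zero>\<^bsub>?F\<^esub> \<oplus>\<^bsub>?F\<^esub> f = f" using val[OF f] by (simp add: free_module_def)
  qed (simp add: free_module_def)
  then show ?thesis
  proof (rule moduleI[OF K.is_cring])
    fix r f assume r: "r \<in> carrier K" and f: "f \<in> carrier ?F"
    show "r \<odot>\<^bsub>?F\<^esub> f \<in> carrier ?F" using r f by (auto simp: free_module_def fin_smult)
    fix q assume q: "q \<in> carrier K"
    show "(r \<oplus>\<^bsub>K\<^esub> q) \<odot>\<^bsub>?F\<^esub> f = r \<odot>\<^bsub>?F\<^esub> f \<oplus>\<^bsub>?F\<^esub> q \<odot>\<^bsub>?F\<^esub> f"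
      using val[OF f] r q by (simp add: free_module_def K.l_distr)
    show "(r \<otimes>\<^bsub>K\<^esub> q) \<odot>\<^bsub>?F\<^esub> f = r \<odot>\<^bsub>?F\<^esub> (q \<odot>\<^bsub>?F\<^esub> f)"
      using val[OF f] r q by (simp add: free_module_def K.m_assoc)
  next
    fix r f g assume r: "r \<in> carrier K" and f: "f \<in> carrier ?F" and g: "g \<in> carrier ?F"
    show "r \<odot>\<^bsub>?F\<^esub> (f \<oplus>\<^bsub>?F\<^esub> g) = r \<odot>\<^bsub>?F\<^esub> f \<oplus>\<^bsub>?F\<^esub> r \<odot>\<^bsub>?F\<^esub> g"
      using val[OF f] val[OF g] r by (simp add: free_module_def K.r_distr)
  next
    fix f assume f: "f \<in> carrier ?F"
    show "\<one>\<^bsub>K\<^esub> \<odot>\<^bsub>?F\<^esub> f = f" using val[OF f] by (simp add: free_module_def)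
  qed
qed

lemma free_gen_closed:
  assumes "cring K" and "s \<in> S"
  shows "free_gen K s \<in> carrier (free_module K S)"
proof -
  interpret K: cring K by fact
  have "finite {t. free_gen K s t \<noteq> \<zero>\<^bsub>K\<^esub>}"
    by (rule finite_subset[of _ "{s}"]) (auto simp: free_gen_def)
  then show ?thesis using assms by (auto simp: free_module_def free_gen_def)
qed

text \<open>Induction on the size of the support: a formal combination is the sum of its term at one point
  and the rest.\<close>

lemma free_module_induct [consumes 2, case_names zero add gen]:
  assumes "cring K" and "f \<in> carrier (free_module K S)"
    and zero: "P \<zero>\<^bsub>free_module K S\<^esub>"
    and add: "\<And>f g. f \<in> carrier (free_module K S) \<Longrightarrow> g \<in> carrier (free_module K S)
        \<Longrightarrow> P f \<Longrightarrow> P g \<Longrightarrow> P (f \<oplus>\<^bsub>free_module K S\<^esub> g)"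
    and gen: "\<And>r s. r \<in> carrier K \<Longrightarrow> s \<in> S \<Longrightarrow> P (r \<odot>\<^bsub>free_module K S\<^esub> free_gen K s)"
  shows "P f"
proof -
  interpret K: cring K by fact
  interpret F: module K "free_module K S" by (rule free_module_module) fact
  have "finite T \<Longrightarrow> f \<in> carrier (free_module K S) \<Longrightarrow> {s. f s \<noteq> \<zero>\<^bsub>K\<^esub>} = T \<Longrightarrow> P f" for T
  proof (induction T arbitrary: f rule: finite_induct)
    case empty
    then have "f = \<zero>\<^bsub>free_module K S\<^esub>" by (auto simp: free_module_def)
    then show ?case using zero by simp
  next
    case (insert t T)
    let ?g = "f(t := \<zero>\<^bsub>K\<^esub>)"
    have tS: "t \<in> S" and ft: "f t \<in> carrier K" and val: "\<And>s. f s \<in> carrier K"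
      using insert.prems by (auto simp: free_module_def)
    have supp: "{s. ?g s \<noteq> \<zero>\<^bsub>K\<^esub>} = T" using insert by auto
    with insert have g: "?g \<in> carrier (free_module K S)" by (auto simp: free_module_def)
    have "f = ?g \<oplus>\<^bsub>free_module K S\<^esub> (f t \<odot>\<^bsub>free_module K S\<^esub> free_gen K t)"
      using val by (auto simp: free_module_def free_gen_def)
    moreover have "P (?g \<oplus>\<^bsub>free_module K S\<^esub> (f t \<odot>\<^bsub>free_module K S\<^esub> free_gen K t))"
      by (rule add[OF g _ insert.IH[OF g supp] gen[OF ft tS]])
        (rule F.smult_closed[OF ft free_gen_closed[OF assms(1) tS]])
    ultimately show ?case by simp
  qed
  then show ?thesis using assms(2) by (auto simp: free_module_def)
qed

text \<open>The linear extension of \<open>\<beta>\<close> to formal combinations. The sum has the shape of the one in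
  \<open>tensor_lift\<close>.\<close>

definition free_lift :: "('k, 'l) ring_scheme \<Rightarrow> ('k, 'v, 'm) module_scheme \<Rightarrow> ('s \<Rightarrow> 'v)
    \<Rightarrow> ('s \<Rightarrow> 'k) \<Rightarrow> 'v"
  where "free_lift K V \<beta> f = finsum V (\<lambda>p. f p \<odot>\<^bsub>V\<^esub> \<beta> p) {p. f p \<noteq> \<zero>\<^bsub>K\<^esub>}"

context
  fixes K :: "('k, 'l) ring_scheme" and V :: "('k, 'v, 'm) module_scheme"
    and S :: "'s set" and \<beta> :: "'s \<Rightarrow> 'v"
  assumes module: "module K V" and val: "\<And>s. s \<in> S \<Longrightarrow> \<beta> s \<in> carrier V"
begin

interpretation V: module K V by (fact module)

lemma free_lift_eq:
  assumes "f \<in> carrier (free_module K S)" and "finite T" and "{p. f p \<noteq> \<zero>\<^bsub>K\<^esub>} \<subseteq> T" and "T \<subseteq> S"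
  shows "free_lift K V \<beta> f = finsum V (\<lambda>p. f p \<odot>\<^bsub>V\<^esub> \<beta> p) T"
  unfolding free_lift_def
  using assms val by (intro V.add.finprod_mono_neutral_cong_left) (auto simp: free_module_def)

lemma free_lift_linear: "free_lift K V \<beta> \<in> linear_maps K (free_module K S) V"
proof (rule linear_mapsI)
  interpret F: module K "free_module K S" by (rule free_module_module) (rule V.R.is_cring)
  fix f assume f: "f \<in> carrier (free_module K S)"
  have fS: "{p. f p \<noteq> \<zero>\<^bsub>K\<^esub>} \<subseteq> S" and fin: "finite {p. f p \<noteq> \<zero>\<^bsub>K\<^esub>}"
    and fK: "\<And>p. f p \<in> carrier K" using f by (auto simp: free_module_def)
  show "free_lift K V \<beta> f \<in> carrier V"
    unfolding free_lift_def using fS fK val by (intro V.finsum_closed) auto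
  {
    fix g assume g: "g \<in> carrier (free_module K S)"
    have gS: "{p. g p \<noteq> \<zero>\<^bsub>K\<^esub>} \<subseteq> S" and gfin: "finite {p. g p \<noteq> \<zero>\<^bsub>K\<^esub>}"
      and gK: "\<And>p. g p \<in> carrier K" using g by (auto simp: free_module_def)
    let ?T = "{p. f p \<noteq> \<zero>\<^bsub>K\<^esub>} \<union> {p. g p \<noteq> \<zero>\<^bsub>K\<^esub>}"
    have T: "finite ?T" "?T \<subseteq> S" using fS gS fin gfin by auto
    have sum: "(f \<oplus>\<^bsub>free_module K S\<^esub> g) = (\<lambda>p. f p \<oplus>\<^bsub>K\<^esub> g p)" by (simp add: free_module_def)
    have "{p. f p \<oplus>\<^bsub>K\<^esub> g p \<noteq> \<zero>\<^bsub>K\<^esub>} \<subseteq> ?T" by auto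
    then have "free_lift K V \<beta> (f \<oplus>\<^bsub>free_module K S\<^esub> g)
        = finsum V (\<lambda>p. (f p \<oplus>\<^bsub>K\<^esub> g p) \<odot>\<^bsub>V\<^esub> \<beta> p) ?T"
      using free_lift_eq[OF F.a_closed[OF f g] T(1) _ T(2)] by (simp add: sum)
    also have "\<dots> = finsum V (\<lambda>p. f p \<odot>\<^bsub>V\<^esub> \<beta> p \<oplus>\<^bsub>V\<^esub> g p \<odot>\<^bsub>V\<^esub> \<beta> p) ?T"
      using T val fK gK by (intro V.finsum_cong') (auto simp: V.smult_l_distr)
    also have "\<dots> = finsum V (\<lambda>p. f p \<odot>\<^bsub>V\<^esub> \<beta> p) ?T \<oplus>\<^bsub>V\<^esub> finsum V (\<lambda>p. g p \<odot>\<^bsub>V\<^esub> \<beta> p) ?T"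
      by (rule V.finsum_addf) (use T val fK gK in auto)
    also have "\<dots> = free_lift K V \<beta> f \<oplus>\<^bsub>V\<^esub> free_lift K V \<beta> g"
      using free_lift_eq[OF f T(1) _ T(2)] free_lift_eq[OF g T(1) _ T(2)] by simp
    finally show "free_lift K V \<beta> (f \<oplus>\<^bsub>free_module K S\<^esub> g)
      = free_lift K V \<beta> f \<oplus>\<^bsub>V\<^esub> free_lift K V \<beta> g" .
  }
  fix r assume r: "r \<in> carrier K"
  let ?T = "{p. f p \<noteq> \<zero>\<^bsub>K\<^esub>}"
  have smult: "r \<odot>\<^bsub>free_module K S\<^esub> f = (\<lambda>p. r \<otimes>\<^bsub>K\<^esub> f p)" by (simp add: free_module_def)
  have "{p. r \<otimes>\<^bsub>K\<^esub> f p \<noteq> \<zero>\<^bsub>K\<^esub>} \<subseteq> ?T" using r by auto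
  then have "free_lift K V \<beta> (r \<odot>\<^bsub>free_module K S\<^esub> f)
      = finsum V (\<lambda>p. (r \<otimes>\<^bsub>K\<^esub> f p) \<odot>\<^bsub>V\<^esub> \<beta> p) ?T"
    using free_lift_eq[OF F.smult_closed[OF r f] fin _ fS] by (simp add: smult)
  also have "\<dots> = finsum V (\<lambda>p. r \<odot>\<^bsub>V\<^esub> (f p \<odot>\<^bsub>V\<^esub> \<beta> p)) ?T"
    using fS val fK r by (intro V.finsum_cong' Pi_I V.smult_assoc1 refl V.smult_closed) auto
  also have "\<dots> = r \<odot>\<^bsub>V\<^esub> free_lift K V \<beta> f"
    unfolding free_lift_def using fin fS val fK r
    by (intro V.finsum_smult_ldistr[symmetric]) auto
  finally show "free_lift K V \<beta> (r \<odot>\<^bsub>free_module K S\<^esub> f) = r \<odot>\<^bsub>V\<^esub> free_lift K V \<beta> f" .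
qed

lemma free_lift_gen:
  assumes s: "s \<in> S"
  shows "free_lift K V \<beta> (free_gen K s) = \<beta> s"
proof -
  have "free_lift K V \<beta> (free_gen K s) = finsum V (\<lambda>p. free_gen K s p \<odot>\<^bsub>V\<^esub> \<beta> p) {s}"
    by (rule free_lift_eq[OF free_gen_closed[OF V.R.is_cring s]]) (use s in \<open>auto simp: free_gen_def\<close>)
  also have "\<dots> = \<beta> s" using val[OF s] by (simp add: free_gen_def)
  finally show ?thesis .
qed

end


section \<open>The universal property of the tensor product\<close>

lemma tensor_sel:
  "carrier (tensor K A B) = carrier (tensor_space K A B)"
  "add (tensor K A B) = add (tensor_space K A B)"
  "zero (tensor K A B) = zero (tensor_space K A B)"
  "smult (tensor K A B) = smult (tensor_space K A B)"
  "grade (tensor K A B) n = submodule_span K (tensor_space K A B)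
      {pure_tensor K A B a b | a b i j. a \<in> grade A i \<and> b \<in> grade B j \<and> i + j = n}"
  by (simp_all add: tensor_def module.defs gmodule.defs)

text \<open>Modules are records that may carry further fields (a grading, actions, a multiplication without
  meaning), so a structure has to be moved between records that agree on the four module operations.\<close>

lemma module_cong:
  assumes "module K V" and "carrier W = carrier V" and "add W = add V" and "zero W = zero V"
    and "smult W = smult V"
  shows "module K W"
proof -
  interpret V: module K V by fact
  have "abelian_group W"
    by (rule abelian_groupI) (use assms V.a_ac V.l_neg in \<open>auto intro!: bexI[of _ "\<ominus>\<^bsub>V\<^esub> x" for x]\<close>)
  then show ?thesis
    by (rule moduleI[OF V.R.is_cring])
      (use assms V.smult_l_distr V.smult_r_distr V.smult_assoc1 in auto)
qed

context
  fixes K :: "('k, 'l) ring_scheme" and A :: "('k, 'a, 'm) gmodule_scheme"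
    and B :: "('k, 'b, 'n) gmodule_scheme"
  assumes A: "module K A" and B: "module K B"
begin

interpretation A: module K A by (fact A)
interpretation B: module K B by (fact B)

private abbreviation "F \<equiv> free_module K (carrier A \<times> carrier B)"
private abbreviation "N \<equiv> tensor_kernel K A B"

interpretation F: module K F by (rule free_module_module) (rule A.R.is_cring)

private lemma gen: "a \<in> carrier A \<Longrightarrow> b \<in> carrier B \<Longrightarrow> free_gen K (a, b) \<in> carrier F"
  by (rule free_gen_closed[OF A.R.is_cring]) simp

private lemma relations: "bilinear_relations K A B \<subseteq> carrier F"
  unfolding bilinear_relations_def Let_def
  by (intro Un_least subsetI; elim CollectE exE conjE) (simp_all add: gen)

private lemma kernel: "submodule N K F"
  unfolding tensor_kernel_def using relations by (rule submodule_span_submodule[OF F.module_axioms])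

interpretation N: abelian_subgroup N F
  using submodule.axioms(1)[OF kernel]
  by (intro abelian_subgroupI3 additive_subgroupI F.abelian_group_axioms)

lemma tensor_module: "module K (tensor K A B)"
proof (rule module_cong)
  show "module K (tensor_space K A B)"
    unfolding tensor_space_def by (rule quotient_is_module[OF F.module_axioms kernel])
qed (simp_all add: tensor_sel)

private lemma coset_eqI:
  assumes "x \<ominus>\<^bsub>F\<^esub> y \<in> bilinear_relations K A B" and "x \<in> carrier F" and "y \<in> carrier F"
  shows "N +>\<^bsub>F\<^esub> x = N +>\<^bsub>F\<^esub> y"
proof -
  have "x \<oplus>\<^bsub>F\<^esub> \<ominus>\<^bsub>F\<^esub> y \<in> N"
    using subsetD[OF submodule_span_superset assms(1)] by (simp add: tensor_kernel_def a_minus_def)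
  then have "x \<in> N +>\<^bsub>F\<^esub> y" by (rule N.a_rcos_module_rev[OF assms(3,2)])
  then show ?thesis using N.a_repr_independence'[OF _ assms(3)] by simp
qed

lemma pure_tensor_bilinear: "pure_tensor K A B \<in> bilinear_maps K A B (tensor K A B)"
proof -
  note q = quotient_carrier[OF F.module_axioms kernel] quotient_add[OF F.module_axioms kernel]
    quotient_smult[OF F.module_axioms kernel]
  have cl: "pure_tensor K A B a b \<in> carrier (tensor K A B)"
    if "a \<in> carrier A" "b \<in> carrier B" for a b
    using gen[OF that] by (auto simp: pure_tensor_def tensor_sel tensor_space_def q)
  note rels = bilinear_relations_def[of K A B, unfolded Let_def]
  have rel: "free_gen K (a \<oplus>\<^bsub>A\<^esub> a', b) \<ominus>\<^bsub>F\<^esub> (free_gen K (a, b) \<oplus>\<^bsub>F\<^esub> free_gen K (a', b))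
      \<in> bilinear_relations K A B"
    if "a \<in> carrier A" "a' \<in> carrier A" "b \<in> carrier B" for a a' b
    unfolding rels by (rule UnI1, rule UnI1, rule UnI1) (use that in blast)
  have rel2: "free_gen K (a, b \<oplus>\<^bsub>B\<^esub> b') \<ominus>\<^bsub>F\<^esub> (free_gen K (a, b) \<oplus>\<^bsub>F\<^esub> free_gen K (a, b'))
      \<in> bilinear_relations K A B"
    if "a \<in> carrier A" "b \<in> carrier B" "b' \<in> carrier B" for a b b'
    unfolding rels by (rule UnI1, rule UnI1, rule UnI2) (use that in blast)
  have rel3: "free_gen K (r \<odot>\<^bsub>A\<^esub> a, b) \<ominus>\<^bsub>F\<^esub> (r \<odot>\<^bsub>F\<^esub> free_gen K (a, b)) \<in> bilinear_relations K A B"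
    if "r \<in> carrier K" "a \<in> carrier A" "b \<in> carrier B" for r a b
    unfolding rels by (rule UnI1, rule UnI2) (use that in blast)
  have rel4: "free_gen K (a, r \<odot>\<^bsub>B\<^esub> b) \<ominus>\<^bsub>F\<^esub> (r \<odot>\<^bsub>F\<^esub> free_gen K (a, b)) \<in> bilinear_relations K A B"
    if "r \<in> carrier K" "a \<in> carrier A" "b \<in> carrier B" for r a b
    unfolding rels by (rule UnI2) (use that in blast)
  show ?thesis
  proof (intro bilinear_mapsI linear_mapsI cl)
    fix a b b' assume x: "a \<in> carrier A" "b \<in> carrier B" "b' \<in> carrier B"
    show "pure_tensor K A B a (b \<oplus>\<^bsub>B\<^esub> b')
        = pure_tensor K A B a b \<oplus>\<^bsub>tensor K A B\<^esub> pure_tensor K A B a b'"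
      using coset_eqI[OF rel2[OF x]] gen x by (simp add: pure_tensor_def tensor_sel tensor_space_def q)
  next
    fix a r b assume x: "a \<in> carrier A" "r \<in> carrier K" "b \<in> carrier B"
    show "pure_tensor K A B a (r \<odot>\<^bsub>B\<^esub> b) = r \<odot>\<^bsub>tensor K A B\<^esub> pure_tensor K A B a b"
      using coset_eqI[OF rel4[OF x(2,1,3)]] gen x
      by (simp add: pure_tensor_def tensor_sel tensor_space_def q)
  next
    fix b a a' assume x: "b \<in> carrier B" "a \<in> carrier A" "a' \<in> carrier A"
    show "pure_tensor K A B (a \<oplus>\<^bsub>A\<^esub> a') b
        = pure_tensor K A B a b \<oplus>\<^bsub>tensor K A B\<^esub> pure_tensor K A B a' b"
      using coset_eqI[OF rel[OF x(2,3,1)]] gen x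
      by (simp add: pure_tensor_def tensor_sel tensor_space_def q)
  next
    fix b r a assume x: "b \<in> carrier B" "r \<in> carrier K" "a \<in> carrier A"
    show "pure_tensor K A B (r \<odot>\<^bsub>A\<^esub> a) b = r \<odot>\<^bsub>tensor K A B\<^esub> pure_tensor K A B a b"
      using coset_eqI[OF rel3[OF x(2,3,1)]] gen x
      by (simp add: pure_tensor_def tensor_sel tensor_space_def q)
  qed
qed

text \<open>Scalars can be absorbed into the first factor, so sums of pure tensors already exhaust the
  tensor product.\<close>

lemma tensor_induct [consumes 1, case_names pure add]:
  assumes "x \<in> carrier (tensor K A B)"
    and pure: "\<And>a b. a \<in> carrier A \<Longrightarrow> b \<in> carrier B \<Longrightarrow> P (pure_tensor K A B a b)"
    and add: "\<And>x y. x \<in> carrier (tensor K A B) \<Longrightarrow> y \<in> carrier (tensor K A B)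
        \<Longrightarrow> P x \<Longrightarrow> P y \<Longrightarrow> P (x \<oplus>\<^bsub>tensor K A B\<^esub> y)"
  shows "P x"
proof -
  note q = quotient_carrier[OF F.module_axioms kernel] quotient_add[OF F.module_axioms kernel]
    quotient_smult[OF F.module_axioms kernel] quotient_zero[OF F.module_axioms kernel]
  have smult: "P (N +>\<^bsub>F\<^esub> (r \<odot>\<^bsub>F\<^esub> free_gen K (a, b)))"
    if "r \<in> carrier K" "a \<in> carrier A" "b \<in> carrier B" for r a b
  proof -
    have "N +>\<^bsub>F\<^esub> (r \<odot>\<^bsub>F\<^esub> free_gen K (a, b)) = pure_tensor K A B (r \<odot>\<^bsub>A\<^esub> a) b"
      using linear_mapsD(3)[OF bilinear_mapsD(2)[OF pure_tensor_bilinear that(3)] that(1,2)] gen that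
      by (simp add: pure_tensor_def tensor_sel tensor_space_def q)
    then show ?thesis using pure that by simp
  qed
  obtain f where f: "f \<in> carrier F" and x: "x = N +>\<^bsub>F\<^esub> f"
    using assms(1) by (auto simp: tensor_sel tensor_space_def q)
  have "P (N +>\<^bsub>F\<^esub> f)"
    using A.R.is_cring f
  proof (induction f rule: free_module_induct)
    case zero
    have "free_gen K (\<zero>\<^bsub>A\<^esub>, \<zero>\<^bsub>B\<^esub>) \<in> carrier F" by (rule gen) auto
    then show ?case using smult[of "\<zero>\<^bsub>K\<^esub>" "\<zero>\<^bsub>A\<^esub>" "\<zero>\<^bsub>B\<^esub>"] by simp
  next
    case (add f g)
    show ?case
      using assms(3)[OF _ _ add(3,4)] add(1,2) by (simp add: tensor_sel tensor_space_def q)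
  next
    case (gen r s)
    then show ?case using smult by (cases s) auto
  qed
  then show ?thesis using x by simp
qed

text \<open>The linear extension of a bilinear map to formal combinations kills the bilinear relations and
  hence the whole kernel, so it is constant on cosets and the arbitrary representative in
  \<open>tensor_lift\<close> does no harm.\<close>

lemma
  assumes V: "module K V" and \<beta>: "\<beta> \<in> bilinear_maps K A B V"
  shows tensor_lift_linear: "tensor_lift K V \<beta> \<in> linear_maps K (tensor K A B) V"
    and tensor_lift_pure: "\<And>a b. a \<in> carrier A \<Longrightarrow> b \<in> carrier B \<Longrightarrow>
      tensor_lift K V \<beta> (pure_tensor K A B a b) = \<beta> a b"
proof -
  interpret V: module K V by fact
  let ?\<phi> = "free_lift K V (\<lambda>p. \<beta> (fst p) (snd p))"
  note q = quotient_carrier[OF F.module_axioms kernel] quotient_add[OF F.module_axioms kernel]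
    quotient_smult[OF F.module_axioms kernel]
  note \<beta>l = bilinear_mapsD(2)[OF \<beta>] and \<beta>r = bilinear_mapsD(1)[OF \<beta>]
  note cl = bilinear_maps_closed[OF \<beta>]
  have val: "\<beta> (fst p) (snd p) \<in> carrier V" if "p \<in> carrier A \<times> carrier B" for p
    using cl that by auto
  note lin = free_lift_linear[where S = "carrier A \<times> carrier B", OF V val]
  have \<phi>_gen: "?\<phi> (free_gen K (a, b)) = \<beta> a b" if "a \<in> carrier A" "b \<in> carrier B" for a b
    using free_lift_gen[where S = "carrier A \<times> carrier B", OF V val] that by simp
  have \<phi>_minus: "?\<phi> (x \<ominus>\<^bsub>F\<^esub> y) = ?\<phi> x \<ominus>\<^bsub>V\<^esub> ?\<phi> y" if "x \<in> carrier F" "y \<in> carrier F" for x y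
    using linear_maps_minus[OF F.module_axioms V lin that] by simp
  have rel: "?\<phi> x \<in> {\<zero>\<^bsub>V\<^esub>}" if "x \<in> bilinear_relations K A B" for x
    using that unfolding bilinear_relations_def Let_def
    by (auto simp: \<phi>_minus \<phi>_gen gen linear_mapsD[OF lin] linear_mapsD(2,3)[OF \<beta>l]
        linear_mapsD(2,3)[OF \<beta>r] cl a_minus_def[of V] V.r_neg)
  have ker: "?\<phi> x = \<zero>\<^bsub>V\<^esub>" if "x \<in> N" for x
    using linear_maps_span[OF F.module_axioms V lin submodule_singleton_zero[OF V] relations rel]
      that unfolding tensor_kernel_def by auto
  have lift: "tensor_lift K V \<beta> (N +>\<^bsub>F\<^esub> f) = ?\<phi> f" if f: "f \<in> carrier F" for f
  proof -
    define g where "g = (SOME g. g \<in> N +>\<^bsub>F\<^esub> f)"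
    have "g \<in> N +>\<^bsub>F\<^esub> f" unfolding g_def using N.a_rcos_self[OF f] by (rule someI[of "\<lambda>g. g \<in> N +>\<^bsub>F\<^esub> f"])
    then have "g \<in> carrier F" "g \<oplus>\<^bsub>F\<^esub> \<ominus>\<^bsub>F\<^esub> f \<in> N"
      using N.a_elemrcos_carrier[OF f] N.a_rcos_module_imp[OF f] by auto
    then have "?\<phi> g \<ominus>\<^bsub>V\<^esub> ?\<phi> f = \<zero>\<^bsub>V\<^esub>"
      using ker \<phi>_minus[OF _ f, symmetric] by (simp add: a_minus_def[of F])
    then have "?\<phi> g = ?\<phi> f"
      using linear_mapsD(1)[OF lin] f \<open>g \<in> carrier F\<close> V.minus_equality[of "?\<phi> g" "\<ominus>\<^bsub>V\<^esub> ?\<phi> f"]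
      by (simp add: a_minus_def)
    then show ?thesis by (simp add: tensor_lift_def g_def Let_def free_lift_def)
  qed
  show "tensor_lift K V \<beta> \<in> linear_maps K (tensor K A B) V"
    by (rule linear_mapsI)
      (auto simp: tensor_sel tensor_space_def q lift linear_mapsD[OF lin])
  show "tensor_lift K V \<beta> (pure_tensor K A B a b) = \<beta> a b"
    if "a \<in> carrier A" "b \<in> carrier B" for a b
    using lift[OF gen[OF that]] \<phi>_gen[OF that] by (simp add: pure_tensor_def)
qed

end

lemma linear_maps_tensor_eqI:
  assumes "module K A" and "module K B"
    and f: "f \<in> linear_maps K (tensor K A B) V" and g: "g \<in> linear_maps K (tensor K A B) V"
    and eq: "\<And>a b. a \<in> carrier A \<Longrightarrow> b \<in> carrier B
      \<Longrightarrow> f (pure_tensor K A B a b) = g (pure_tensor K A B a b)"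
    and "x \<in> carrier (tensor K A B)"
  shows "f x = g x"
  by (rule tensor_induct[OF assms(1,2,6)]) (simp_all add: eq linear_mapsD[OF f] linear_mapsD[OF g])


section \<open>Gradings\<close>

lemma submodule_cong:
  assumes "carrier W = carrier V" and "add W = add V" and "zero W = zero V" and "smult W = smult V"
  shows "submodule N K W \<longleftrightarrow> submodule N K V"
  using assms by (simp add: submodule_def submodule_axioms_def subgroup_def m_inv_def)

lemma graded_module_cong:
  assumes "graded_module K V" and "carrier W = carrier V" and "add W = add V"
    and "zero W = zero V" and "smult W = smult V" and "grade W = grade V"
  shows "graded_module K W"
proof -
  interpret V: graded_module K V by fact
  have "homogeneous_decomp W x f \<longleftrightarrow> homogeneous_decomp V x f" for x f
    using assms by (simp add: homogeneous_decomp_def finsum_def finprod_def)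
  then show ?thesis
    using V.grade_submodule V.ex1_homogeneous_decomp assms(2-6)
    by (intro graded_module.intro graded_module_axioms.intro module_cong[OF V.module_axioms])
      (simp_all add: submodule_cong[of W V])
qed

lemma graded_mapsD:
  assumes "f \<in> graded_maps K V W q"
  shows "f \<in> linear_maps K V W" and "x \<in> grade V n \<Longrightarrow> f x \<in> grade W (n + q)"
  using assms by (simp_all add: graded_maps_def)

lemma graded_mapsI:
  assumes "f \<in> linear_maps K V W" and "\<And>x n. x \<in> grade V n \<Longrightarrow> f x \<in> grade W (n + q)"
  shows "f \<in> graded_maps K V W q"
  using assms by (simp add: graded_maps_def)

lemma graded_maps_comp:
  assumes "f \<in> graded_maps K U V p" and "g \<in> graded_maps K V W q"
  shows "(\<lambda>x. g (f x)) \<in> graded_maps K U W (p + q)"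
  using linear_maps_comp[OF graded_mapsD(1)[OF assms(1)] graded_mapsD(1)[OF assms(2)]]
    graded_mapsD(2)[OF assms(2) graded_mapsD(2)[OF assms(1)]]
  by (intro graded_mapsI) (simp_all add: add.assoc)

lemma graded_maps_id: "id \<in> graded_maps K V V 0"
  by (simp add: graded_maps_def linear_maps_id)

text \<open>The linear map that is \<open>g n\<close> in degree \<open>n\<close>. Both the sign maps and the projections of a tensor
  product onto its homogeneous parts are of this form, so that the linearity of such a sum, whose
  range varies with \<open>x\<close>, is proved once.\<close>

definition graded_sum :: "('k, 'v, 'm) gmodule_scheme \<Rightarrow> ('k, 'w, 'n) module_scheme
    \<Rightarrow> (int \<Rightarrow> 'v \<Rightarrow> 'w) \<Rightarrow> 'v \<Rightarrow> 'w"
  where "graded_sum M V g x =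
    finsum V (\<lambda>n. g n (homogeneous_part M x n)) {n. homogeneous_part M x n \<noteq> \<zero>\<^bsub>M\<^esub>}"

context graded_module
begin

lemma grade_closed: "x \<in> grade M n \<Longrightarrow> x \<in> carrier M"
  using submoduleE(1)[OF grade_submodule] by blast

lemma zero_grade: "\<zero>\<^bsub>M\<^esub> \<in> grade M n"
  using subgroup.one_closed[OF submodule.axioms(1)[OF grade_submodule]] by simp

lemmas neg_grade = submoduleE(3)[OF grade_submodule]
  and smult_grade = submoduleE(4)[OF grade_submodule]
  and add_grade = submoduleE(5)[OF grade_submodule]

lemma homogeneous_decomp_part:
  assumes "x \<in> carrier M"
  shows "homogeneous_decomp M x (homogeneous_part M x)"
  unfolding homogeneous_part_def by (rule theI'[OF ex1_homogeneous_decomp[OF assms]])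

lemma homogeneous_part_grade: "x \<in> carrier M \<Longrightarrow> homogeneous_part M x n \<in> grade M n"
  and finite_support: "x \<in> carrier M \<Longrightarrow> finite {n. homogeneous_part M x n \<noteq> \<zero>\<^bsub>M\<^esub>}"
  and homogeneous_part_sum: "x \<in> carrier M \<Longrightarrow>
    finsum M (homogeneous_part M x) {n. homogeneous_part M x n \<noteq> \<zero>\<^bsub>M\<^esub>} = x"
  using homogeneous_decomp_part by (auto simp: homogeneous_decomp_def)

lemma homogeneous_part_closed: "x \<in> carrier M \<Longrightarrow> homogeneous_part M x n \<in> carrier M"
  using grade_closed homogeneous_part_grade by blast

lemma homogeneous_partI:
  assumes f: "\<And>n. f n \<in> grade M n" and S: "finite S" "\<And>n. n \<notin> S \<Longrightarrow> f n = \<zero>\<^bsub>M\<^esub>"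
    and x: "x = finsum M f S"
  shows "homogeneous_part M x = f"
proof -
  have supp: "{n. f n \<noteq> \<zero>\<^bsub>M\<^esub>} \<subseteq> S" using S by blast
  have fM: "f n \<in> carrier M" for n using f grade_closed by blast
  have "finsum M f {n. f n \<noteq> \<zero>\<^bsub>M\<^esub>} = finsum M f S"
    using supp S fM by (intro M.add.finprod_mono_neutral_cong_left) auto
  then have "homogeneous_decomp M x f"
    using f x finite_subset[OF supp S(1)] by (simp add: homogeneous_decomp_def)
  moreover have "x \<in> carrier M" using x fM by (simp add: Pi_def)
  ultimately show ?thesis
    unfolding homogeneous_part_def by (intro the1_equality[OF ex1_homogeneous_decomp])
qed

lemma homogeneous_part_sum_superset:
  assumes "x \<in> carrier M" and "finite S" and "{n. homogeneous_part M x n \<noteq> \<zero>\<^bsub>M\<^esub>} \<subseteq> S"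
  shows "finsum M (homogeneous_part M x) S = x"
proof -
  have "finsum M (homogeneous_part M x) {n. homogeneous_part M x n \<noteq> \<zero>\<^bsub>M\<^esub>}
      = finsum M (homogeneous_part M x) S"
    using assms homogeneous_part_closed[OF assms(1)]
    by (intro M.add.finprod_mono_neutral_cong_left) auto
  then show ?thesis using homogeneous_part_sum[OF assms(1)] by simp
qed

lemma homogeneous_part_homogeneous:
  assumes "x \<in> grade M m"
  shows "homogeneous_part M x = (\<lambda>n. if n = m then x else \<zero>\<^bsub>M\<^esub>)"
  using assms zero_grade grade_closed[OF assms]
  by (intro homogeneous_partI[of _ "{m}"]) auto

lemma homogeneous_part_add:
  assumes x: "x \<in> carrier M" and y: "y \<in> carrier M"
  shows "homogeneous_part M (x \<oplus>\<^bsub>M\<^esub> y) = (\<lambda>n. homogeneous_part M x n \<oplus>\<^bsub>M\<^esub> homogeneous_part M y n)"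
proof -
  let ?S = "{n. homogeneous_part M x n \<noteq> \<zero>\<^bsub>M\<^esub>} \<union> {n. homogeneous_part M y n \<noteq> \<zero>\<^bsub>M\<^esub>}"
  have S: "finite ?S" using finite_support x y by simp
  have "finsum M (\<lambda>n. homogeneous_part M x n \<oplus>\<^bsub>M\<^esub> homogeneous_part M y n) ?S
      = finsum M (homogeneous_part M x) ?S \<oplus>\<^bsub>M\<^esub> finsum M (homogeneous_part M y) ?S"
    by (rule M.finsum_addf) (simp_all add: homogeneous_part_closed x y)
  also have "\<dots> = x \<oplus>\<^bsub>M\<^esub> y"
    using homogeneous_part_sum_superset[OF x S] homogeneous_part_sum_superset[OF y S] by simp
  finally show ?thesis
    using homogeneous_part_grade x y by (intro homogeneous_partI[OF _ S]) (auto intro!: add_grade)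
qed

lemma homogeneous_part_smult:
  assumes r: "r \<in> carrier K" and x: "x \<in> carrier M"
  shows "homogeneous_part M (r \<odot>\<^bsub>M\<^esub> x) = (\<lambda>n. r \<odot>\<^bsub>M\<^esub> homogeneous_part M x n)"
proof (rule homogeneous_partI)
  show "finite {n. homogeneous_part M x n \<noteq> \<zero>\<^bsub>M\<^esub>}" by (rule finite_support[OF x])
  show "r \<odot>\<^bsub>M\<^esub> x
      = finsum M (\<lambda>n. r \<odot>\<^bsub>M\<^esub> homogeneous_part M x n) {n. homogeneous_part M x n \<noteq> \<zero>\<^bsub>M\<^esub>}"
    using finsum_smult_ldistr[OF finite_support[OF x] r, of "homogeneous_part M x"]
      homogeneous_part_closed[OF x] homogeneous_part_sum[OF x] by simp
qed (use r x homogeneous_part_grade in \<open>auto intro!: smult_grade\<close>)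

lemma homogeneous_part_linear: "(\<lambda>x. homogeneous_part M x n) \<in> linear_maps K M M"
  by (rule linear_mapsI)
    (simp_all add: homogeneous_part_closed homogeneous_part_add homogeneous_part_smult)

lemma graded_induct [consumes 1, case_names homogeneous add]:
  assumes "x \<in> carrier M"
    and homogeneous: "\<And>n x. x \<in> grade M n \<Longrightarrow> P x"
    and add: "\<And>x y. x \<in> carrier M \<Longrightarrow> y \<in> carrier M \<Longrightarrow> P x \<Longrightarrow> P y \<Longrightarrow> P (x \<oplus>\<^bsub>M\<^esub> y)"
  shows "P x"
proof -
  have cl: "homogeneous_part M x n \<in> carrier M" for n
    by (rule homogeneous_part_closed[OF assms(1)])
  have "P (finsum M (homogeneous_part M x) S)" if "finite S" for S
    using that
  proof (induction S rule: finite_induct)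
    case empty
    show ?case using homogeneous[OF zero_grade[of 0]] by simp
  next
    case (insert n S)
    then show ?case
      using homogeneous[OF homogeneous_part_grade[OF assms(1)], of n] cl
      by (simp add: add M.finsum_closed Pi_def)
  qed
  from this[OF finite_support[OF assms(1)]] show ?thesis
    using homogeneous_part_sum[OF assms(1)] by simp
qed

lemma linear_maps_graded_eqI:
  assumes f: "f \<in> linear_maps K M V" and g: "g \<in> linear_maps K M V"
    and eq: "\<And>n x. x \<in> grade M n \<Longrightarrow> f x = g x" and x: "x \<in> carrier M"
  shows "f x = g x"
  using x by (induction x rule: graded_induct) (simp_all add: eq linear_mapsD[OF f] linear_mapsD[OF g])

lemma graded_sum_superset:
  assumes V: "module K V" and g: "\<And>n. g n \<in> linear_maps K M V" and x: "x \<in> carrier M"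
    and "finite S" and "{n. homogeneous_part M x n \<noteq> \<zero>\<^bsub>M\<^esub>} \<subseteq> S"
  shows "graded_sum M V g x = finsum V (\<lambda>n. g n (homogeneous_part M x n)) S"
proof -
  interpret V: module K V by fact
  show ?thesis
    unfolding graded_sum_def using assms(4,5)
    by (intro V.add.finprod_mono_neutral_cong_left)
      (auto simp: linear_maps_zero[OF module_axioms V g] intro!: linear_mapsD(1)[OF g]
        homogeneous_part_closed[OF x])
qed

lemma graded_sum_linear:
  assumes V: "module K V" and g: "\<And>n. g n \<in> linear_maps K M V"
  shows "graded_sum M V g \<in> linear_maps K M V"
proof -
  interpret V: module K V by fact
  note cl = linear_mapsD(1)[OF g homogeneous_part_closed]
  note sup = graded_sum_superset[OF V g]
  show ?thesis
  proof (rule linear_mapsI)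
    fix x assume x: "x \<in> carrier M"
    show "graded_sum M V g x \<in> carrier V"
      unfolding graded_sum_def using cl[OF x] by (intro V.finsum_closed) auto
    let ?X = "{n. homogeneous_part M x n \<noteq> \<zero>\<^bsub>M\<^esub>}"
    {
      fix y assume y: "y \<in> carrier M"
      let ?S = "?X \<union> {n. homogeneous_part M y n \<noteq> \<zero>\<^bsub>M\<^esub>}"
      have S: "finite ?S" using finite_support x y by simp
      have "{n. homogeneous_part M (x \<oplus>\<^bsub>M\<^esub> y) n \<noteq> \<zero>\<^bsub>M\<^esub>} \<subseteq> ?S"
        using x y by (auto simp: homogeneous_part_add)
      then have "graded_sum M V g (x \<oplus>\<^bsub>M\<^esub> y)
          = finsum V (\<lambda>n. g n (homogeneous_part M x n) \<oplus>\<^bsub>V\<^esub> g n (homogeneous_part M y n)) ?S"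
        using x y sup[OF _ S, of "x \<oplus>\<^bsub>M\<^esub> y"]
        by (simp add: homogeneous_part_add linear_mapsD(2)[OF g] homogeneous_part_closed)
      also have "\<dots> = finsum V (\<lambda>n. g n (homogeneous_part M x n)) ?S
          \<oplus>\<^bsub>V\<^esub> finsum V (\<lambda>n. g n (homogeneous_part M y n)) ?S"
        by (rule V.finsum_addf) (use cl x y in auto)
      also have "\<dots> = graded_sum M V g x \<oplus>\<^bsub>V\<^esub> graded_sum M V g y"
        using sup[OF x S] sup[OF y S] by simp
      finally show "graded_sum M V g (x \<oplus>\<^bsub>M\<^esub> y) = graded_sum M V g x \<oplus>\<^bsub>V\<^esub> graded_sum M V g y" .
    }
    fix r assume r: "r \<in> carrier K"
    have "{n. homogeneous_part M (r \<odot>\<^bsub>M\<^esub> x) n \<noteq> \<zero>\<^bsub>M\<^esub>} \<subseteq> ?X"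
      using r x by (auto simp: homogeneous_part_smult)
    then have "graded_sum M V g (r \<odot>\<^bsub>M\<^esub> x) = finsum V (\<lambda>n. r \<odot>\<^bsub>V\<^esub> g n (homogeneous_part M x n)) ?X"
      using r x sup[OF _ finite_support[OF x], of "r \<odot>\<^bsub>M\<^esub> x"]
      by (simp add: homogeneous_part_smult linear_mapsD(3)[OF g] homogeneous_part_closed)
    also have "\<dots> = r \<odot>\<^bsub>V\<^esub> graded_sum M V g x"
      unfolding graded_sum_def using cl[OF x]
      by (intro V.finsum_smult_ldistr[symmetric] finite_support[OF x] r) auto
    finally show "graded_sum M V g (r \<odot>\<^bsub>M\<^esub> x) = r \<odot>\<^bsub>V\<^esub> graded_sum M V g x" .
  qed
qed

lemma graded_sum_homogeneous:
  assumes V: "module K V" and g: "\<And>n. g n \<in> linear_maps K M V" and x: "x \<in> grade M n"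
  shows "graded_sum M V g x = g n x"
proof -
  interpret V: module K V by fact
  have "graded_sum M V g x = finsum V (\<lambda>n. g n (homogeneous_part M x n)) {n}"
    by (rule graded_sum_superset[OF V g grade_closed[OF x]])
      (auto simp: homogeneous_part_homogeneous[OF x])
  also have "\<dots> = g n x"
    using linear_mapsD(1)[OF g grade_closed[OF x], of n] by (simp add: homogeneous_part_homogeneous[OF x])
  finally show ?thesis .
qed

lemma koszul_eq_graded_sum:
  "koszul M q = graded_sum M M (\<lambda>n x. if even (q * n) then x else \<ominus>\<^bsub>M\<^esub> x)"
  by (simp add: fun_eq_iff koszul_def graded_sum_def)

lemma koszul_linear: "koszul M q \<in> linear_maps K M M"
  and koszul_homogeneous:
    "x \<in> grade M n \<Longrightarrow> koszul M q x = (if even (q * n) then x else \<ominus>\<^bsub>M\<^esub> x)"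
proof -
  have lin: "(\<lambda>x. if even (q * n) then x else \<ominus>\<^bsub>M\<^esub> x) \<in> linear_maps K M M" for n
    using linear_maps_id[of K M] linear_maps_neg[OF module_axioms linear_maps_id[of K M]]
    by (cases "even (q * n)") (simp_all only: id_def if_True if_False)
  show "koszul M q \<in> linear_maps K M M"
    unfolding koszul_eq_graded_sum by (rule graded_sum_linear[OF module_axioms lin])
  show "x \<in> grade M n \<Longrightarrow> koszul M q x = (if even (q * n) then x else \<ominus>\<^bsub>M\<^esub> x)"
    unfolding koszul_eq_graded_sum by (rule graded_sum_homogeneous[OF module_axioms lin])
qed

lemma koszul_graded: "koszul M q \<in> graded_maps K M M 0"
  by (rule graded_mapsI[OF koszul_linear]) (simp add: koszul_homogeneous neg_grade)

lemma koszul_closed: "x \<in> carrier M \<Longrightarrow> koszul M q x \<in> carrier M"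
  using linear_mapsD(1)[OF koszul_linear] .

lemma koszul_even: "even q \<Longrightarrow> x \<in> carrier M \<Longrightarrow> koszul M q x = x"
  by (rule linear_maps_graded_eqI[OF koszul_linear linear_maps_id, unfolded id_def])
    (simp_all add: koszul_homogeneous)

lemma koszul_odd: "odd q \<Longrightarrow> x \<in> carrier M \<Longrightarrow> koszul M q x = koszul M 1 x"
  by (rule linear_maps_graded_eqI[OF koszul_linear koszul_linear])
    (simp_all add: koszul_homogeneous)

lemma koszul_koszul: "x \<in> carrier M \<Longrightarrow> koszul M 1 (koszul M 1 x) = x"
proof (rule linear_maps_graded_eqI[OF linear_maps_comp[OF koszul_linear koszul_linear] linear_maps_id,
      unfolded id_def])
  fix n x assume x: "x \<in> grade M n"
  then have "\<ominus>\<^bsub>M\<^esub> x \<in> grade M n" by (rule neg_grade)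
  then show "koszul M 1 (koszul M 1 x) = x"
    using x grade_closed[OF x] by (simp add: koszul_homogeneous)
qed

end

lemma koszul_natural_even:
  assumes "graded_module K V" and "graded_module K W" and f: "f \<in> graded_maps K V W p" and "even p"
    and x: "x \<in> carrier V"
  shows "f (koszul V q x) = koszul W q (f x)"
proof -
  interpret V: graded_module K V by fact
  interpret W: graded_module K W by fact
  note fl = graded_mapsD(1)[OF f]
  show ?thesis
  proof (rule V.linear_maps_graded_eqI[OF linear_maps_comp[OF V.koszul_linear fl]
        linear_maps_comp[OF fl W.koszul_linear] _ x])
    fix n x assume x: "x \<in> grade V n"
    then show "f (koszul V q x) = koszul W q (f x)"
      using graded_mapsD(2)[OF f x] \<open>even p\<close> V.grade_closed[OF x]
      by (simp add: V.koszul_homogeneous W.koszul_homogeneous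
        linear_maps_uminus[OF V.module_axioms W.module_axioms fl])
  qed
qed

text \<open>An odd map changes the parity of the degree, so the signs before and after it differ.\<close>

lemma koszul_natural_odd:
  assumes "graded_module K V" and "graded_module K W" and f: "f \<in> graded_maps K V W p" and "odd p"
    and x: "x \<in> carrier V"
  shows "f (koszul V 1 x) = \<ominus>\<^bsub>W\<^esub> koszul W 1 (f x)"
proof -
  interpret V: graded_module K V by fact
  interpret W: graded_module K W by fact
  note fl = graded_mapsD(1)[OF f]
  show ?thesis
  proof (rule V.linear_maps_graded_eqI[OF linear_maps_comp[OF V.koszul_linear fl]
        linear_maps_neg[OF W.module_axioms linear_maps_comp[OF fl W.koszul_linear]] _ x])
    fix n x assume x: "x \<in> grade V n"
    then show "f (koszul V 1 x) = \<ominus>\<^bsub>W\<^esub> koszul W 1 (f x)"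
      using graded_mapsD(2)[OF f x] \<open>odd p\<close> V.grade_closed[OF x] W.grade_closed[OF graded_mapsD(2)[OF f x]]
      by (simp add: V.koszul_homogeneous W.koszul_homogeneous
        linear_maps_uminus[OF V.module_axioms W.module_axioms fl])
  qed
qed

text \<open>Uniqueness of the homogeneous components is obtained from linear projections \<open>p n\<close>, which recover
  the components of any decomposition; existence is an induction over sums of homogeneous elements.\<close>

lemma graded_moduleI:
  assumes "module K M" and sub: "\<And>n. submodule (grade M n) K M"
    and gen: "\<And>P x. \<lbrakk>x \<in> carrier M; \<And>n y. y \<in> grade M n \<Longrightarrow> P y;
        \<And>y z. \<lbrakk>y \<in> carrier M; z \<in> carrier M; P y; P z\<rbrakk> \<Longrightarrow> P (y \<oplus>\<^bsub>M\<^esub> z)\<rbrakk> \<Longrightarrow> P x"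
    and p: "\<And>n. p n \<in> linear_maps K M M"
    and p_id: "\<And>n x. x \<in> grade M n \<Longrightarrow> p n x = x"
    and p_zero: "\<And>n m x. x \<in> grade M m \<Longrightarrow> m \<noteq> n \<Longrightarrow> p n x = \<zero>\<^bsub>M\<^esub>"
  shows "graded_module K M"
proof -
  interpret M: module K M by fact
  have closed: "x \<in> carrier M" if "x \<in> grade M n" for x n
    using M.submoduleE(1)[OF sub] that by blast
  have "f n = p n x" if "homogeneous_decomp M x f" for x f n
  proof -
    let ?S = "{n. f n \<noteq> \<zero>\<^bsub>M\<^esub>}"
    have f: "\<And>n. f n \<in> grade M n" and S: "finite ?S" and x: "x = finsum M f ?S"
      using that by (auto simp: homogeneous_decomp_def)
    have cl: "f n \<in> carrier M" for n using closed f by blast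
    have "p n x = finsum M (\<lambda>m. p n (f m)) ?S"
      unfolding x by (rule linear_maps_finsum[OF M.module_axioms M.module_axioms p S cl])
    also have "\<dots> = finsum M f {n}"
      using S cl f by (intro M.add.finprod_mono_neutral_cong)
        (auto simp: p_id p_zero[OF f] linear_mapsD(1)[OF p])
    also have "\<dots> = f n" using cl by simp
    finally show ?thesis by simp
  qed
  then have unique: "f = (\<lambda>n. p n x)" if "homogeneous_decomp M x f" for x f
    using that by (simp add: fun_eq_iff)
  have decompI: "homogeneous_decomp M x f"
    if f: "\<And>n. f n \<in> grade M n" and S: "finite S" and supp: "{n. f n \<noteq> \<zero>\<^bsub>M\<^esub>} \<subseteq> S"
      and x: "x = finsum M f S" for x f S
  proof -
    have "finsum M f {n. f n \<noteq> \<zero>\<^bsub>M\<^esub>} = finsum M f S"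
      using S supp closed[OF f] by (intro M.add.finprod_mono_neutral_cong_left) auto
    then show ?thesis using f x finite_subset[OF supp S] by (simp add: homogeneous_decomp_def)
  qed
  have "homogeneous_decomp M x (\<lambda>n. p n x)" if "x \<in> carrier M" for x
    using that
  proof (rule gen)
    fix m y assume y: "y \<in> grade M m"
    have eq: "p n y = (if n = m then y else \<zero>\<^bsub>M\<^esub>)" for n using p_id p_zero y by auto
    have "\<zero>\<^bsub>M\<^esub> \<in> grade M n" for n using subgroup.one_closed[OF submodule.axioms(1)[OF sub]] by simp
    with y show "homogeneous_decomp M y (\<lambda>n. p n y)"
      unfolding eq using closed[OF y] by (intro decompI[of _ "{m}"]) auto
  next
    fix y z
    assume y: "y \<in> carrier M" "homogeneous_decomp M y (\<lambda>n. p n y)"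
      and z: "z \<in> carrier M" "homogeneous_decomp M z (\<lambda>n. p n z)"
    let ?Y = "{n. p n y \<noteq> \<zero>\<^bsub>M\<^esub>}" and ?Z = "{n. p n z \<noteq> \<zero>\<^bsub>M\<^esub>}"
    note D = y(2)[unfolded homogeneous_decomp_def] z(2)[unfolded homogeneous_decomp_def]
    have fin: "finite (?Y \<union> ?Z)" using D by simp
    have cl: "\<And>n. p n y \<in> carrier M" "\<And>n. p n z \<in> carrier M" using linear_mapsD(1)[OF p] y z by auto
    have "finsum M (\<lambda>n. p n y) ?Y = finsum M (\<lambda>n. p n y) (?Y \<union> ?Z)"
      "finsum M (\<lambda>n. p n z) ?Z = finsum M (\<lambda>n. p n z) (?Y \<union> ?Z)"
      using fin cl by (intro M.add.finprod_mono_neutral_cong_left; auto)+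
    with D have "y \<oplus>\<^bsub>M\<^esub> z = finsum M (\<lambda>n. p n y) (?Y \<union> ?Z) \<oplus>\<^bsub>M\<^esub> finsum M (\<lambda>n. p n z) (?Y \<union> ?Z)"
      by simp
    also have "\<dots> = finsum M (\<lambda>n. p n y \<oplus>\<^bsub>M\<^esub> p n z) (?Y \<union> ?Z)"
      by (rule M.finsum_addf[symmetric]) (use cl in auto)
    finally show "homogeneous_decomp M (y \<oplus>\<^bsub>M\<^esub> z) (\<lambda>n. p n (y \<oplus>\<^bsub>M\<^esub> z))"
      unfolding linear_mapsD(2)[OF p y(1) z(1)] using D M.submoduleE(5)[OF sub] cl
      by (intro decompI[OF _ fin]) auto
  qed
  then have "\<exists>!f. homogeneous_decomp M x f" if "x \<in> carrier M" for x
    using that unique by blast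
  then show ?thesis
    using sub by (intro graded_module.intro graded_module_axioms.intro M.module_axioms)
qed


section \<open>Tensor products of graded modules\<close>

lemma linear_maps_span_eq:
  assumes V: "module K V" and W: "module K W"
    and f: "f \<in> linear_maps K V W" and g: "g \<in> linear_maps K V W"
    and S: "S \<subseteq> carrier V" and eq: "\<And>x. x \<in> S \<Longrightarrow> f x = g x"
    and x: "x \<in> submodule_span K V S"
  shows "f x = g x"
proof -
  interpret V: module K V by fact
  interpret W: module K W by fact
  have cl: "f y \<in> carrier W" "g y \<in> carrier W" if "y \<in> carrier V" for y
    using linear_mapsD(1)[OF f that] linear_mapsD(1)[OF g that] by auto
  have "f y \<ominus>\<^bsub>W\<^esub> g y \<in> {\<zero>\<^bsub>W\<^esub>}" if "y \<in> S" for y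
    using eq[OF that] cl[of y] S that by (auto simp: a_minus_def W.r_neg)
  from linear_maps_span[OF V W linear_maps_diff[OF W f g] submodule_singleton_zero[OF W] S this x]
  have "f x \<ominus>\<^bsub>W\<^esub> g x = \<zero>\<^bsub>W\<^esub>" by simp
  moreover have "x \<in> carrier V" using submodule_span_least[OF V.carrier_is_submodule S] x by blast
  ultimately show ?thesis
    using cl[of x] W.minus_equality[of "f x" "\<ominus>\<^bsub>W\<^esub> g x"] by (simp add: a_minus_def)
qed

definition homogeneous_tensors ::
  "('k, 'l) ring_scheme \<Rightarrow> ('k, 'a, 'm) gmodule_scheme \<Rightarrow> ('k, 'b, 'n) gmodule_scheme
    \<Rightarrow> int \<Rightarrow> ('a \<times> 'b \<Rightarrow> 'k) set set"
  where "homogeneous_tensors K A B n =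
    {pure_tensor K A B a b | a b i j. a \<in> grade A i \<and> b \<in> grade B j \<and> i + j = n}"

lemma grade_tensor:
  "grade (tensor K A B) n = submodule_span K (tensor K A B) (homogeneous_tensors K A B n)"
proof -
  have "submodule N K (tensor K A B) \<longleftrightarrow> submodule N K (tensor_space K A B)" for N
    by (rule submodule_cong) (simp_all add: tensor_sel)
  then show ?thesis by (simp only: tensor_sel submodule_span_def homogeneous_tensors_def)
qed

context
  fixes K :: "('k, 'l) ring_scheme" and A :: "('k, 'a, 'm) gmodule_scheme"
    and B :: "('k, 'b, 'n) gmodule_scheme"
  assumes gA: "graded_module K A" and gB: "graded_module K B"
begin

interpretation A: graded_module K A by (fact gA)
interpretation B: graded_module K B by (fact gB)

private abbreviation "T \<equiv> tensor K A B"

interpretation T: module K T by (rule tensor_module[OF A.module_axioms B.module_axioms])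

private lemma pure: "pure_tensor K A B \<in> bilinear_maps K A B T"
  by (rule pure_tensor_bilinear[OF A.module_axioms B.module_axioms])

lemma homogeneous_tensors_closed: "homogeneous_tensors K A B n \<subseteq> carrier T"
  using bilinear_maps_closed[OF pure] A.grade_closed B.grade_closed
  by (auto simp: homogeneous_tensors_def)

lemma pure_tensor_grade:
  "a \<in> grade A i \<Longrightarrow> b \<in> grade B j \<Longrightarrow> pure_tensor K A B a b \<in> grade T (i + j)"
  unfolding grade_tensor
  by (rule subsetD[OF submodule_span_superset]) (auto simp: homogeneous_tensors_def)

lemma linear_maps_tensor_graded:
  assumes V: "module K V" and f: "f \<in> linear_maps K T V" and N: "submodule N K V"
    and "\<And>i j a b. a \<in> grade A i \<Longrightarrow> b \<in> grade B j \<Longrightarrow> i + j = n \<Longrightarrow> f (pure_tensor K A B a b) \<in> N"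
    and x: "x \<in> grade T n"
  shows "f x \<in> N"
  by (rule linear_maps_span[OF T.module_axioms V f N homogeneous_tensors_closed _ x[unfolded grade_tensor]])
    (use assms(4) in \<open>auto simp: homogeneous_tensors_def\<close>)

text \<open>The projection onto degree \<open>n\<close>: \<open>a \<otimes> b\<close> is sent to the sum of all \<open>a\<^sub>i \<otimes> b\<^sub>j\<close> with
  \<open>i + j = n\<close>.\<close>

private definition part :: "int \<Rightarrow> ('a \<times> 'b \<Rightarrow> 'k) set \<Rightarrow> ('a \<times> 'b \<Rightarrow> 'k) set"
  where "part n = tensor_lift K T
    (\<lambda>a b. graded_sum A T (\<lambda>i a. pure_tensor K A B a (homogeneous_part B b (n - i))) a)"

private lemma part_bilinear:
  "(\<lambda>a b. graded_sum A T (\<lambda>i a. pure_tensor K A B a (homogeneous_part B b (n - i))) a)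
    \<in> bilinear_maps K A B T"
proof (rule bilinear_mapsI)
  fix b assume "b \<in> carrier B"
  then show "(\<lambda>a. graded_sum A T (\<lambda>i a. pure_tensor K A B a (homogeneous_part B b (n - i))) a)
      \<in> linear_maps K A T"
    using A.graded_sum_linear[OF T.module_axioms bilinear_mapsD(2)[OF pure B.homogeneous_part_closed]]
    by simp
next
  fix a assume a: "a \<in> carrier A"
  show "(\<lambda>b. graded_sum A T (\<lambda>i a. pure_tensor K A B a (homogeneous_part B b (n - i))) a)
      \<in> linear_maps K B T"
    unfolding graded_sum_def
    by (rule linear_maps_finsum_pointwise[OF T.module_axioms A.finite_support[OF a] _ B.module_axioms])
      (rule linear_maps_comp[OF B.homogeneous_part_linear
          bilinear_mapsD(1)[OF pure A.homogeneous_part_closed[OF a]]])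
qed

private lemma part_linear: "part n \<in> linear_maps K T T"
  unfolding part_def
  by (rule tensor_lift_linear[OF A.module_axioms B.module_axioms T.module_axioms part_bilinear])

private lemma part_pure:
  assumes a: "a \<in> grade A i" and b: "b \<in> grade B j"
  shows "part n (pure_tensor K A B a b) = (if i + j = n then pure_tensor K A B a b else \<zero>\<^bsub>T\<^esub>)"
proof -
  note cl = A.grade_closed[OF a] B.grade_closed[OF b]
  have "part n (pure_tensor K A B a b) = pure_tensor K A B a (homogeneous_part B b (n - i))"
    unfolding part_def
      tensor_lift_pure[OF A.module_axioms B.module_axioms T.module_axioms part_bilinear cl]
    by (rule A.graded_sum_homogeneous[OF T.module_axioms
          bilinear_mapsD(2)[OF pure B.homogeneous_part_closed[OF cl(2)]] a])
  also have "\<dots> = (if i + j = n then pure_tensor K A B a b else \<zero>\<^bsub>T\<^esub>)"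
    using linear_maps_zero[OF B.module_axioms T.module_axioms bilinear_mapsD(1)[OF pure cl(1)]]
    by (auto simp: B.homogeneous_part_homogeneous[OF b])
  finally show ?thesis .
qed

text \<open>Pure tensors of homogeneous elements generate, since each factor is a sum of homogeneous elements;
  the maps \<open>part n\<close> separate their degrees.\<close>

theorem tensor_graded: "graded_module K T"
proof (rule graded_moduleI[OF T.module_axioms, where p = part])
  show "submodule (grade T n) K T" for n
    unfolding grade_tensor by (rule submodule_span_submodule[OF T.module_axioms homogeneous_tensors_closed])
  show "part n \<in> linear_maps K T T" for n by (rule part_linear)
  show "part n x = x" if x: "x \<in> grade T n" for n x
  proof -
    have "part n y = id y" if "y \<in> homogeneous_tensors K A B n" for y
      using that by (auto simp: homogeneous_tensors_def part_pure)
    from linear_maps_span_eq[OF T.module_axioms T.module_axioms part_linear linear_maps_id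
        homogeneous_tensors_closed this x[unfolded grade_tensor]]
    show ?thesis by simp
  qed
  show "part n x = \<zero>\<^bsub>T\<^esub>" if x: "x \<in> grade T m" and "m \<noteq> n" for n m x
  proof -
    have "part n x \<in> {\<zero>\<^bsub>T\<^esub>}"
      by (rule linear_maps_tensor_graded[OF T.module_axioms part_linear
            submodule_singleton_zero[OF T.module_axioms] _ x])
        (use \<open>m \<noteq> n\<close> in \<open>auto simp: part_pure\<close>)
    then show ?thesis by simp
  qed
next
  fix P x
  assume x: "x \<in> carrier T" and hom: "\<And>n y. y \<in> grade T n \<Longrightarrow> P y"
    and step: "\<And>y z. \<lbrakk>y \<in> carrier T; z \<in> carrier T; P y; P z\<rbrakk> \<Longrightarrow> P (y \<oplus>\<^bsub>T\<^esub> z)"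
  note cl = bilinear_maps_closed[OF pure]
  show "P x"
  proof (rule tensor_induct[where P = P, OF A.module_axioms B.module_axioms x _ step])
    fix a b assume a: "a \<in> carrier A" and b: "b \<in> carrier B"
    from a show "P (pure_tensor K A B a b)"
    proof (induction a rule: A.graded_induct)
      case (homogeneous i a)
      note a = this A.grade_closed[OF this]
      from b show ?case
      proof (induction b rule: B.graded_induct)
        case (homogeneous j b)
        show ?case by (rule hom[OF pure_tensor_grade[OF a(1) homogeneous]])
      next
        case (add b b')
        then show ?case
          using a cl by (simp add: linear_mapsD(2)[OF bilinear_mapsD(1)[OF pure]] step)
      qed
    next
      case (add a a')
      then show ?case
        using b cl
        by (simp add: linear_mapsD(2)[OF bilinear_mapsD(2)[OF pure]] step)
    qed
  qed
qed

lemma tensor_lift_graded: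
  assumes V: "graded_module K V" and \<beta>: "\<beta> \<in> bilinear_maps K A B V"
    and deg: "\<And>i j a b. a \<in> grade A i \<Longrightarrow> b \<in> grade B j \<Longrightarrow> \<beta> a b \<in> grade V (i + j + q)"
  shows "tensor_lift K V \<beta> \<in> graded_maps K T V q"
proof -
  interpret V: graded_module K V by fact
  note lin = tensor_lift_linear[OF A.module_axioms B.module_axioms V.module_axioms \<beta>]
  show ?thesis
  proof (rule graded_mapsI[OF lin])
    fix x n assume x: "x \<in> grade T n"
    show "tensor_lift K V \<beta> x \<in> grade V (n + q)"
      using deg A.grade_closed B.grade_closed
      by (intro linear_maps_tensor_graded[OF V.module_axioms lin V.grade_submodule _ x])
        (auto simp: tensor_lift_pure[OF A.module_axioms B.module_axioms V.module_axioms \<beta>])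
  qed
qed

end

lemma
  assumes A: "graded_module K A" and "module K B" and "module K A'" and "module K B'"
    and f: "f \<in> linear_maps K A A'" and g: "g \<in> linear_maps K B B'"
  shows tensor_map_linear: "tensor_map K A B A' B' q f g \<in> linear_maps K (tensor K A B) (tensor K A' B')"
    and tensor_map_pure: "\<And>a b. a \<in> carrier A \<Longrightarrow> b \<in> carrier B \<Longrightarrow>
      tensor_map K A B A' B' q f g (pure_tensor K A B a b) = pure_tensor K A' B' (f (koszul A q a)) (g b)"
    and tensor_map_bilinear: "(\<lambda>a b. pure_tensor K A' B' (f (koszul A q a)) (g b))
      \<in> bilinear_maps K A B (tensor K A' B')"
proof -
  interpret A: graded_module K A by (fact A)
  show \<beta>: "(\<lambda>a b. pure_tensor K A' B' (f (koszul A q a)) (g b)) \<in> bilinear_maps K A B (tensor K A' B')"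
    using bilinear_maps_comp[OF pure_tensor_bilinear[OF assms(3,4)]
        linear_maps_comp[OF A.koszul_linear f] g linear_maps_id] by simp
  note rules = A.module_axioms assms(2) tensor_module[OF assms(3,4)] \<beta>
  show "tensor_map K A B A' B' q f g \<in> linear_maps K (tensor K A B) (tensor K A' B')"
    unfolding tensor_map_def by (rule tensor_lift_linear[OF rules])
  show "\<And>a b. a \<in> carrier A \<Longrightarrow> b \<in> carrier B \<Longrightarrow>
      tensor_map K A B A' B' q f g (pure_tensor K A B a b) = pure_tensor K A' B' (f (koszul A q a)) (g b)"
    unfolding tensor_map_def by (rule tensor_lift_pure[OF rules])
qed

lemma tensor_map_graded:
  assumes gr: "graded_module K A" "graded_module K B" "graded_module K A'" "graded_module K B'"
    and f: "f \<in> graded_maps K A A' p" and g: "g \<in> graded_maps K B B' q"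
  shows "tensor_map K A B A' B' q f g \<in> graded_maps K (tensor K A B) (tensor K A' B') (p + q)"
  unfolding tensor_map_def
proof (rule tensor_lift_graded[OF gr(1,2) tensor_graded[OF gr(3,4)]])
  interpret A: graded_module K A by (fact gr)
  interpret B: graded_module K B by (fact gr)
  interpret A': graded_module K A' by (fact gr)
  interpret B': graded_module K B' by (fact gr)
  show "(\<lambda>a b. pure_tensor K A' B' (f (koszul A q a)) (g b)) \<in> bilinear_maps K A B (tensor K A' B')"
    by (rule tensor_map_bilinear[OF gr(1) B.module_axioms A'.module_axioms B'.module_axioms
          graded_mapsD(1)[OF f] graded_mapsD(1)[OF g]])
  fix i j a b assume a: "a \<in> grade A i" and b: "b \<in> grade B j"
  have "f (koszul A q a) \<in> grade A' (i + p)"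
    using graded_mapsD(2)[OF graded_maps_comp[OF A.koszul_graded f] a] by simp
  from pure_tensor_grade[OF gr(3,4) this graded_mapsD(2)[OF g b]]
  show "pure_tensor K A' B' (f (koszul A q a)) (g b) \<in> grade (tensor K A' B') (i + j + (p + q))"
    by (simp add: algebra_simps)
qed

text \<open>Both sides are bilinear in \<open>a\<close> and \<open>b\<close>. For homogeneous factors of degrees \<open>i\<close> and \<open>j\<close> the
  exponent \<open>q (i + j)\<close> of the sign splits as \<open>q i + q j\<close>.\<close>

lemma koszul_pure_tensor:
  assumes gr: "graded_module K A" "graded_module K B" and a: "a \<in> carrier A" and b: "b \<in> carrier B"
  shows "koszul (tensor K A B) q (pure_tensor K A B a b)
    = pure_tensor K A B (koszul A q a) (koszul B q b)"
proof -
  interpret A: graded_module K A by (fact gr)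
  interpret B: graded_module K B by (fact gr)
  interpret T: graded_module K "tensor K A B" by (rule tensor_graded[OF gr])
  note p = pure_tensor_bilinear[OF A.module_axioms B.module_axioms]
  note q = bilinear_maps_comp[OF p A.koszul_linear B.koszul_linear linear_maps_id, of q q, unfolded id_def]
  note pK = bilinear_maps_comp[OF p linear_maps_id linear_maps_id T.koszul_linear, of q, unfolded id_def]
  show ?thesis
  proof (rule A.linear_maps_graded_eqI[OF bilinear_mapsD(2)[OF pK b] bilinear_mapsD(2)[OF q b] _ a])
    fix i a assume a: "a \<in> grade A i"
    note aA = A.grade_closed[OF a]
    show "koszul (tensor K A B) q (pure_tensor K A B a b) = pure_tensor K A B (koszul A q a) (koszul B q b)"
    proof (rule B.linear_maps_graded_eqI[OF bilinear_mapsD(1)[OF pK aA] bilinear_mapsD(1)[OF q aA] _ b])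
      fix j b assume b: "b \<in> grade B j"
      note bB = B.grade_closed[OF b]
      show "koszul (tensor K A B) q (pure_tensor K A B a b)
          = pure_tensor K A B (koszul A q a) (koszul B q b)"
        using bilinear_maps_closed[OF p aA bB]
        by (auto simp: T.koszul_homogeneous[OF pure_tensor_grade[OF gr a b]]
            A.koszul_homogeneous[OF a] B.koszul_homogeneous[OF b] aA bB
            linear_maps_uminus[OF A.module_axioms T.module_axioms bilinear_mapsD(2)[OF p]]
            linear_maps_uminus[OF B.module_axioms T.module_axioms bilinear_mapsD(1)[OF p]])
    qed
  qed
qed


section \<open>Trilinear maps and associativity\<close>

definition trilinear_maps ::
  "('k, 'l) ring_scheme \<Rightarrow> ('k, 'a, 'm) module_scheme \<Rightarrow> ('k, 'b, 'n) module_scheme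
    \<Rightarrow> ('k, 'c, 'o) module_scheme \<Rightarrow> ('k, 'v, 'p) module_scheme \<Rightarrow> ('a \<Rightarrow> 'b \<Rightarrow> 'c \<Rightarrow> 'v) set"
  where "trilinear_maps K A B C V = {\<beta>. (\<forall>a\<in>carrier A. \<beta> a \<in> bilinear_maps K B C V) \<and>
    (\<forall>b\<in>carrier B. \<forall>c\<in>carrier C. (\<lambda>a. \<beta> a b c) \<in> linear_maps K A V)}"

lemma trilinear_mapsD:
  assumes "\<beta> \<in> trilinear_maps K A B C V"
  shows "a \<in> carrier A \<Longrightarrow> (\<lambda>b c. \<beta> a b c) \<in> bilinear_maps K B C V"
    and "b \<in> carrier B \<Longrightarrow> (\<lambda>a c. \<beta> a b c) \<in> bilinear_maps K A C V"
    and "c \<in> carrier C \<Longrightarrow> (\<lambda>a b. \<beta> a b c) \<in> bilinear_maps K A B V"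
  using assms by (simp_all add: trilinear_maps_def bilinear_maps_def)

lemma linear_maps_smult:
  assumes "module K W" and "f \<in> linear_maps K V W" and "r \<in> carrier K"
  shows "(\<lambda>x. r \<odot>\<^bsub>W\<^esub> f x) \<in> linear_maps K V W"
proof -
  interpret W: module K W by fact
  show ?thesis
    using linear_mapsD[OF assms(2)] assms(3) W.smult_assoc1 W.R.m_comm
    by (intro linear_mapsI) (auto simp: W.smult_r_distr simp flip: W.smult_assoc1)
qed

text \<open>For fixed \<open>c\<close> the lift is linear in \<open>x\<close>, so additivity and homogeneity in \<open>c\<close> need only be
  compared at pure tensors, where they are assumed.\<close>

lemma tensor_lift_parameter_linear:
  assumes A: "module K A" and B: "module K B" and C: "module K C" and V: "module K V"
    and \<beta>: "\<And>c. c \<in> carrier C \<Longrightarrow> \<beta> c \<in> bilinear_maps K A B V"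
    and lin: "\<And>a b. a \<in> carrier A \<Longrightarrow> b \<in> carrier B \<Longrightarrow> (\<lambda>c. \<beta> c a b) \<in> linear_maps K C V"
    and x: "x \<in> carrier (tensor K A B)"
  shows "(\<lambda>c. tensor_lift K V (\<beta> c) x) \<in> linear_maps K C V"
proof -
  interpret C: module K C by (fact C)
  note tl = tensor_lift_linear[OF A B V \<beta>] and tp = tensor_lift_pure[OF A B V \<beta>]
  show ?thesis
  proof (rule linear_mapsI)
    fix c assume c: "c \<in> carrier C"
    show "tensor_lift K V (\<beta> c) x \<in> carrier V" using linear_mapsD(1)[OF tl[OF c] x] .
    {
      fix c' assume c': "c' \<in> carrier C"
      show "tensor_lift K V (\<beta> (c \<oplus>\<^bsub>C\<^esub> c')) x = tensor_lift K V (\<beta> c) x \<oplus>\<^bsub>V\<^esub> tensor_lift K V (\<beta> c') x"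
        by (rule linear_maps_tensor_eqI[OF A B tl[OF C.a_closed[OF c c']]
              linear_maps_add[OF V tl[OF c] tl[OF c']] _ x])
          (simp add: tp c c' linear_mapsD(2)[OF lin])
    }
    fix r assume r: "r \<in> carrier K"
    show "tensor_lift K V (\<beta> (r \<odot>\<^bsub>C\<^esub> c)) x = r \<odot>\<^bsub>V\<^esub> tensor_lift K V (\<beta> c) x"
      by (rule linear_maps_tensor_eqI[OF A B tl[OF C.smult_closed[OF r c]]
            linear_maps_smult[OF V tl[OF c] r] _ x])
        (simp add: tp c r linear_mapsD(3)[OF lin])
  qed
qed

lemma
  assumes A: "module K A" and B: "module K B" and C: "module K C" and V: "module K V"
    and \<beta>: "\<beta> \<in> trilinear_maps K A B C V"
  shows tensor_lift_outer_left:
      "(\<lambda>x c. tensor_lift K V (\<lambda>a b. \<beta> a b c) x) \<in> bilinear_maps K (tensor K A B) C V"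
    and tensor_lift_outer_right:
      "(\<lambda>a y. tensor_lift K V (\<lambda>b c. \<beta> a b c) y) \<in> bilinear_maps K A (tensor K B C) V"
proof -
  note D = trilinear_mapsD[OF \<beta>]
  show "(\<lambda>x c. tensor_lift K V (\<lambda>a b. \<beta> a b c) x) \<in> bilinear_maps K (tensor K A B) C V"
    by (intro bilinear_mapsI tensor_lift_linear[OF A B V D(3)]
        tensor_lift_parameter_linear[OF A B C V D(3) bilinear_mapsD(1)[OF D(1)]])
  show "(\<lambda>a y. tensor_lift K V (\<lambda>b c. \<beta> a b c) y) \<in> bilinear_maps K A (tensor K B C) V"
    by (intro bilinear_mapsI tensor_lift_linear[OF B C V D(1)]
        tensor_lift_parameter_linear[OF B C A V D(1) bilinear_mapsD(2)[OF D(2)]])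
qed

lemma assoc_right_trilinear:
  assumes A: "module K A" and B: "module K B" and C: "module K C"
  shows "(\<lambda>a b c. pure_tensor K A (tensor K B C) a (pure_tensor K B C b c))
    \<in> trilinear_maps K A B C (tensor K A (tensor K B C))"
proof -
  note p = pure_tensor_bilinear[OF A tensor_module[OF B C]] and q = pure_tensor_bilinear[OF B C]
  show ?thesis
    unfolding trilinear_maps_def
    using bilinear_maps_comp[OF q linear_maps_id linear_maps_id bilinear_mapsD(1)[OF p], unfolded id_def]
      bilinear_mapsD(2)[OF p bilinear_maps_closed[OF q]] by simp
qed

lemma assoc_left_trilinear:
  assumes A: "module K A" and B: "module K B" and C: "module K C"
  shows "(\<lambda>a b c. pure_tensor K (tensor K A B) C (pure_tensor K A B a b) c)
    \<in> trilinear_maps K A B C (tensor K (tensor K A B) C)"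
proof -
  note p = pure_tensor_bilinear[OF tensor_module[OF A B] C] and q = pure_tensor_bilinear[OF A B]
  show ?thesis
    unfolding trilinear_maps_def
    using bilinear_maps_comp[OF p bilinear_mapsD(1)[OF q] linear_maps_id linear_maps_id, unfolded id_def]
      linear_maps_comp[OF bilinear_mapsD(2)[OF q] bilinear_mapsD(2)[OF p]] by simp
qed

context
  fixes K :: "('k, 'l) ring_scheme" and A :: "('k, 'a, 'm) gmodule_scheme"
    and B :: "('k, 'b, 'n) gmodule_scheme" and C :: "('k, 'c, 'o) gmodule_scheme"
  assumes gr: "graded_module K A" "graded_module K B" "graded_module K C"
begin

interpretation A: graded_module K A by (fact gr)
interpretation B: graded_module K B by (fact gr)
interpretation C: graded_module K C by (fact gr)
interpretation AB: graded_module K "tensor K A B" by (intro tensor_graded gr)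
interpretation BC: graded_module K "tensor K B C" by (intro tensor_graded gr)
interpretation R: graded_module K "tensor K A (tensor K B C)"
  by (rule tensor_graded[OF gr(1) BC.graded_module_axioms])
interpretation L: graded_module K "tensor K (tensor K A B) C"
  by (rule tensor_graded[OF AB.graded_module_axioms gr(3)])

private lemmas mods = A.module_axioms B.module_axioms C.module_axioms

private lemmas assoc_right_bilinear =
  tensor_lift_outer_left[OF mods R.module_axioms assoc_right_trilinear[OF mods]]
private lemmas assoc_left_bilinear =
  tensor_lift_outer_right[OF mods L.module_axioms assoc_left_trilinear[OF mods]]

lemma assoc_right_pure:
  assumes "x \<in> carrier (tensor K A B)" and "c \<in> carrier C"
  shows "assoc_right K A B C (pure_tensor K (tensor K A B) C x c)
    = tensor_lift K (tensor K A (tensor K B C))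
        (\<lambda>a b. pure_tensor K A (tensor K B C) a (pure_tensor K B C b c)) x"
  unfolding assoc_right_def Let_def
  by (rule tensor_lift_pure[OF AB.module_axioms C.module_axioms R.module_axioms assoc_right_bilinear assms])

lemma assoc_left_pure:
  assumes "a \<in> carrier A" and "b \<in> carrier B" and "c \<in> carrier C"
  shows "assoc_left K A B C (pure_tensor K A (tensor K B C) a (pure_tensor K B C b c))
    = pure_tensor K (tensor K A B) C (pure_tensor K A B a b) c"
  unfolding assoc_left_def Let_def
  using assms bilinear_maps_closed[OF pure_tensor_bilinear[OF mods(2,3)] assms(2,3)]
  by (simp add: tensor_lift_pure[OF A.module_axioms BC.module_axioms L.module_axioms assoc_left_bilinear]
      tensor_lift_pure[OF mods(2,3) L.module_axioms
        trilinear_mapsD(1)[OF assoc_left_trilinear[OF mods]]])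

lemma assoc_right_graded:
  "assoc_right K A B C \<in> graded_maps K (tensor K (tensor K A B) C) (tensor K A (tensor K B C)) 0"
  unfolding assoc_right_def Let_def
proof (rule tensor_lift_graded[OF AB.graded_module_axioms gr(3) R.graded_module_axioms assoc_right_bilinear])
  fix i j x c assume x: "x \<in> grade (tensor K A B) i" and c: "c \<in> grade C j"
  have "tensor_lift K (tensor K A (tensor K B C))
        (\<lambda>a b. pure_tensor K A (tensor K B C) a (pure_tensor K B C b c))
      \<in> graded_maps K (tensor K A B) (tensor K A (tensor K B C)) j"
  proof (rule tensor_lift_graded[OF gr(1,2) R.graded_module_axioms])
    show "(\<lambda>a b. pure_tensor K A (tensor K B C) a (pure_tensor K B C b c))
        \<in> bilinear_maps K A B (tensor K A (tensor K B C))"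
      using trilinear_mapsD(3)[OF assoc_right_trilinear[OF mods] C.grade_closed[OF c]] .
    fix i k a b assume a: "a \<in> grade A i" and b: "b \<in> grade B k"
    show "pure_tensor K A (tensor K B C) a (pure_tensor K B C b c)
        \<in> grade (tensor K A (tensor K B C)) (i + k + j)"
      using pure_tensor_grade[OF gr(1) BC.graded_module_axioms a pure_tensor_grade[OF gr(2,3) b c]]
      by (simp add: add.assoc)
  qed
  from graded_mapsD(2)[OF this x]
  show "tensor_lift K (tensor K A (tensor K B C))
        (\<lambda>a b. pure_tensor K A (tensor K B C) a (pure_tensor K B C b c)) x
      \<in> grade (tensor K A (tensor K B C)) (i + j + 0)" by simp
qed

lemma assoc_left_graded:
  "assoc_left K A B C \<in> graded_maps K (tensor K A (tensor K B C)) (tensor K (tensor K A B) C) 0"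
  unfolding assoc_left_def Let_def
proof (rule tensor_lift_graded[OF gr(1) BC.graded_module_axioms L.graded_module_axioms assoc_left_bilinear])
  fix i j a y assume a: "a \<in> grade A i" and y: "y \<in> grade (tensor K B C) j"
  have "tensor_lift K (tensor K (tensor K A B) C)
        (\<lambda>b c. pure_tensor K (tensor K A B) C (pure_tensor K A B a b) c)
      \<in> graded_maps K (tensor K B C) (tensor K (tensor K A B) C) i"
  proof (rule tensor_lift_graded[OF gr(2,3) L.graded_module_axioms])
    show "(\<lambda>b c. pure_tensor K (tensor K A B) C (pure_tensor K A B a b) c)
        \<in> bilinear_maps K B C (tensor K (tensor K A B) C)"
      using trilinear_mapsD(1)[OF assoc_left_trilinear[OF mods] A.grade_closed[OF a]] .
    fix j k b c assume b: "b \<in> grade B j" and c: "c \<in> grade C k"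
    show "pure_tensor K (tensor K A B) C (pure_tensor K A B a b) c
        \<in> grade (tensor K (tensor K A B) C) (j + k + i)"
      using pure_tensor_grade[OF AB.graded_module_axioms gr(3) pure_tensor_grade[OF gr(1,2) a b] c]
      by (simp add: algebra_simps)
  qed
  from graded_mapsD(2)[OF this y]
  show "tensor_lift K (tensor K (tensor K A B) C)
        (\<lambda>b c. pure_tensor K (tensor K A B) C (pure_tensor K A B a b) c) y
      \<in> grade (tensor K (tensor K A B) C) (i + j + 0)" by (simp add: algebra_simps)
qed

end


section \<open>Sweedler sums in a curved coalgebra\<close>

lemma bilinear_maps_cong:
  assumes "\<beta> \<in> bilinear_maps K A B V" and "module K A" and "module K B"
    and eq: "\<And>a b. a \<in> carrier A \<Longrightarrow> b \<in> carrier B \<Longrightarrow> \<gamma> a b = \<beta> a b"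
  shows "\<gamma> \<in> bilinear_maps K A B V"
proof (rule bilinear_mapsI)
  fix a assume a: "a \<in> carrier A"
  show "(\<lambda>b. \<gamma> a b) \<in> linear_maps K B V"
    by (rule linear_maps_cong[OF bilinear_mapsD(1)[OF assms(1) a] eq[OF a] assms(3)])
next
  fix b assume b: "b \<in> carrier B"
  show "(\<lambda>a. \<gamma> a b) \<in> linear_maps K A V"
    by (rule linear_maps_cong[OF bilinear_mapsD(2)[OF assms(1) b] eq[OF _ b] assms(2)])
qed

lemma ground_module:
  assumes "cring K"
  shows "module K (ground K)"
proof -
  interpret K: cring K by fact
  have "abelian_group (ground K)"
    by (rule abelian_groupI)
      (auto simp: ground_def K.a_ac intro!: bexI[of _ "\<ominus>\<^bsub>K\<^esub> x" for x] K.l_neg)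
  then show ?thesis
    by (rule moduleI[OF assms]) (auto simp: ground_def K.l_distr K.r_distr K.m_assoc)
qed

text \<open>In Sweedler notation this is the sum of all \<open>\<beta> c' c''\<close>. Coassociativity, the coderivation
  and curvature axioms and the degree of the comultiplication, all of them statements about maps of
  tensor products, become rules for rewriting such sums.\<close>

definition sweedler :: "('k, 'l) ring_scheme \<Rightarrow> ('k, 'c, 'm) gcoalgebra_scheme
    \<Rightarrow> ('k, 'v, 'n) module_scheme \<Rightarrow> ('c \<Rightarrow> 'c \<Rightarrow> 'v) \<Rightarrow> 'c \<Rightarrow> 'v"
  where "sweedler K C V \<beta> c = tensor_lift K V \<beta> (comult C c)"

context curved_dg_coalgebra
begin

lemma graded: "graded_module K C" and is_module: "module K C"
  by (rule graded_module_axioms module_axioms)+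

lemma graded_square: "graded_module K (tensor K C C)" by (rule tensor_graded[OF graded graded])

lemma module_square: "module K (tensor K C C)" by (rule tensor_module[OF is_module is_module])

lemmas comult_linear = graded_mapsD(1)[OF comult_degree]
  and comult_closed = linear_mapsD(1)[OF graded_mapsD(1)[OF comult_degree]]
  and diff_linear = graded_mapsD(1)[OF diff_degree]

context
  fixes V :: "('k, 'v, 'n) module_scheme"
  assumes V: "module K V"
begin

lemma sweedler_linear: "\<beta> \<in> bilinear_maps K C C V \<Longrightarrow> sweedler K C V \<beta> \<in> linear_maps K C V"
  unfolding sweedler_def
  by (rule linear_maps_comp[OF comult_linear tensor_lift_linear[OF is_module is_module V]])

lemma sweedler_closed:
  "\<beta> \<in> bilinear_maps K C C V \<Longrightarrow> c \<in> carrier C \<Longrightarrow> sweedler K C V \<beta> c \<in> carrier V"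
  using linear_mapsD(1)[OF sweedler_linear] .

lemma sweedler_comp:
  assumes \<beta>: "\<beta> \<in> bilinear_maps K C C V" and c: "c \<in> carrier C"
    and W: "module K W" and \<phi>: "\<phi> \<in> linear_maps K V W"
  shows "\<phi> (sweedler K C V \<beta> c) = sweedler K C W (\<lambda>x y. \<phi> (\<beta> x y)) c"
  unfolding sweedler_def
proof (rule linear_maps_tensor_eqI[OF is_module is_module _ _ _ comult_closed[OF c]])
  have \<gamma>: "(\<lambda>x y. \<phi> (\<beta> x y)) \<in> bilinear_maps K C C W"
    using bilinear_maps_comp[OF \<beta> linear_maps_id linear_maps_id \<phi>] by simp
  show "(\<lambda>x. \<phi> (tensor_lift K V \<beta> x)) \<in> linear_maps K (tensor K C C) W"
    by (rule linear_maps_comp[OF tensor_lift_linear[OF is_module is_module V \<beta>] \<phi>])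
  show "tensor_lift K W (\<lambda>x y. \<phi> (\<beta> x y)) \<in> linear_maps K (tensor K C C) W"
    by (rule tensor_lift_linear[OF is_module is_module W \<gamma>])
  show "\<phi> (tensor_lift K V \<beta> (pure_tensor K C C a b))
      = tensor_lift K W (\<lambda>x y. \<phi> (\<beta> x y)) (pure_tensor K C C a b)"
    if "a \<in> carrier C" "b \<in> carrier C" for a b
    using that by (simp add: tensor_lift_pure[OF is_module is_module V \<beta>] tensor_lift_pure[OF is_module is_module W \<gamma>])
qed

lemma sweedler_cong:
  assumes \<beta>: "\<beta> \<in> bilinear_maps K C C V" and c: "c \<in> carrier C"
    and eq: "\<And>x y. x \<in> carrier C \<Longrightarrow> y \<in> carrier C \<Longrightarrow> \<gamma> x y = \<beta> x y"
  shows "sweedler K C V \<gamma> c = sweedler K C V \<beta> c"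
  unfolding sweedler_def
proof (rule linear_maps_tensor_eqI[OF is_module is_module _ _ _ comult_closed[OF c]])
  have \<gamma>: "\<gamma> \<in> bilinear_maps K C C V" by (rule bilinear_maps_cong[OF \<beta> is_module is_module eq])
  show "tensor_lift K V \<gamma> \<in> linear_maps K (tensor K C C) V"
    "tensor_lift K V \<beta> \<in> linear_maps K (tensor K C C) V"
    by (rule tensor_lift_linear[OF is_module is_module V] \<beta> \<gamma>)+
  show "tensor_lift K V \<gamma> (pure_tensor K C C a b) = tensor_lift K V \<beta> (pure_tensor K C C a b)"
    if "a \<in> carrier C" "b \<in> carrier C" for a b
    using that by (simp add: tensor_lift_pure[OF is_module is_module V] \<beta> \<gamma> eq)
qed

lemma sweedler_add:
  assumes \<beta>: "\<beta> \<in> bilinear_maps K C C V" and \<gamma>: "\<gamma> \<in> bilinear_maps K C C V" and c: "c \<in> carrier C"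
  shows "sweedler K C V \<beta> c \<oplus>\<^bsub>V\<^esub> sweedler K C V \<gamma> c
    = sweedler K C V (\<lambda>x y. \<beta> x y \<oplus>\<^bsub>V\<^esub> \<gamma> x y) c"
  unfolding sweedler_def
proof (rule linear_maps_tensor_eqI[OF is_module is_module _ _ _ comult_closed[OF c]])
  note \<delta> = bilinear_maps_add[OF V \<beta> \<gamma>]
  show "(\<lambda>x. tensor_lift K V \<beta> x \<oplus>\<^bsub>V\<^esub> tensor_lift K V \<gamma> x) \<in> linear_maps K (tensor K C C) V"
    by (rule linear_maps_add[OF V tensor_lift_linear[OF is_module is_module V \<beta>] tensor_lift_linear[OF is_module is_module V \<gamma>]])
  show "tensor_lift K V (\<lambda>x y. \<beta> x y \<oplus>\<^bsub>V\<^esub> \<gamma> x y) \<in> linear_maps K (tensor K C C) V"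
    by (rule tensor_lift_linear[OF is_module is_module V \<delta>])
  show "tensor_lift K V \<beta> (pure_tensor K C C a b) \<oplus>\<^bsub>V\<^esub> tensor_lift K V \<gamma> (pure_tensor K C C a b)
      = tensor_lift K V (\<lambda>x y. \<beta> x y \<oplus>\<^bsub>V\<^esub> \<gamma> x y) (pure_tensor K C C a b)"
    if "a \<in> carrier C" "b \<in> carrier C" for a b
    using that by (simp add: tensor_lift_pure[OF is_module is_module V] \<beta> \<gamma> \<delta>)
qed

end

context
  fixes V :: "('k, 'v, 'n) module_scheme"
  assumes V: "module K V"
begin

lemma sweedler_uminus:
  assumes \<beta>: "\<beta> \<in> bilinear_maps K C C V" and c: "c \<in> carrier C"
  shows "sweedler K C V (\<lambda>x y. \<ominus>\<^bsub>V\<^esub> \<beta> x y) c = \<ominus>\<^bsub>V\<^esub> sweedler K C V \<beta> c"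
  using sweedler_comp[OF V \<beta> c V linear_maps_neg[OF V linear_maps_id]] by simp

text \<open>The comultiplication has degree \<open>0\<close>, so the sign map passes through it and then splits over the
  two factors.\<close>

lemma sweedler_koszul:
  assumes \<beta>: "\<beta> \<in> bilinear_maps K C C V" and c: "c \<in> carrier C"
  shows "sweedler K C V \<beta> (koszul C 1 c) = sweedler K C V (\<lambda>x y. \<beta> (koszul C 1 x) (koszul C 1 y)) c"
proof -
  interpret CC: graded_module K "tensor K C C" by (rule graded_square)
  note \<gamma> = bilinear_maps_comp[OF \<beta> koszul_linear koszul_linear linear_maps_id, of 1 1, unfolded id_def]
  have "sweedler K C V \<beta> (koszul C 1 c) = tensor_lift K V \<beta> (koszul (tensor K C C) 1 (comult C c))"
    unfolding sweedler_def by (simp add: koszul_natural_even[OF graded graded_square comult_degree _ c])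
  also have "\<dots> = sweedler K C V (\<lambda>x y. \<beta> (koszul C 1 x) (koszul C 1 y)) c"
    unfolding sweedler_def
  proof (rule linear_maps_tensor_eqI[OF is_module is_module _ _ _ comult_closed[OF c]])
    show "(\<lambda>x. tensor_lift K V \<beta> (koszul (tensor K C C) 1 x)) \<in> linear_maps K (tensor K C C) V"
      by (rule linear_maps_comp[OF CC.koszul_linear tensor_lift_linear[OF is_module is_module V \<beta>]])
    show "tensor_lift K V (\<lambda>x y. \<beta> (koszul C 1 x) (koszul C 1 y)) \<in> linear_maps K (tensor K C C) V"
      by (rule tensor_lift_linear[OF is_module is_module V \<gamma>])
    show "tensor_lift K V \<beta> (koszul (tensor K C C) 1 (pure_tensor K C C a b))
        = tensor_lift K V (\<lambda>x y. \<beta> (koszul C 1 x) (koszul C 1 y)) (pure_tensor K C C a b)"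
      if "a \<in> carrier C" "b \<in> carrier C" for a b
      using that by (simp add: koszul_pure_tensor[OF graded graded] koszul_closed
          tensor_lift_pure[OF is_module is_module V \<beta>] tensor_lift_pure[OF is_module is_module V \<gamma>])
  qed
  finally show ?thesis .
qed

text \<open>The axioms of the coalgebra and the convolution apply \<open>f \<otimes> g\<close> to the comultiplication and then
  evaluate; this is the translation of such an expression.\<close>

lemma tensor_lift_tensor_map:
  assumes f: "f \<in> linear_maps K C A" and g: "g \<in> linear_maps K C B" and A: "module K A" and B: "module K B"
    and \<beta>: "\<beta> \<in> bilinear_maps K A B V" and c: "c \<in> carrier C"
  shows "tensor_lift K V \<beta> (tensor_map K C C A B q f g (comult C c))
    = sweedler K C V (\<lambda>x y. \<beta> (f (koszul C q x)) (g y)) c"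
  unfolding sweedler_def
proof (rule linear_maps_tensor_eqI[OF is_module is_module _ _ _ comult_closed[OF c]])
  note \<gamma> = bilinear_maps_comp[OF \<beta> linear_maps_comp[OF koszul_linear f] g linear_maps_id, of q, unfolded id_def]
  show "(\<lambda>x. tensor_lift K V \<beta> (tensor_map K C C A B q f g x)) \<in> linear_maps K (tensor K C C) V"
    by (rule linear_maps_comp[OF tensor_map_linear[OF graded is_module A B f g] tensor_lift_linear[OF A B V \<beta>]])
  show "tensor_lift K V (\<lambda>x y. \<beta> (f (koszul C q x)) (g y)) \<in> linear_maps K (tensor K C C) V"
    by (rule tensor_lift_linear[OF is_module is_module V \<gamma>])
  show "tensor_lift K V \<beta> (tensor_map K C C A B q f g (pure_tensor K C C a b))
      = tensor_lift K V (\<lambda>x y. \<beta> (f (koszul C q x)) (g y)) (pure_tensor K C C a b)"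
    if "a \<in> carrier C" "b \<in> carrier C" for a b
    using that by (simp add: tensor_map_pure[OF graded is_module A B f g] tensor_lift_pure[OF is_module is_module V \<gamma>]
        tensor_lift_pure[OF A B V \<beta>] linear_mapsD(1)[OF f] linear_mapsD(1)[OF g] koszul_closed)
qed

lemma sweedler_coderivation:
  assumes \<beta>: "\<beta> \<in> bilinear_maps K C C V" and c: "c \<in> carrier C"
  shows "sweedler K C V \<beta> (d c) = sweedler K C V (\<lambda>x y. \<beta> (d x) y) c
    \<oplus>\<^bsub>V\<^esub> sweedler K C V (\<lambda>x y. \<beta> (koszul C 1 x) (d y)) c"
proof -
  note lin = tensor_lift_linear[OF is_module is_module V \<beta>]
  note tm = linear_mapsD(1)[OF tensor_map_linear[OF graded is_module is_module is_module] comult_closed[OF c]]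
  have "sweedler K C V \<beta> (d c) = tensor_lift K V \<beta> (tensor_map K C C C C 0 d id (comult C c))
      \<oplus>\<^bsub>V\<^esub> tensor_lift K V \<beta> (tensor_map K C C C C (-1) id d (comult C c))"
    unfolding sweedler_def
    by (simp add: coderivation[OF c] linear_mapsD(2)[OF lin] tm diff_linear linear_maps_id)
  also have "\<dots> = sweedler K C V (\<lambda>x y. \<beta> (d (koszul C 0 x)) (id y)) c
      \<oplus>\<^bsub>V\<^esub> sweedler K C V (\<lambda>x y. \<beta> (id (koszul C (-1) x)) (d y)) c"
    by (simp only: tensor_lift_tensor_map[OF _ _ is_module is_module \<beta> c] diff_linear linear_maps_id)
  also have "sweedler K C V (\<lambda>x y. \<beta> (d (koszul C 0 x)) (id y)) c = sweedler K C V (\<lambda>x y. \<beta> (d x) y) c"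
    using bilinear_maps_comp[OF \<beta> diff_linear linear_maps_id linear_maps_id, unfolded id_def] c
    by (intro sweedler_cong[OF V]) (simp_all add: koszul_even)
  also have "sweedler K C V (\<lambda>x y. \<beta> (id (koszul C (-1) x)) (d y)) c
      = sweedler K C V (\<lambda>x y. \<beta> (koszul C 1 x) (d y)) c"
    using bilinear_maps_comp[OF \<beta> koszul_linear diff_linear linear_maps_id, of 1, unfolded id_def] c
    by (intro sweedler_cong[OF V]) (simp_all add: koszul_odd[of "-1"])
  finally show ?thesis .
qed

lemma sweedler_left_bilinear:
  assumes \<beta>: "\<beta> \<in> trilinear_maps K C C C V"
  shows "(\<lambda>x z. sweedler K C V (\<lambda>u v. \<beta> u v z) x) \<in> bilinear_maps K C C V"
  unfolding sweedler_def
  using bilinear_maps_comp[OF tensor_lift_outer_left[OF is_module is_module is_module V \<beta>] comult_linear linear_maps_id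
      linear_maps_id] by simp

lemma sweedler_right_bilinear:
  assumes \<beta>: "\<beta> \<in> trilinear_maps K C C C V"
  shows "(\<lambda>u y. sweedler K C V (\<lambda>v w. \<beta> u v w) y) \<in> bilinear_maps K C C V"
  unfolding sweedler_def
  using bilinear_maps_comp[OF tensor_lift_outer_right[OF is_module is_module is_module V \<beta>] linear_maps_id comult_linear
      linear_maps_id] by simp

text \<open>Applying the lift of \<open>\<beta>\<close> on \<open>C \<otimes> (C \<otimes> C)\<close> to both sides of the coassociativity axiom gives the
  two iterated sums.\<close>

lemma sweedler_coassoc:
  assumes \<beta>: "\<beta> \<in> trilinear_maps K C C C V" and c: "c \<in> carrier C"
  shows "sweedler K C V (\<lambda>x z. sweedler K C V (\<lambda>u v. \<beta> u v z) x) c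
    = sweedler K C V (\<lambda>u y. sweedler K C V (\<lambda>v w. \<beta> u v w) y) c"
proof -
  let ?\<gamma> = "\<lambda>u y. tensor_lift K V (\<lambda>v w. \<beta> u v w) y"
  note \<gamma> = tensor_lift_outer_right[OF is_module is_module is_module V \<beta>]
  let ?\<phi> = "tensor_lift K V ?\<gamma>"
  note \<phi> = tensor_lift_linear[OF is_module module_square V \<gamma>] and \<phi>_pure = tensor_lift_pure[OF is_module module_square V \<gamma>]
  note tri = assoc_right_trilinear[OF is_module is_module is_module]
  note id = linear_maps_id
  have "?\<phi> (assoc_right K C C C (tensor_map K C C (tensor K C C) C 0 (comult C) id (comult C c)))
      = sweedler K C V (\<lambda>x z. sweedler K C V (\<lambda>u v. \<beta> u v z) x) c"
    unfolding sweedler_def[of K C V "\<lambda>x z. sweedler K C V (\<lambda>u v. \<beta> u v z) x"]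
  proof (rule linear_maps_tensor_eqI[OF is_module is_module _ _ _ comult_closed[OF c]])
    show "(\<lambda>t. ?\<phi> (assoc_right K C C C (tensor_map K C C (tensor K C C) C 0 (comult C) id t)))
        \<in> linear_maps K (tensor K C C) V"
      by (rule linear_maps_comp[OF linear_maps_comp[OF
              tensor_map_linear[OF graded is_module module_square is_module comult_linear id]
              graded_mapsD(1)[OF assoc_right_graded[OF graded graded graded]]] \<phi>])
    show "tensor_lift K V (\<lambda>x z. sweedler K C V (\<lambda>u v. \<beta> u v z) x) \<in> linear_maps K (tensor K C C) V"
      by (rule tensor_lift_linear[OF is_module is_module V sweedler_left_bilinear[OF \<beta>]])
    fix x z assume x: "x \<in> carrier C" and z: "z \<in> carrier C"
    let ?\<tau> = "\<lambda>u v. pure_tensor K C (tensor K C C) u (pure_tensor K C C v z)"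
    note \<tau> = trilinear_mapsD(3)[OF tri z]
    have "?\<phi> (assoc_right K C C C (tensor_map K C C (tensor K C C) C 0 (comult C) id (pure_tensor K C C x z)))
        = ?\<phi> (sweedler K C (tensor K C (tensor K C C)) ?\<tau> x)"
      using x z by (simp add: tensor_map_pure[OF graded is_module module_square is_module comult_linear id] koszul_even
          assoc_right_pure[OF graded graded graded] comult_closed sweedler_def)
    also have "\<dots> = sweedler K C V (\<lambda>u v. ?\<phi> (?\<tau> u v)) x"
      by (rule sweedler_comp[OF tensor_module[OF is_module module_square] \<tau> x V \<phi>])
    also have "\<dots> = sweedler K C V (\<lambda>u v. \<beta> u v z) x"
      by (rule sweedler_cong[OF V trilinear_mapsD(3)[OF \<beta> z] x])
        (simp add: \<phi>_pure z bilinear_maps_closed[OF pure_tensor_bilinear[OF is_module is_module]]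
          tensor_lift_pure[OF is_module is_module V trilinear_mapsD(1)[OF \<beta>]])
    also have "\<dots> = tensor_lift K V (\<lambda>x z. sweedler K C V (\<lambda>u v. \<beta> u v z) x) (pure_tensor K C C x z)"
      by (simp add: tensor_lift_pure[OF is_module is_module V sweedler_left_bilinear[OF \<beta>] x z])
    finally show "?\<phi> (assoc_right K C C C (tensor_map K C C (tensor K C C) C 0 (comult C) id (pure_tensor K C C x z)))
        = tensor_lift K V (\<lambda>x z. sweedler K C V (\<lambda>u v. \<beta> u v z) x) (pure_tensor K C C x z)" .
  qed
  moreover have "?\<phi> (tensor_map K C C C (tensor K C C) 0 id (comult C) (comult C c))
      = sweedler K C V (\<lambda>u y. ?\<gamma> (id (koszul C 0 u)) (comult C y)) c"
    by (rule tensor_lift_tensor_map[OF id comult_linear is_module module_square \<gamma> c])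
  moreover have "\<dots> = sweedler K C V (\<lambda>u y. sweedler K C V (\<lambda>v w. \<beta> u v w) y) c"
    by (rule sweedler_cong[OF V sweedler_right_bilinear[OF \<beta>] c]) (simp add: koszul_even sweedler_def)
  ultimately show ?thesis using coassoc[OF c] by simp
qed

end

lemma h_linear: "h \<in> linear_maps K C (ground K)"
  by (rule graded_mapsD(1)[OF curvature_degree])

lemma h_closed: "x \<in> carrier C \<Longrightarrow> h x \<in> carrier K"
  using linear_mapsD(1)[OF h_linear] by (simp add: ground_def)

lemma h_add: "x \<in> carrier C \<Longrightarrow> y \<in> carrier C \<Longrightarrow> h (x \<oplus>\<^bsub>C\<^esub> y) = h x \<oplus>\<^bsub>K\<^esub> h y"
  and h_smult: "r \<in> carrier K \<Longrightarrow> x \<in> carrier C \<Longrightarrow> h (r \<odot>\<^bsub>C\<^esub> x) = r \<otimes>\<^bsub>K\<^esub> h x"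
  using linear_mapsD(2,3)[OF h_linear] by (simp_all add: ground_def)

lemma curvature_bilinear:
  "(\<lambda>x y. h x \<odot>\<^bsub>C\<^esub> y) \<in> bilinear_maps K C C C" "(\<lambda>x y. h y \<odot>\<^bsub>C\<^esub> x) \<in> bilinear_maps K C C C"
  by (auto simp: bilinear_maps_def linear_maps_def h_closed h_add h_smult
      smult_l_distr smult_r_distr R.m_comm simp flip: smult_assoc1)

lemma sweedler_curvature:
  assumes c: "c \<in> carrier C"
  shows "d (d c) = sweedler K C C (\<lambda>x y. h x \<odot>\<^bsub>C\<^esub> y) c
    \<ominus>\<^bsub>C\<^esub> sweedler K C C (\<lambda>x y. h y \<odot>\<^bsub>C\<^esub> x) c"
proof -
  note g = ground_module[OF R.is_cring]
  note id = linear_maps_id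
  have left: "(\<lambda>r x. r \<odot>\<^bsub>C\<^esub> x) \<in> bilinear_maps K (ground K) C C"
    and right: "(\<lambda>x r. r \<odot>\<^bsub>C\<^esub> x) \<in> bilinear_maps K C (ground K) C"
    by (auto simp: bilinear_maps_def linear_maps_def ground_def
      smult_l_distr smult_r_distr R.m_comm simp flip: smult_assoc1)
  have "unit_left K C (tensor_map K C C (ground K) C 0 h id (comult C c))
      = sweedler K C C (\<lambda>x y. h (koszul C 0 x) \<odot>\<^bsub>C\<^esub> id y) c"
    unfolding unit_left_def by (rule tensor_lift_tensor_map[OF is_module h_linear id g is_module left c])
  also have "\<dots> = sweedler K C C (\<lambda>x y. h x \<odot>\<^bsub>C\<^esub> y) c"
    by (rule sweedler_cong[OF is_module curvature_bilinear(1) c]) (simp add: koszul_even)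
  finally have 1: "unit_left K C (tensor_map K C C (ground K) C 0 h id (comult C c)) = \<dots>" .
  have "unit_right K C (tensor_map K C C C (ground K) (-2) id h (comult C c))
      = sweedler K C C (\<lambda>x y. h y \<odot>\<^bsub>C\<^esub> id (koszul C (-2) x)) c"
    unfolding unit_right_def by (rule tensor_lift_tensor_map[OF is_module id h_linear is_module g right c])
  also have "\<dots> = sweedler K C C (\<lambda>x y. h y \<odot>\<^bsub>C\<^esub> x) c"
    by (rule sweedler_cong[OF is_module curvature_bilinear(2) c]) (simp add: koszul_even)
  finally have 2: "unit_right K C (tensor_map K C C C (ground K) (-2) id h (comult C c)) = \<dots>" .
  show ?thesis using diff_square[OF c] 1 2 by simp
qed

end


section \<open>The twisted differential\<close>

text \<open>The bookkeeping for the square of \<open>d\<^sub>1 + d\<^sub>2 + d\<^sub>3 + R - L\<close>, where \<open>p\<^sub>i\<^sub>j\<close> stands for the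
  composite of the \<open>i\<close>-th with the \<open>j\<close>-th summand (4 is \<open>R\<close>, 5 is \<open>L\<close>), and \<open>l\<close> and \<open>r\<close> are the
  terms in which the curvature is evaluated on the left and on the right Sweedler factor.\<close>

lemma (in abelian_group) twisted_square_zero:
  assumes c: "p11 \<in> carrier G" "p12 \<in> carrier G" "p13 \<in> carrier G" "p14 \<in> carrier G" "p15 \<in> carrier G"
    "p21 \<in> carrier G" "p22 \<in> carrier G" "p23 \<in> carrier G" "p24 \<in> carrier G" "p25 \<in> carrier G"
    "p31 \<in> carrier G" "p32 \<in> carrier G" "p33 \<in> carrier G" "p34 \<in> carrier G" "p35 \<in> carrier G"
    "p41 \<in> carrier G" "p42 \<in> carrier G" "p43 \<in> carrier G" "p44 \<in> carrier G" "p45 \<in> carrier G"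
    "p51 \<in> carrier G" "p52 \<in> carrier G" "p53 \<in> carrier G" "p54 \<in> carrier G" "p55 \<in> carrier G"
    "l \<in> carrier G" "r \<in> carrier G"
    and z: "p11 = \<zero>" "p33 = \<zero>" "p12 \<oplus> p21 = \<zero>" "p13 \<oplus> p31 = \<zero>" "p23 \<oplus> p32 = \<zero>"
      "p14 \<oplus> p41 = \<zero>" "p35 \<oplus> p53 = \<zero>" "p45 \<oplus> p54 = \<zero>"
    and p22: "p22 = l \<ominus> r"
    and R: "p24 \<oplus> p42 \<oplus> (p34 \<oplus> p43) \<oplus> p44 = r"
    and L: "p15 \<oplus> p51 \<oplus> (p25 \<oplus> p52) = p55 \<oplus> l"
  shows "(p11 \<oplus> p12 \<oplus> p13 \<oplus> p14 \<ominus> p15) \<oplus> (p21 \<oplus> p22 \<oplus> p23 \<oplus> p24 \<ominus> p25)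
    \<oplus> (p31 \<oplus> p32 \<oplus> p33 \<oplus> p34 \<ominus> p35) \<oplus> (p41 \<oplus> p42 \<oplus> p43 \<oplus> p44 \<ominus> p45)
    \<ominus> (p51 \<oplus> p52 \<oplus> p53 \<oplus> p54 \<ominus> p55) = \<zero>" (is "?lhs = _")
proof -
  have neg_zero: "\<ominus> \<zero> = \<zero>" by (rule minus_equality) simp_all
  \<comment> \<open>Collect the composites into the groups that the hypotheses evaluate; this is a rearrangement only.\<close>
  have "?lhs = p11 \<oplus> p33 \<oplus> (p12 \<oplus> p21) \<oplus> (p13 \<oplus> p31) \<oplus> (p23 \<oplus> p32) \<oplus> (p14 \<oplus> p41)
      \<oplus> \<ominus> (p35 \<oplus> p53) \<oplus> \<ominus> (p45 \<oplus> p54) \<oplus> (p22 \<oplus> (p24 \<oplus> p42 \<oplus> (p34 \<oplus> p43) \<oplus> p44)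
      \<oplus> (p55 \<ominus> (p15 \<oplus> p51 \<oplus> (p25 \<oplus> p52))))"
    using c by (simp add: a_minus_def minus_add a_ac)
  also have "\<dots> = (l \<ominus> r) \<oplus> r \<oplus> (p55 \<ominus> (p55 \<oplus> l))"
    unfolding z R L p22 using c by (simp add: neg_zero)
  also have "\<dots> = \<zero>"
    using c by (simp add: a_minus_def minus_add a_assoc r_neg l_neg r_neg2)
  finally show ?thesis .
qed

lemma bilinear_mult:
  assumes "dg_algebra K A dA"
  shows "mult A \<in> bilinear_maps K A A A"
proof -
  interpret A: dg_algebra K A dA by fact
  interpret A: ring A by (rule A.ring_axioms)
  show ?thesis
    by (simp add: bilinear_maps_def linear_maps_def A.smult_mult_left A.smult_mult_right
        A.l_distr A.r_distr)
qed

text \<open>The multiplication has degree zero as a map on the tensor square, so it commutes with the sign map.\<close>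

lemma koszul_mult:
  assumes "dg_algebra K A dA" and x: "x \<in> carrier A" and y: "y \<in> carrier A"
  shows "koszul A q (x \<otimes>\<^bsub>A\<^esub> y) = koszul A q x \<otimes>\<^bsub>A\<^esub> koszul A q y"
proof -
  interpret A: dg_algebra K A dA by fact
  note gA = A.graded_module_axioms and A = A.module_axioms
  note m = bilinear_mult[OF assms(1)] and p = pure_tensor_bilinear[OF A A]
  note lift = tensor_lift_pure[OF A A A m]
  have "tensor_lift K A (mult A) \<in> graded_maps K (tensor K A A) A 0"
    by (rule tensor_lift_graded[OF gA gA gA m]) (simp add: A.mult_grade)
  from koszul_natural_even[OF tensor_graded[OF gA gA] gA this _ bilinear_maps_closed[OF p x y], of q]
  show ?thesis
    by (simp add: koszul_pure_tensor[OF gA gA x y] lift x y A.koszul_closed)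
qed

context
  fixes K :: "('k, 'l) ring_scheme"
    and A :: "('k, 'a, 'n) gmodule_scheme" and dA :: "'a \<Rightarrow> 'a"
    and C :: "('k, 'c, 'm) gcoalgebra_scheme" and dC :: "'c \<Rightarrow> 'c" and h :: "'c \<Rightarrow> 'k"
    and \<alpha> :: "'c \<Rightarrow> 'a"
  assumes dgA: "dg_algebra K A dA" and cdgC: "curved_dg_coalgebra K C dC h"
    and twisting: "curved_twisting_morphism K A dA C dC h \<alpha>"
begin

interpretation A: dg_algebra K A dA by (fact dgA)
interpretation A: ring A by (rule A.ring_axioms)
interpretation C: curved_dg_coalgebra K C dC h by (fact cdgC)

private abbreviation "CA \<equiv> tensor K C A"
private abbreviation "AC \<equiv> tensor K A C"
private abbreviation "V \<equiv> tensor K A CA"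
private abbreviation "S \<equiv> sweedler K C V"
private abbreviation \<kappa> where "\<kappa> \<equiv> koszul A 1"
private abbreviation \<sigma> where "\<sigma> \<equiv> koszul C 1"
private abbreviation mul (infixl "\<cdot>" 70) where "a \<cdot> b \<equiv> a \<otimes>\<^bsub>A\<^esub> b"

private lemmas gA = A.graded_module_axioms and gC = C.graded_module_axioms
  and mA = A.module_axioms and mC = C.module_axioms

private lemma gCA: "graded_module K CA" and gAC: "graded_module K AC"
  by (intro tensor_graded gA gC)+

private lemma gV: "graded_module K V" by (intro tensor_graded gA gCA)

interpretation CA: graded_module K CA by (rule gCA)
interpretation AC: graded_module K AC by (rule gAC)
interpretation V: graded_module K V by (rule gV)

private lemmas mCA = CA.module_axioms and mAC = AC.module_axioms and mV = V.module_axioms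

private definition t :: "'a \<Rightarrow> 'c \<Rightarrow> 'a \<Rightarrow> ('a \<times> ('c \<times> 'a \<Rightarrow> 'k) set \<Rightarrow> 'k) set"
  where "t a c b = pure_tensor K A CA a (pure_tensor K C A c b)"

private lemma t_trilinear: "t \<in> trilinear_maps K A C A V"
  using assoc_right_trilinear[OF mA mC mA] unfolding t_def[abs_def] .

private lemma \<alpha>_degree: "\<alpha> \<in> graded_maps K C A (-1)"
  using twisting by (simp add: curved_twisting_morphism_def)

private lemmas \<alpha>_linear = graded_mapsD(1)[OF \<alpha>_degree]
  and dA_linear = graded_mapsD(1)[OF A.diff_degree]

private lemma t_linear:
  "c \<in> carrier C \<Longrightarrow> b \<in> carrier A \<Longrightarrow> (\<lambda>a. t a c b) \<in> linear_maps K A V"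
  "a \<in> carrier A \<Longrightarrow> b \<in> carrier A \<Longrightarrow> (\<lambda>c. t a c b) \<in> linear_maps K C V"
  "a \<in> carrier A \<Longrightarrow> c \<in> carrier C \<Longrightarrow> (\<lambda>b. t a c b) \<in> linear_maps K A V"
  using t_trilinear by (simp_all add: trilinear_maps_def bilinear_maps_def)

text \<open>The calculations below need two kinds of rewriting. The rules \<open>linear\<close> verify that an expression is
  linear in a variable; the rules \<open>signs\<close> bring it into normal form, with minus signs outside, double
  sign maps cancelled, and \<open>\<sigma>\<close> applied inside \<open>\<alpha>\<close> but outside \<open>d\<^sub>C\<close>.\<close>

private lemmas additive =
  linear_mapsD(1,2)[OF A.koszul_linear] linear_mapsD(1,2)[OF C.koszul_linear]
  linear_mapsD(1,2)[OF \<alpha>_linear] linear_mapsD(1,2)[OF dA_linear] linear_mapsD(1,2)[OF C.diff_linear]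
  linear_mapsD(1)[OF t_linear(1)] linear_mapsD(2)[OF t_linear(1)]
  linear_mapsD(2)[OF t_linear(2)] linear_mapsD(2)[OF t_linear(3)]
  A.l_distr A.r_distr

private lemmas homothetic =
  linear_mapsD(3)[OF A.koszul_linear] linear_mapsD(3)[OF C.koszul_linear]
  linear_mapsD(3)[OF \<alpha>_linear] linear_mapsD(3)[OF dA_linear] linear_mapsD(3)[OF C.diff_linear]
  linear_mapsD(3)[OF t_linear(1)] linear_mapsD(3)[OF t_linear(2)] linear_mapsD(3)[OF t_linear(3)]
  A.smult_mult_left A.smult_mult_right

private lemmas linear = additive homothetic

private lemma koszul_\<alpha>: "c \<in> carrier C \<Longrightarrow> \<kappa> (\<alpha> c) = \<ominus>\<^bsub>A\<^esub> \<alpha> (\<sigma> c)"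
  using koszul_natural_odd[OF gC gA \<alpha>_degree, of c] linear by simp

private lemmas signs = koszul_\<alpha>
  linear_maps_uminus[OF mA mA A.koszul_linear] linear_maps_uminus[OF mC mC C.koszul_linear]
  linear_maps_uminus[OF mC mA \<alpha>_linear] linear_maps_uminus[OF mA mA dA_linear]
  linear_maps_uminus[OF mC mC C.diff_linear]
  linear_maps_uminus[OF mA mV t_linear(1)] linear_maps_uminus[OF mC mV t_linear(2)]
  linear_maps_uminus[OF mA mV t_linear(3)]
  A.l_minus A.r_minus
  A.koszul_koszul C.koszul_koszul koszul_mult[OF dgA]
  A.koszul_odd[of "-1"] C.koszul_odd[of "-1"] A.koszul_even[of 0] C.koszul_even[of 0]
  koszul_natural_odd[OF gA gA A.diff_degree] koszul_natural_odd[OF gC gC C.diff_degree]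

private lemma V_eqI:
  assumes f: "f \<in> linear_maps K V W" and g: "g \<in> linear_maps K V W"
    and eq: "\<And>a c b. a \<in> carrier A \<Longrightarrow> c \<in> carrier C \<Longrightarrow> b \<in> carrier A \<Longrightarrow> f (t a c b) = g (t a c b)"
    and x: "x \<in> carrier V"
  shows "f x = g x"
proof (rule linear_maps_tensor_eqI[OF mA mCA f g _ x])
  fix a y assume a: "a \<in> carrier A" and y: "y \<in> carrier CA"
  note p = bilinear_mapsD(1)[OF pure_tensor_bilinear[OF mA mCA] a]
  show "f (pure_tensor K A CA a y) = g (pure_tensor K A CA a y)"
    by (rule linear_maps_tensor_eqI[OF mC mA linear_maps_comp[OF p f] linear_maps_comp[OF p g] _ y])
      (use eq a in \<open>simp add: t_def\<close>)
qed

text \<open>The summands of the twisted differential: the internal differentials of the three factors, and the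
  twists on the right and on the left.\<close>

private definition "D1 = tensor_map K A CA A CA 0 dA id"
private definition "D2 = tensor_map K A CA A CA (-1) id (tensor_map K C A C A 0 dC id)"
private definition "D3 = tensor_map K A CA A CA (-1) id (tensor_map K C A C A (-1) id dA)"
private definition "R = tensor_map K A CA A CA (-1) id (d_right K A C \<alpha>)"
private definition "L = (\<lambda>x. assoc_right K A C A
  (tensor_map K AC A AC A 0 (d_left K A C \<alpha>) id (assoc_left K A C A x)))"

private lemma d_twisted_eq:
  "d_twisted K A dA C dC \<alpha> x = D1 x \<oplus>\<^bsub>V\<^esub> D2 x \<oplus>\<^bsub>V\<^esub> D3 x \<oplus>\<^bsub>V\<^esub> R x \<ominus>\<^bsub>V\<^esub> L x"
  by (simp add: d_twisted_def d_tensor_def Let_def D1_def D2_def D3_def R_def L_def)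

private lemma right_trilinear: "(\<lambda>u v b. pure_tensor K C A (\<sigma> u) (\<alpha> v \<cdot> b)) \<in> trilinear_maps K C C A CA"
proof -
  note p = pure_tensor_bilinear[OF mC mA]
  show ?thesis
    by (simp add: trilinear_maps_def bilinear_maps_def linear_maps_def linear
        linear_mapsD[OF bilinear_mapsD(1)[OF p]] linear_mapsD[OF bilinear_mapsD(2)[OF p]])
qed

private lemma left_trilinear: "(\<lambda>a u v. pure_tensor K A C (\<kappa> a \<cdot> \<alpha> u) v) \<in> trilinear_maps K A C C AC"
proof -
  note p = pure_tensor_bilinear[OF mA mC]
  show ?thesis
    by (simp add: trilinear_maps_def bilinear_maps_def linear_maps_def linear
        linear_mapsD[OF bilinear_mapsD(1)[OF p]] linear_mapsD[OF bilinear_mapsD(2)[OF p]])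
qed

private lemma d_right_bilinear: "(\<lambda>c b. tensor_lift K CA
    (\<lambda>u v. pure_tensor K C A (\<sigma> u) (\<alpha> v \<cdot> b)) (comult C c)) \<in> bilinear_maps K C A CA"
  using bilinear_maps_comp[OF tensor_lift_outer_left[OF mC mC mA mCA right_trilinear]
      C.comult_linear linear_maps_id linear_maps_id] by simp

private lemma d_left_bilinear: "(\<lambda>a c. tensor_lift K AC
    (\<lambda>u v. pure_tensor K A C (\<kappa> a \<cdot> \<alpha> u) v) (comult C c)) \<in> bilinear_maps K A C AC"
  using bilinear_maps_comp[OF tensor_lift_outer_right[OF mA mC mC mAC left_trilinear]
      linear_maps_id C.comult_linear linear_maps_id] by simp

private lemma d_right_graded: "d_right K A C \<alpha> \<in> graded_maps K CA CA (-1)"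
  unfolding d_right_def
proof (rule tensor_lift_graded[OF gC gA gCA d_right_bilinear])
  fix i j c b assume c: "c \<in> grade C i" and b: "b \<in> grade A j"
  have "tensor_lift K CA (\<lambda>u v. pure_tensor K C A (\<sigma> u) (\<alpha> v \<cdot> b))
      \<in> graded_maps K (tensor K C C) CA (j - 1)"
  proof (rule tensor_lift_graded[OF gC gC gCA trilinear_mapsD(3)[OF right_trilinear A.grade_closed[OF b]]])
    fix i k u v assume u: "u \<in> grade C i" and v: "v \<in> grade C k"
    have "\<sigma> u \<in> grade C i" using graded_mapsD(2)[OF C.koszul_graded u] by simp
    moreover have "\<alpha> v \<cdot> b \<in> grade A (k - 1 + j)"
      using A.mult_grade[OF graded_mapsD(2)[OF \<alpha>_degree v] b] by simp
    ultimately show "pure_tensor K C A (\<sigma> u) (\<alpha> v \<cdot> b) \<in> grade CA (i + k + (j - 1))"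
      using pure_tensor_grade[OF gC gA] by (force simp: algebra_simps)
  qed
  from graded_mapsD(2)[OF this graded_mapsD(2)[OF C.comult_degree c]]
  show "tensor_lift K CA (\<lambda>u v. pure_tensor K C A (\<sigma> u) (\<alpha> v \<cdot> b)) (comult C c) \<in> grade CA (i + j + - 1)"
    by (simp add: algebra_simps)
qed

private lemma d_left_graded: "d_left K A C \<alpha> \<in> graded_maps K AC AC (-1)"
  unfolding d_left_def
proof (rule tensor_lift_graded[OF gA gC gAC d_left_bilinear])
  fix i j a c assume a: "a \<in> grade A i" and c: "c \<in> grade C j"
  have "tensor_lift K AC (\<lambda>u v. pure_tensor K A C (\<kappa> a \<cdot> \<alpha> u) v)
      \<in> graded_maps K (tensor K C C) AC (i - 1)"
  proof (rule tensor_lift_graded[OF gC gC gAC trilinear_mapsD(1)[OF left_trilinear A.grade_closed[OF a]]])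
    fix j k u v assume u: "u \<in> grade C j" and v: "v \<in> grade C k"
    have "\<kappa> a \<in> grade A i" using graded_mapsD(2)[OF A.koszul_graded a] by simp
    then have "\<kappa> a \<cdot> \<alpha> u \<in> grade A (i + (j - 1))"
      using A.mult_grade[OF _ graded_mapsD(2)[OF \<alpha>_degree u]] by simp
    from pure_tensor_grade[OF gA gC this v]
    show "pure_tensor K A C (\<kappa> a \<cdot> \<alpha> u) v \<in> grade AC (j + k + (i - 1))"
      by (simp add: algebra_simps)
  qed
  from graded_mapsD(2)[OF this graded_mapsD(2)[OF C.comult_degree c]]
  show "tensor_lift K AC (\<lambda>u v. pure_tensor K A C (\<kappa> a \<cdot> \<alpha> u) v) (comult C c) \<in> grade AC (i + j + - 1)"
    by (simp add: algebra_simps)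
qed

private lemma degrees:
  "D1 \<in> graded_maps K V V (-1)" "D2 \<in> graded_maps K V V (-1)" "D3 \<in> graded_maps K V V (-1)"
  "R \<in> graded_maps K V V (-1)" "L \<in> graded_maps K V V (-1)"
proof -
  note id = graded_maps_id
  note V = tensor_map_graded[OF gA gCA gA gCA] and CA = tensor_map_graded[OF gC gA gC gA]
  show "D1 \<in> graded_maps K V V (-1)"
    unfolding D1_def using V[OF A.diff_degree id] by simp
  show "D2 \<in> graded_maps K V V (-1)"
    unfolding D2_def using V[OF id CA[OF C.diff_degree id]] by simp
  show "D3 \<in> graded_maps K V V (-1)"
    unfolding D3_def using V[OF id CA[OF id A.diff_degree]] by simp
  show "R \<in> graded_maps K V V (-1)"
    unfolding R_def using V[OF id d_right_graded] by simp
  show "L \<in> graded_maps K V V (-1)"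
    unfolding L_def
    using graded_maps_comp[OF graded_maps_comp[OF assoc_left_graded[OF gA gC gA]
          tensor_map_graded[OF gAC gA gAC gA d_left_graded id]] assoc_right_graded[OF gA gC gA]]
    by simp
qed

private lemmas ops_linear = degrees[THEN graded_mapsD(1)]

private lemma right_S_bilinear:
  "a \<in> carrier A \<Longrightarrow> b \<in> carrier A \<Longrightarrow> (\<lambda>x y. t a (\<sigma> x) (\<alpha> y \<cdot> b)) \<in> bilinear_maps K C C V"
  and left_S_bilinear:
  "a \<in> carrier A \<Longrightarrow> b \<in> carrier A \<Longrightarrow> (\<lambda>x y. t (a \<cdot> \<alpha> x) y b) \<in> bilinear_maps K C C V"
  by (simp_all add: bilinear_maps_def linear_maps_def linear)

text \<open>Linearity and these values determine the operators, so their original definitions through tensor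
  maps and associativity isomorphisms can be forgotten from here on.\<close>

private lemma ops_pure:
  assumes a: "a \<in> carrier A" and c: "c \<in> carrier C" and b: "b \<in> carrier A"
  shows "D1 (t a c b) = t (dA a) c b"
    and "D2 (t a c b) = t (\<kappa> a) (dC c) b"
    and "D3 (t a c b) = t (\<kappa> a) (\<sigma> c) (dA b)"
    and "R (t a c b) = S (\<lambda>x y. t (\<kappa> a) (\<sigma> x) (\<alpha> y \<cdot> b)) c"
    and "L (t a c b) = S (\<lambda>x y. t (\<kappa> a \<cdot> \<alpha> x) y b) c"
proof -
  note id = linear_maps_id
  note tmV = tensor_map_pure[OF gA mCA mA mCA] and tmCA = tensor_map_pure[OF gC mA mC mA]
  note lCA = tensor_map_linear[OF gC mA mC mA]
  have cb: "pure_tensor K C A c b \<in> carrier CA" and ac: "pure_tensor K A C a c \<in> carrier AC"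
    by (rule bilinear_maps_closed[OF pure_tensor_bilinear[OF mC mA] c b]
        bilinear_maps_closed[OF pure_tensor_bilinear[OF mA mC] a c])+
  note sgn = A.koszul_even[of 0] C.koszul_even[of 0] A.koszul_odd[of "-1"] C.koszul_odd[of "-1"]
    AC.koszul_even[of 0]
  show "D1 (t a c b) = t (dA a) c b"
    unfolding D1_def t_def by (simp add: tmV dA_linear id a cb sgn)
  show "D2 (t a c b) = t (\<kappa> a) (dC c) b"
    unfolding D2_def t_def
    by (simp add: tmV id a cb sgn lCA C.diff_linear tmCA c b)
  show "D3 (t a c b) = t (\<kappa> a) (\<sigma> c) (dA b)"
    unfolding D3_def t_def
    by (simp add: tmV id a cb sgn lCA dA_linear tmCA c b)
  have "d_right K A C \<alpha> (pure_tensor K C A c b)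
      = sweedler K C CA (\<lambda>u v. pure_tensor K C A (\<sigma> u) (\<alpha> v \<cdot> b)) c"
    unfolding d_right_def sweedler_def by (rule tensor_lift_pure[OF mC mA mCA d_right_bilinear c b])
  then have "R (t a c b)
      = pure_tensor K A CA (\<kappa> a) (sweedler K C CA (\<lambda>u v. pure_tensor K C A (\<sigma> u) (\<alpha> v \<cdot> b)) c)"
    unfolding R_def t_def by (simp add: tmV id a cb sgn graded_mapsD(1)[OF d_right_graded])
  also have "\<dots> = S (\<lambda>x y. t (\<kappa> a) (\<sigma> x) (\<alpha> y \<cdot> b)) c"
    unfolding t_def
    by (rule C.sweedler_comp[OF mCA trilinear_mapsD(3)[OF right_trilinear b] c mV
          bilinear_mapsD(1)[OF pure_tensor_bilinear[OF mA mCA] A.koszul_closed[OF a]]])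
  finally show "R (t a c b) = S (\<lambda>x y. t (\<kappa> a) (\<sigma> x) (\<alpha> y \<cdot> b)) c" .
  have dl: "d_left K A C \<alpha> (pure_tensor K A C a c)
      = sweedler K C AC (\<lambda>u v. pure_tensor K A C (\<kappa> a \<cdot> \<alpha> u) v) c"
    unfolding d_left_def sweedler_def by (rule tensor_lift_pure[OF mA mC mAC d_left_bilinear a c])
  note lt = trilinear_mapsD(1)[OF left_trilinear a]
  note tb = trilinear_mapsD(3)[OF t_trilinear b]
  have "L (t a c b) = tensor_lift K V (\<lambda>a c. t a c b)
      (sweedler K C AC (\<lambda>u v. pure_tensor K A C (\<kappa> a \<cdot> \<alpha> u) v) c)"
    unfolding L_def t_def
    by (simp add: assoc_left_pure[OF gA gC gA a c b] id ac sgn b graded_mapsD(1)[OF d_left_graded]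
        tensor_map_pure[OF gAC mA mAC mA] dl assoc_right_pure[OF gA gC gA] C.sweedler_closed[OF mAC lt c])
  also have "\<dots> = S (\<lambda>x y. tensor_lift K V (\<lambda>a c. t a c b) (pure_tensor K A C (\<kappa> a \<cdot> \<alpha> x) y)) c"
    by (rule C.sweedler_comp[OF mAC lt c mV tensor_lift_linear[OF mA mC mV tb]])
  also have "\<dots> = S (\<lambda>x y. t (\<kappa> a \<cdot> \<alpha> x) y b) c"
    by (rule C.sweedler_cong[OF mV left_S_bilinear[OF A.koszul_closed[OF a] b] c])
      (simp add: tensor_lift_pure[OF mA mC mV tb] linear a)
  finally show "L (t a c b) = S (\<lambda>x y. t (\<kappa> a \<cdot> \<alpha> x) y b) c" .
qed

private lemmas closed = A.koszul_closed C.koszul_closed linear_mapsD(1)[OF \<alpha>_linear]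
  linear_mapsD(1)[OF dA_linear] linear_mapsD(1)[OF C.diff_linear] linear_mapsD(1)[OF t_linear(1)]

private lemmas bilinear = bilinear_maps_def linear_maps_def linear

private lemmas S_add = C.sweedler_add[OF mV] and S_cong = C.sweedler_cong[OF mV]
  and S_comp = C.sweedler_comp[OF mV _ _ mV] and S_uminus = C.sweedler_uminus[OF mV]
  and S_closed = C.sweedler_closed[OF mV]

text \<open>The convolution square of \<open>\<alpha>\<close>; the map \<open>\<sigma>\<close> is the Koszul sign of moving the second \<open>\<alpha>\<close>, of odd
  degree, past the first Sweedler factor.\<close>

private definition conv :: "'c \<Rightarrow> 'a"
  where "conv = sweedler K C A (\<lambda>x y. \<alpha> (\<sigma> x) \<cdot> \<alpha> y)"

private lemma conv_bilinear: "(\<lambda>x y. \<alpha> (\<sigma> x) \<cdot> \<alpha> y) \<in> bilinear_maps K C C A"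
  by (simp add: bilinear)

private lemma conv_linear: "conv \<in> linear_maps K C A"
  unfolding conv_def by (rule C.sweedler_linear[OF mA conv_bilinear])

private lemmas conv_simps = linear_mapsD[OF conv_linear]

private lemma twisting_sum:
  assumes c: "c \<in> carrier C"
  shows "dA (\<alpha> c) \<oplus>\<^bsub>A\<^esub> \<alpha> (dC c) \<oplus>\<^bsub>A\<^esub> conv c = h c \<odot>\<^bsub>A\<^esub> \<one>\<^bsub>A\<^esub>"
proof -
  have "convolution K C A (-1) \<alpha> \<alpha> c = sweedler K C A (\<lambda>x y. \<alpha> (koszul C (-1) x) \<cdot> \<alpha> y) c"
    unfolding convolution_def
    by (rule C.tensor_lift_tensor_map[OF mA \<alpha>_linear \<alpha>_linear mA mA bilinear_mult[OF dgA] c])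
  also have "\<dots> = conv c"
    unfolding conv_def by (rule C.sweedler_cong[OF mA conv_bilinear c]) (simp add: C.koszul_odd[of "-1"])
  finally have "convolution K C A (-1) \<alpha> \<alpha> c = conv c" .
  moreover have "hom_diff A dC dA (-1) \<alpha> c \<oplus>\<^bsub>A\<^esub> convolution K C A (-1) \<alpha> \<alpha> c = h c \<odot>\<^bsub>A\<^esub> \<one>\<^bsub>A\<^esub>"
    using twisting c unfolding curved_twisting_morphism_def by blast
  ultimately show ?thesis by (simp add: hom_diff_def)
qed

private lemma t_zero:
  "c \<in> carrier C \<Longrightarrow> b \<in> carrier A \<Longrightarrow> t \<zero>\<^bsub>A\<^esub> c b = \<zero>\<^bsub>V\<^esub>"
  "a \<in> carrier A \<Longrightarrow> c \<in> carrier C \<Longrightarrow> t a c \<zero>\<^bsub>A\<^esub> = \<zero>\<^bsub>V\<^esub>"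
  using linear_maps_zero[OF mA mV t_linear(1)] linear_maps_zero[OF mA mV t_linear(3)] by auto

context
  fixes a c b
  assumes a: "a \<in> carrier A" and c: "c \<in> carrier C" and b: "b \<in> carrier A"
begin

private lemma internal:
  "D1 (D1 (t a c b)) = \<zero>\<^bsub>V\<^esub>"
  "D3 (D3 (t a c b)) = \<zero>\<^bsub>V\<^esub>"
  "D1 (D2 (t a c b)) \<oplus>\<^bsub>V\<^esub> D2 (D1 (t a c b)) = \<zero>\<^bsub>V\<^esub>"
  "D1 (D3 (t a c b)) \<oplus>\<^bsub>V\<^esub> D3 (D1 (t a c b)) = \<zero>\<^bsub>V\<^esub>"
  "D2 (D3 (t a c b)) \<oplus>\<^bsub>V\<^esub> D3 (D2 (t a c b)) = \<zero>\<^bsub>V\<^esub>"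
  by (simp_all add: a b c ops_pure linear signs A.diff_square t_zero V.l_neg)

private abbreviation "Lh \<equiv> S (\<lambda>x y. t a (h x \<odot>\<^bsub>C\<^esub> y) b) c"
private abbreviation "Rh \<equiv> S (\<lambda>x y. t a (h y \<odot>\<^bsub>C\<^esub> x) b) c"

private lemma h_bilinear:
  "(\<lambda>x y. t a (h x \<odot>\<^bsub>C\<^esub> y) b) \<in> bilinear_maps K C C V"
  "(\<lambda>x y. t a (h y \<odot>\<^bsub>C\<^esub> x) b) \<in> bilinear_maps K C C V"
  using bilinear_maps_comp[OF C.curvature_bilinear(1) linear_maps_id linear_maps_id t_linear(2)[OF a b]]
    bilinear_maps_comp[OF C.curvature_bilinear(2) linear_maps_id linear_maps_id t_linear(2)[OF a b]]
  by simp_all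

text \<open>The curvature axiom: \<open>d\<^sub>C\<close> squares to the difference of the two curvature terms.\<close>

private lemma D2_D2: "D2 (D2 (t a c b)) = Lh \<ominus>\<^bsub>V\<^esub> Rh"
proof -
  have cl: "sweedler K C C (\<lambda>x y. h x \<odot>\<^bsub>C\<^esub> y) c \<in> carrier C"
    "sweedler K C C (\<lambda>x y. h y \<odot>\<^bsub>C\<^esub> x) c \<in> carrier C"
    by (rule C.sweedler_closed[OF mC] C.curvature_bilinear c)+
  have "D2 (D2 (t a c b)) = t a (dC (dC c)) b"
    by (simp add: a b c ops_pure linear signs)
  also have "\<dots> = Lh \<ominus>\<^bsub>V\<^esub> Rh"
    unfolding C.sweedler_curvature[OF c] linear_maps_minus[OF mC mV t_linear(2)[OF a b] cl]
    by (simp only: C.sweedler_comp[OF mC C.curvature_bilinear(1) c mV t_linear(2)[OF a b]]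
        C.sweedler_comp[OF mC C.curvature_bilinear(2) c mV t_linear(2)[OF a b]])
  finally show ?thesis .
qed

text \<open>An internal differential and a twist that do not meet in a common factor anticommute by the sign
  rule. For \<open>d\<^sub>3\<close> and \<open>L\<close> the sign of \<open>c\<close> has to be distributed over its two Sweedler factors.\<close>

private lemma D1_R: "D1 (R (t a c b)) \<oplus>\<^bsub>V\<^esub> R (D1 (t a c b)) = \<zero>\<^bsub>V\<^esub>"
proof -
  let ?\<beta> = "\<lambda>x y. t (\<kappa> (dA a)) (\<sigma> x) (\<alpha> y \<cdot> b)"
  have \<beta>: "?\<beta> \<in> bilinear_maps K C C V" by (simp add: bilinear a b)
  have "D1 (R (t a c b)) = S (\<lambda>x y. D1 (t (\<kappa> a) (\<sigma> x) (\<alpha> y \<cdot> b))) c"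
    unfolding ops_pure(4)[OF a c b]
    by (rule S_comp[OF right_S_bilinear c ops_linear(1)]) (simp_all add: a b closed)
  also have "\<dots> = S (\<lambda>x y. \<ominus>\<^bsub>V\<^esub> ?\<beta> x y) c"
    by (rule S_cong[OF _ c]) (simp_all add: bilinear signs ops_pure a b V.minus_add V.smult_r_minus)
  also have "\<dots> = \<ominus>\<^bsub>V\<^esub> S ?\<beta> c" by (rule S_uminus[OF \<beta> c])
  finally show ?thesis
    using S_closed[OF \<beta> c] by (simp add: ops_pure a b c closed V.l_neg)
qed

private lemma D3_L: "D3 (L (t a c b)) \<oplus>\<^bsub>V\<^esub> L (D3 (t a c b)) = \<zero>\<^bsub>V\<^esub>"
proof -
  let ?\<beta> = "\<lambda>x y. t (a \<cdot> \<alpha> (\<sigma> x)) (\<sigma> y) (dA b)"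
  have \<beta>: "?\<beta> \<in> bilinear_maps K C C V" by (simp add: bilinear a b)
  have "D3 (L (t a c b)) = S (\<lambda>x y. D3 (t (\<kappa> a \<cdot> \<alpha> x) y b)) c"
    unfolding ops_pure(5)[OF a c b]
    by (rule S_comp[OF left_S_bilinear c ops_linear(3)]) (simp_all add: a b closed)
  also have "\<dots> = S (\<lambda>x y. \<ominus>\<^bsub>V\<^esub> ?\<beta> x y) c"
    by (rule S_cong[OF _ c]) (simp_all add: bilinear signs ops_pure a b V.minus_add V.smult_r_minus)
  also have "\<dots> = \<ominus>\<^bsub>V\<^esub> S ?\<beta> c" by (rule S_uminus[OF \<beta> c])
  finally have 1: "D3 (L (t a c b)) = \<ominus>\<^bsub>V\<^esub> S ?\<beta> c" .
  have "L (D3 (t a c b)) = S (\<lambda>x y. t (a \<cdot> \<alpha> x) y (dA b)) (\<sigma> c)"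
    by (simp add: ops_pure a b c closed signs)
  also have "\<dots> = S ?\<beta> c"
    by (rule C.sweedler_koszul[OF mV left_S_bilinear c]) (simp_all add: a b closed)
  finally show ?thesis
    using 1 S_closed[OF \<beta> c] by (simp add: V.l_neg)
qed

text \<open>The two twists split \<open>c\<close> twice, once from each side; coassociativity identifies the results, and
  the odd degree of \<open>\<alpha>\<close> makes their signs opposite.\<close>

private lemma R_L: "R (L (t a c b)) \<oplus>\<^bsub>V\<^esub> L (R (t a c b)) = \<zero>\<^bsub>V\<^esub>"
proof -
  let ?\<beta> = "\<lambda>u v w. t (a \<cdot> \<alpha> (\<sigma> u)) (\<sigma> v) (\<alpha> w \<cdot> b)"
  have \<beta>: "?\<beta> \<in> trilinear_maps K C C C V" by (simp add: trilinear_maps_def bilinear a b)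
  note \<beta>r = C.sweedler_right_bilinear[OF mV \<beta>] and \<beta>l = C.sweedler_left_bilinear[OF mV \<beta>]
  have "R (L (t a c b)) = S (\<lambda>x y. R (t (\<kappa> a \<cdot> \<alpha> x) y b)) c"
    unfolding ops_pure(5)[OF a c b]
    by (rule S_comp[OF left_S_bilinear c ops_linear(4)]) (simp_all add: a b closed)
  also have "\<dots> = S (\<lambda>x y. \<ominus>\<^bsub>V\<^esub> S (?\<beta> x) y) c"
  proof (rule S_cong[OF _ c])
    show "(\<lambda>x y. \<ominus>\<^bsub>V\<^esub> S (?\<beta> x) y) \<in> bilinear_maps K C C V"
      using bilinear_maps_comp[OF \<beta>r linear_maps_id linear_maps_id linear_maps_neg[OF mV linear_maps_id]]
      by simp
    fix x y assume x: "x \<in> carrier C" and y: "y \<in> carrier C"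
    have "R (t (\<kappa> a \<cdot> \<alpha> x) y b) = S (\<lambda>u v. \<ominus>\<^bsub>V\<^esub> ?\<beta> x u v) y"
      unfolding ops_pure(4)[OF A.m_closed[OF closed(1)[OF a] closed(3)[OF x]] y b]
      by (rule S_cong[OF _ y])
        (simp_all add: bilinear signs a b x V.minus_add V.smult_r_minus)
    then show "R (t (\<kappa> a \<cdot> \<alpha> x) y b) = \<ominus>\<^bsub>V\<^esub> S (?\<beta> x) y"
      using S_uminus[OF trilinear_mapsD(1)[OF \<beta> x] y] by simp
  qed
  also have "\<dots> = \<ominus>\<^bsub>V\<^esub> S (\<lambda>x y. S (?\<beta> x) y) c" by (rule S_uminus[OF \<beta>r c])
  finally have 1: "R (L (t a c b)) = \<ominus>\<^bsub>V\<^esub> S (\<lambda>x y. S (?\<beta> x) y) c" .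
  have "L (R (t a c b)) = S (\<lambda>x y. L (t (\<kappa> a) (\<sigma> x) (\<alpha> y \<cdot> b))) c"
    unfolding ops_pure(4)[OF a c b]
    by (rule S_comp[OF right_S_bilinear c ops_linear(5)]) (simp_all add: a b closed)
  also have "\<dots> = S (\<lambda>x y. S (\<lambda>u v. ?\<beta> u v y) x) c"
  proof (rule S_cong[OF \<beta>l c])
    fix x y assume x: "x \<in> carrier C" and y: "y \<in> carrier C"
    have "L (t (\<kappa> a) (\<sigma> x) (\<alpha> y \<cdot> b)) = S (\<lambda>u v. t (a \<cdot> \<alpha> u) v (\<alpha> y \<cdot> b)) (\<sigma> x)"
      by (simp add: ops_pure a b x y closed signs)
    also have "\<dots> = S (\<lambda>u v. ?\<beta> u v y) x"
      by (rule C.sweedler_koszul[OF mV left_S_bilinear x]) (simp_all add: a b y closed)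
    finally show "L (t (\<kappa> a) (\<sigma> x) (\<alpha> y \<cdot> b)) = S (\<lambda>u v. ?\<beta> u v y) x" .
  qed
  also have "\<dots> = S (\<lambda>x y. S (?\<beta> x) y) c" by (rule C.sweedler_coassoc[OF mV \<beta> c])
  finally show ?thesis
    using 1 S_closed[OF \<beta>r c] by (simp add: V.l_neg)
qed

private lemma right_bilinear:
  assumes "f \<in> linear_maps K C A"
  shows "(\<lambda>x y. t a x (f y \<cdot> b)) \<in> bilinear_maps K C C V"
  using linear_mapsD[OF assms] by (simp add: bilinear a b)

private lemma left_bilinear:
  assumes "f \<in> linear_maps K C A"
  shows "(\<lambda>x y. t (a \<cdot> f x) y b) \<in> bilinear_maps K C C V"
  using linear_mapsD[OF assms] by (simp add: bilinear a b)

private lemmas dA_\<alpha>_linear = linear_maps_comp[OF \<alpha>_linear dA_linear]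
  and \<alpha>_dC_linear = linear_maps_comp[OF C.diff_linear \<alpha>_linear]

text \<open>By the coderivation rule \<open>R\<close> after \<open>d\<^sub>C\<close> has a term with \<open>d\<^sub>C\<close> on each Sweedler factor. The one on the
  surviving factor cancels; the other one feeds \<open>\<alpha> \<circ> d\<^sub>C\<close>.\<close>

private lemma D2_R: "D2 (R (t a c b)) \<oplus>\<^bsub>V\<^esub> R (D2 (t a c b)) = S (\<lambda>x y. t a x (\<alpha> (dC y) \<cdot> b)) c"
proof -
  let ?\<beta> = "\<lambda>x y. t a (\<sigma> (dC x)) (\<alpha> y \<cdot> b)"
  have \<beta>: "?\<beta> \<in> bilinear_maps K C C V" by (simp add: bilinear a b)
  have "D2 (R (t a c b)) = S (\<lambda>x y. D2 (t (\<kappa> a) (\<sigma> x) (\<alpha> y \<cdot> b))) c"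
    unfolding ops_pure(4)[OF a c b]
    by (rule S_comp[OF right_S_bilinear c ops_linear(2)]) (simp_all add: a b closed)
  also have "\<dots> = S (\<lambda>x y. \<ominus>\<^bsub>V\<^esub> ?\<beta> x y) c"
    by (rule S_cong[OF _ c]) (simp_all add: bilinear signs ops_pure a b V.minus_add V.smult_r_minus)
  also have "\<dots> = \<ominus>\<^bsub>V\<^esub> S ?\<beta> c" by (rule S_uminus[OF \<beta> c])
  finally have 1: "D2 (R (t a c b)) = \<ominus>\<^bsub>V\<^esub> S ?\<beta> c" .
  have "R (D2 (t a c b)) = S (\<lambda>x y. t a (\<sigma> x) (\<alpha> y \<cdot> b)) (dC c)"
    by (simp add: ops_pure a b c closed signs)
  also have "\<dots> = S ?\<beta> c \<oplus>\<^bsub>V\<^esub> S (\<lambda>x y. t a (\<sigma> (\<sigma> x)) (\<alpha> (dC y) \<cdot> b)) c"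
    by (rule C.sweedler_coderivation[OF mV right_S_bilinear[OF a b] c])
  also have "S (\<lambda>x y. t a (\<sigma> (\<sigma> x)) (\<alpha> (dC y) \<cdot> b)) c = S (\<lambda>x y. t a x (\<alpha> (dC y) \<cdot> b)) c"
    by (rule S_cong[OF right_bilinear[OF \<alpha>_dC_linear] c]) (simp add: signs)
  finally show ?thesis
    using 1 S_closed[OF \<beta> c] S_closed[OF right_bilinear[OF \<alpha>_dC_linear] c] by (simp add: V.r_neg1)
qed

text \<open>The Leibniz rule for \<open>\<alpha> c'' \<cdot> b\<close>: the term with \<open>d\<^sub>A b\<close> cancels and the one with \<open>d\<^sub>A \<circ> \<alpha>\<close>
  remains.\<close>

private lemma D3_R: "D3 (R (t a c b)) \<oplus>\<^bsub>V\<^esub> R (D3 (t a c b)) = S (\<lambda>x y. t a x (dA (\<alpha> y) \<cdot> b)) c"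
proof -
  let ?\<beta> = "\<lambda>x y. t a x (\<alpha> (\<sigma> y) \<cdot> dA b)" and ?\<gamma> = "\<lambda>x y. t a x (dA (\<alpha> y) \<cdot> b)"
  have \<beta>: "?\<beta> \<in> bilinear_maps K C C V" by (simp add: bilinear a b)
  have \<beta>n: "(\<lambda>x y. \<ominus>\<^bsub>V\<^esub> ?\<beta> x y) \<in> bilinear_maps K C C V"
    by (simp add: bilinear a b V.minus_add V.smult_r_minus)
  note \<gamma> = right_bilinear[OF dA_\<alpha>_linear]
  have "D3 (R (t a c b)) = S (\<lambda>x y. D3 (t (\<kappa> a) (\<sigma> x) (\<alpha> y \<cdot> b))) c"
    unfolding ops_pure(4)[OF a c b]
    by (rule S_comp[OF right_S_bilinear c ops_linear(3)]) (simp_all add: a b closed)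
  also have "\<dots> = S (\<lambda>x y. ?\<gamma> x y \<oplus>\<^bsub>V\<^esub> \<ominus>\<^bsub>V\<^esub> ?\<beta> x y) c"
    by (rule S_cong[OF bilinear_maps_add[OF mV \<gamma> \<beta>n] c])
      (simp add: linear signs ops_pure a b A.leibniz)
  also have "\<dots> = S ?\<gamma> c \<oplus>\<^bsub>V\<^esub> \<ominus>\<^bsub>V\<^esub> S ?\<beta> c"
    unfolding S_add[OF \<gamma> \<beta>n c, symmetric] S_uminus[OF \<beta> c] ..
  finally have 1: "D3 (R (t a c b)) = S ?\<gamma> c \<oplus>\<^bsub>V\<^esub> \<ominus>\<^bsub>V\<^esub> S ?\<beta> c" .
  have "R (D3 (t a c b)) = S (\<lambda>x y. t a (\<sigma> x) (\<alpha> y \<cdot> dA b)) (\<sigma> c)"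
    by (simp add: ops_pure a b c closed signs)
  also have "\<dots> = S (\<lambda>x y. t a (\<sigma> (\<sigma> x)) (\<alpha> (\<sigma> y) \<cdot> dA b)) c"
    by (rule C.sweedler_koszul[OF mV right_S_bilinear c]) (simp_all add: a b closed)
  also have "\<dots> = S ?\<beta> c" by (rule S_cong[OF \<beta> c]) (simp add: signs)
  finally show ?thesis
    using 1 S_closed[OF \<beta> c] S_closed[OF \<gamma> c] by (simp add: V.a_assoc V.l_neg)
qed

text \<open>Twisting twice multiplies \<open>b\<close> by two values of \<open>\<alpha>\<close>; after regrouping by coassociativity they form
  the convolution square.\<close>

private lemma R_R: "R (R (t a c b)) = S (\<lambda>x y. t a x (conv y \<cdot> b)) c"
proof -
  let ?\<beta> = "\<lambda>u v w. t a u (\<alpha> (\<sigma> v) \<cdot> (\<alpha> w \<cdot> b))"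
  have \<beta>: "?\<beta> \<in> trilinear_maps K C C C V" by (simp add: trilinear_maps_def bilinear a b)
  have "R (R (t a c b)) = S (\<lambda>x y. R (t (\<kappa> a) (\<sigma> x) (\<alpha> y \<cdot> b))) c"
    unfolding ops_pure(4)[OF a c b]
    by (rule S_comp[OF right_S_bilinear c ops_linear(4)]) (simp_all add: a b closed)
  also have "\<dots> = S (\<lambda>x y. S (\<lambda>u v. ?\<beta> u v y) x) c"
  proof (rule S_cong[OF C.sweedler_left_bilinear[OF mV \<beta>] c])
    fix x y assume x: "x \<in> carrier C" and y: "y \<in> carrier C"
    have yb: "\<alpha> y \<cdot> b \<in> carrier A" using y b by (simp add: closed)
    have "R (t (\<kappa> a) (\<sigma> x) (\<alpha> y \<cdot> b)) = S (\<lambda>u v. t a (\<sigma> u) (\<alpha> v \<cdot> (\<alpha> y \<cdot> b))) (\<sigma> x)"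
      by (simp add: ops_pure a b x y closed signs)
    also have "\<dots> = S (\<lambda>u v. t a (\<sigma> (\<sigma> u)) (\<alpha> (\<sigma> v) \<cdot> (\<alpha> y \<cdot> b))) x"
      by (rule C.sweedler_koszul[OF mV right_S_bilinear[OF a yb] x])
    also have "\<dots> = S (\<lambda>u v. ?\<beta> u v y) x"
      by (rule S_cong[OF trilinear_mapsD(3)[OF \<beta> y] x]) (simp add: signs)
    finally show "R (t (\<kappa> a) (\<sigma> x) (\<alpha> y \<cdot> b)) = S (\<lambda>u v. ?\<beta> u v y) x" .
  qed
  also have "\<dots> = S (\<lambda>x y. S (?\<beta> x) y) c" by (rule C.sweedler_coassoc[OF mV \<beta> c])
  also have "\<dots> = S (\<lambda>x y. t a x (conv y \<cdot> b)) c"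
  proof (rule S_cong[OF right_bilinear[OF conv_linear] c])
    fix x y assume x: "x \<in> carrier C" and y: "y \<in> carrier C"
    have lin: "(\<lambda>z. t a x (z \<cdot> b)) \<in> linear_maps K A V" by (simp add: linear_maps_def linear a b x)
    have "t a x (conv y \<cdot> b) = S (\<lambda>v w. t a x (\<alpha> (\<sigma> v) \<cdot> \<alpha> w \<cdot> b)) y"
      unfolding conv_def by (rule C.sweedler_comp[OF mA conv_bilinear y mV lin])
    also have "\<dots> = S (?\<beta> x) y"
      by (rule S_cong[OF trilinear_mapsD(1)[OF \<beta> x] y]) (simp add: A.m_assoc closed b)
    finally show "S (?\<beta> x) y = t a x (conv y \<cdot> b)" by simp
  qed
  finally show ?thesis .
qed

text \<open>The three previous lemmas contribute the three terms of the twisting equation on the right Sweedler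
  factor.\<close>

private lemma right_curvature:
  "D2 (R (t a c b)) \<oplus>\<^bsub>V\<^esub> R (D2 (t a c b)) \<oplus>\<^bsub>V\<^esub> (D3 (R (t a c b)) \<oplus>\<^bsub>V\<^esub> R (D3 (t a c b)))
    \<oplus>\<^bsub>V\<^esub> R (R (t a c b)) = Rh"
proof -
  note b1 = right_bilinear[OF \<alpha>_dC_linear] and b2 = right_bilinear[OF dA_\<alpha>_linear]
    and b3 = right_bilinear[OF conv_linear]
  have "t a x (\<alpha> (dC y) \<cdot> b) \<oplus>\<^bsub>V\<^esub> t a x (dA (\<alpha> y) \<cdot> b) \<oplus>\<^bsub>V\<^esub> t a x (conv y \<cdot> b) = t a (h y \<odot>\<^bsub>C\<^esub> x) b"
    if x: "x \<in> carrier C" and y: "y \<in> carrier C" for x y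
  proof -
    have "t a x (\<alpha> (dC y) \<cdot> b) \<oplus>\<^bsub>V\<^esub> t a x (dA (\<alpha> y) \<cdot> b) \<oplus>\<^bsub>V\<^esub> t a x (conv y \<cdot> b)
        = t a x ((dA (\<alpha> y) \<oplus>\<^bsub>A\<^esub> \<alpha> (dC y) \<oplus>\<^bsub>A\<^esub> conv y) \<cdot> b)"
      using x y a b by (simp add: linear conv_simps V.a_comm)
    also have "\<dots> = t a (h y \<odot>\<^bsub>C\<^esub> x) b"
      unfolding twisting_sum[OF y] using x y a b by (simp add: linear C.h_closed)
    finally show ?thesis .
  qed
  then show ?thesis
    unfolding D2_R D3_R R_R S_add[OF b1 b2 c] S_add[OF bilinear_maps_add[OF mV b1 b2] b3 c]
    by (intro S_cong[OF h_bilinear(2) c])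
qed

text \<open>The mirror images for the left twist. Here the square of \<open>L\<close> carries a minus sign, because the
  sign map of the first factor also meets the value of \<open>\<alpha>\<close> produced by the first twist; this is why
  \<open>L\<close> is subtracted in the differential.\<close>

private lemma D1_L: "D1 (L (t a c b)) \<oplus>\<^bsub>V\<^esub> L (D1 (t a c b)) = S (\<lambda>x y. t (a \<cdot> dA (\<alpha> x)) y b) c"
proof -
  let ?\<beta> = "\<lambda>x y. t (\<kappa> (dA a) \<cdot> \<alpha> x) y b" and ?\<gamma> = "\<lambda>x y. t (a \<cdot> dA (\<alpha> x)) y b"
  have \<beta>: "?\<beta> \<in> bilinear_maps K C C V" by (simp add: bilinear a b)
  have \<beta>n: "(\<lambda>x y. \<ominus>\<^bsub>V\<^esub> ?\<beta> x y) \<in> bilinear_maps K C C V"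
    by (simp add: bilinear a b V.minus_add V.smult_r_minus)
  note \<gamma> = left_bilinear[OF dA_\<alpha>_linear]
  have "D1 (L (t a c b)) = S (\<lambda>x y. D1 (t (\<kappa> a \<cdot> \<alpha> x) y b)) c"
    unfolding ops_pure(5)[OF a c b]
    by (rule S_comp[OF left_S_bilinear c ops_linear(1)]) (simp_all add: a b closed)
  also have "\<dots> = S (\<lambda>x y. ?\<gamma> x y \<oplus>\<^bsub>V\<^esub> \<ominus>\<^bsub>V\<^esub> ?\<beta> x y) c"
    by (rule S_cong[OF bilinear_maps_add[OF mV \<gamma> \<beta>n] c])
      (simp add: linear signs ops_pure a b A.leibniz V.a_comm)
  also have "\<dots> = S ?\<gamma> c \<oplus>\<^bsub>V\<^esub> \<ominus>\<^bsub>V\<^esub> S ?\<beta> c"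
    unfolding S_add[OF \<gamma> \<beta>n c, symmetric] S_uminus[OF \<beta> c] ..
  finally have 1: "D1 (L (t a c b)) = S ?\<gamma> c \<oplus>\<^bsub>V\<^esub> \<ominus>\<^bsub>V\<^esub> S ?\<beta> c" .
  have "L (D1 (t a c b)) = S ?\<beta> c"
    by (simp add: ops_pure a b c closed)
  then show ?thesis
    using 1 S_closed[OF \<beta> c] S_closed[OF \<gamma> c] by (simp add: V.a_assoc V.l_neg)
qed

private lemma D2_L: "D2 (L (t a c b)) \<oplus>\<^bsub>V\<^esub> L (D2 (t a c b)) = S (\<lambda>x y. t (a \<cdot> \<alpha> (dC x)) y b) c"
proof -
  let ?\<beta> = "\<lambda>x y. t (a \<cdot> \<alpha> (\<sigma> x)) (dC y) b" and ?\<gamma> = "\<lambda>x y. t (a \<cdot> \<alpha> (dC x)) y b"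
  have \<beta>: "?\<beta> \<in> bilinear_maps K C C V" by (simp add: bilinear a b)
  note \<gamma> = left_bilinear[OF \<alpha>_dC_linear]
  have "D2 (L (t a c b)) = S (\<lambda>x y. D2 (t (\<kappa> a \<cdot> \<alpha> x) y b)) c"
    unfolding ops_pure(5)[OF a c b]
    by (rule S_comp[OF left_S_bilinear c ops_linear(2)]) (simp_all add: a b closed)
  also have "\<dots> = S (\<lambda>x y. \<ominus>\<^bsub>V\<^esub> ?\<beta> x y) c"
    by (rule S_cong[OF _ c]) (simp_all add: bilinear signs ops_pure a b V.minus_add V.smult_r_minus)
  also have "\<dots> = \<ominus>\<^bsub>V\<^esub> S ?\<beta> c" by (rule S_uminus[OF \<beta> c])
  finally have 1: "D2 (L (t a c b)) = \<ominus>\<^bsub>V\<^esub> S ?\<beta> c" .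
  have "L (D2 (t a c b)) = S (\<lambda>x y. t (a \<cdot> \<alpha> x) y b) (dC c)"
    by (simp add: ops_pure a b c closed signs)
  also have "\<dots> = S ?\<gamma> c \<oplus>\<^bsub>V\<^esub> S ?\<beta> c"
    by (rule C.sweedler_coderivation[OF mV left_S_bilinear[OF a b] c])
  finally show ?thesis
    using 1 S_closed[OF \<beta> c] S_closed[OF \<gamma> c] by (simp add: V.a_comm[of _ "S ?\<beta> c"] V.r_neg1)
qed

private lemma L_L: "L (L (t a c b)) = \<ominus>\<^bsub>V\<^esub> S (\<lambda>x y. t (a \<cdot> conv x) y b) c"
proof -
  let ?\<beta> = "\<lambda>u v w. t (a \<cdot> \<alpha> (\<sigma> u) \<cdot> \<alpha> v) w b"
  have \<beta>: "?\<beta> \<in> trilinear_maps K C C C V" by (simp add: trilinear_maps_def bilinear a b)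
  note \<beta>r = C.sweedler_right_bilinear[OF mV \<beta>]
  have "L (L (t a c b)) = S (\<lambda>x y. L (t (\<kappa> a \<cdot> \<alpha> x) y b)) c"
    unfolding ops_pure(5)[OF a c b]
    by (rule S_comp[OF left_S_bilinear c ops_linear(5)]) (simp_all add: a b closed)
  also have "\<dots> = S (\<lambda>x y. \<ominus>\<^bsub>V\<^esub> S (?\<beta> x) y) c"
  proof (rule S_cong[OF _ c])
    show "(\<lambda>x y. \<ominus>\<^bsub>V\<^esub> S (?\<beta> x) y) \<in> bilinear_maps K C C V"
      using bilinear_maps_comp[OF \<beta>r linear_maps_id linear_maps_id linear_maps_neg[OF mV linear_maps_id]]
      by simp
    fix x y assume x: "x \<in> carrier C" and y: "y \<in> carrier C"
    have "L (t (\<kappa> a \<cdot> \<alpha> x) y b) = S (\<lambda>u v. \<ominus>\<^bsub>V\<^esub> ?\<beta> x u v) y"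
      unfolding ops_pure(5)[OF A.m_closed[OF closed(1)[OF a] closed(3)[OF x]] y b]
      by (rule S_cong[OF _ y])
        (simp_all add: bilinear signs a b x V.minus_add V.smult_r_minus)
    then show "L (t (\<kappa> a \<cdot> \<alpha> x) y b) = \<ominus>\<^bsub>V\<^esub> S (?\<beta> x) y"
      using S_uminus[OF trilinear_mapsD(1)[OF \<beta> x] y] by simp
  qed
  also have "\<dots> = \<ominus>\<^bsub>V\<^esub> S (\<lambda>x y. S (?\<beta> x) y) c" by (rule S_uminus[OF \<beta>r c])
  also have "S (\<lambda>x y. S (?\<beta> x) y) c = S (\<lambda>x y. S (\<lambda>u v. ?\<beta> u v y) x) c"
    by (rule C.sweedler_coassoc[OF mV \<beta> c, symmetric])
  also have "\<dots> = S (\<lambda>x y. t (a \<cdot> conv x) y b) c"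
  proof (rule S_cong[OF left_bilinear[OF conv_linear] c])
    fix x y assume x: "x \<in> carrier C" and y: "y \<in> carrier C"
    have lin: "(\<lambda>z. t (a \<cdot> z) y b) \<in> linear_maps K A V" by (simp add: linear_maps_def linear a b y)
    have "t (a \<cdot> conv x) y b = S (\<lambda>u v. t (a \<cdot> (\<alpha> (\<sigma> u) \<cdot> \<alpha> v)) y b) x"
      unfolding conv_def by (rule C.sweedler_comp[OF mA conv_bilinear x mV lin])
    also have "\<dots> = S (\<lambda>u v. ?\<beta> u v y) x"
      by (rule S_cong[OF trilinear_mapsD(3)[OF \<beta> y] x]) (simp add: A.m_assoc closed a)
    finally show "S (\<lambda>u v. ?\<beta> u v y) x = t (a \<cdot> conv x) y b" by simp
  qed
  finally show ?thesis .
qed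

private lemma left_curvature:
  "D1 (L (t a c b)) \<oplus>\<^bsub>V\<^esub> L (D1 (t a c b)) \<oplus>\<^bsub>V\<^esub> (D2 (L (t a c b)) \<oplus>\<^bsub>V\<^esub> L (D2 (t a c b)))
    = L (L (t a c b)) \<oplus>\<^bsub>V\<^esub> Lh"
proof -
  note b1 = left_bilinear[OF dA_\<alpha>_linear] and b2 = left_bilinear[OF \<alpha>_dC_linear]
    and b3 = left_bilinear[OF conv_linear]
  note cl = S_closed[OF b1 c] S_closed[OF b2 c] S_closed[OF b3 c]
  have "t (a \<cdot> dA (\<alpha> x)) y b \<oplus>\<^bsub>V\<^esub> t (a \<cdot> \<alpha> (dC x)) y b \<oplus>\<^bsub>V\<^esub> t (a \<cdot> conv x) y b = t a (h x \<odot>\<^bsub>C\<^esub> y) b"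
    if x: "x \<in> carrier C" and y: "y \<in> carrier C" for x y
  proof -
    have "t (a \<cdot> dA (\<alpha> x)) y b \<oplus>\<^bsub>V\<^esub> t (a \<cdot> \<alpha> (dC x)) y b \<oplus>\<^bsub>V\<^esub> t (a \<cdot> conv x) y b
        = t (a \<cdot> (dA (\<alpha> x) \<oplus>\<^bsub>A\<^esub> \<alpha> (dC x) \<oplus>\<^bsub>A\<^esub> conv x)) y b"
      using x y a b by (simp add: linear conv_simps)
    also have "\<dots> = t a (h x \<odot>\<^bsub>C\<^esub> y) b"
      unfolding twisting_sum[OF x] using x y a b by (simp add: linear C.h_closed)
    finally show ?thesis .
  qed
  then have "Lh = S (\<lambda>x y. t (a \<cdot> dA (\<alpha> x)) y b \<oplus>\<^bsub>V\<^esub> t (a \<cdot> \<alpha> (dC x)) y b \<oplus>\<^bsub>V\<^esub> t (a \<cdot> conv x) y b) c"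
    by (intro S_cong[OF h_bilinear(1) c, symmetric])
  also have "\<dots> = S (\<lambda>x y. t (a \<cdot> dA (\<alpha> x)) y b) c \<oplus>\<^bsub>V\<^esub> S (\<lambda>x y. t (a \<cdot> \<alpha> (dC x)) y b) c
      \<oplus>\<^bsub>V\<^esub> S (\<lambda>x y. t (a \<cdot> conv x) y b) c"
    unfolding S_add[OF b1 b2 c] S_add[OF bilinear_maps_add[OF mV b1 b2] b3 c] ..
  finally show ?thesis
    unfolding D1_L D2_L L_L using cl by (simp add: V.a_comm[of _ "S (\<lambda>x y. t (a \<cdot> conv x) y b) c"] V.r_neg1)
qed

private lemma ops_closed: "x \<in> carrier V \<Longrightarrow> D1 x \<in> carrier V" "x \<in> carrier V \<Longrightarrow> D2 x \<in> carrier V"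
  "x \<in> carrier V \<Longrightarrow> D3 x \<in> carrier V" "x \<in> carrier V \<Longrightarrow> R x \<in> carrier V"
  "x \<in> carrier V \<Longrightarrow> L x \<in> carrier V"
  by (rule linear_mapsD(1)[OF ops_linear(1)] linear_mapsD(1)[OF ops_linear(2)]
      linear_mapsD(1)[OF ops_linear(3)] linear_mapsD(1)[OF ops_linear(4)]
      linear_mapsD(1)[OF ops_linear(5)], assumption)+

lemma square_pure: "d_twisted K A dA C dC \<alpha> (d_twisted K A dA C dC \<alpha> (t a c b)) = \<zero>\<^bsub>V\<^esub>"
proof -
  \<comment> \<open>Distribute the outer operators over the inner sum, which produces the 25 composites.\<close>
  note add = linear_mapsD(2)[OF ops_linear(1)] linear_mapsD(2)[OF ops_linear(2)]
    linear_mapsD(2)[OF ops_linear(3)] linear_mapsD(2)[OF ops_linear(4)] linear_mapsD(2)[OF ops_linear(5)]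
  note minus = linear_maps_minus[OF mV mV ops_linear(1)] linear_maps_minus[OF mV mV ops_linear(2)]
    linear_maps_minus[OF mV mV ops_linear(3)] linear_maps_minus[OF mV mV ops_linear(4)]
    linear_maps_minus[OF mV mV ops_linear(5)]
  have t: "t a c b \<in> carrier V" by (simp add: linear a b c)
  note cl = ops_closed ops_closed[OF t]
  show ?thesis
    unfolding d_twisted_eq
    by (simp only: add minus cl V.a_closed V.minus_closed)
      (rule V.twisted_square_zero[where l = Lh and r = Rh]; (intro ops_closed t S_closed h_bilinear c
        internal D1_R D3_L R_L D2_D2 right_curvature left_curvature)?)
qed

end

lemma d_twisted_linear: "d_twisted K A dA C dC \<alpha> \<in> linear_maps K V V"
  unfolding d_twisted_eq[abs_def]
  by (intro linear_maps_diff linear_maps_add mV ops_linear)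

lemma d_twisted_graded: "d_twisted K A dA C dC \<alpha> \<in> graded_maps K V V (-1)"
proof (rule graded_mapsI[OF d_twisted_linear])
  fix x n assume "x \<in> grade V n"
  then show "d_twisted K A dA C dC \<alpha> x \<in> grade V (n + - 1)"
    unfolding d_twisted_eq a_minus_def
    by (intro V.add_grade V.neg_grade degrees[THEN graded_mapsD(2)])
qed

lemma d_twisted_square:
  assumes "x \<in> carrier V"
  shows "d_twisted K A dA C dC \<alpha> (d_twisted K A dA C dC \<alpha> x) = \<zero>\<^bsub>V\<^esub>"
  by (rule V_eqI[OF linear_maps_comp[OF d_twisted_linear d_twisted_linear] linear_maps_const_zero[OF mV]
        square_pure assms])

lemma twisted_complex: "chain_complex K (free_bimodule K A C) (d_twisted K A dA C dC \<alpha>)"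
proof -
  let ?B = "free_bimodule K A C"
  have sel: "carrier ?B = carrier V" "add ?B = add V" "zero ?B = zero V" "smult ?B = smult V"
    "grade ?B = grade V"
    by (simp_all add: free_bimodule_def Let_def gmodule.defs gbimodule.defs)
  interpret B: graded_module K ?B by (rule graded_module_cong[OF gV sel])
  show ?thesis
  proof
    show "d_twisted K A dA C dC \<alpha> \<in> graded_maps K ?B ?B (-1)"
      using d_twisted_graded by (simp add: graded_maps_def linear_maps_def sel)
    show "d_twisted K A dA C dC \<alpha> (d_twisted K A dA C dC \<alpha> x) = \<zero>\<^bsub>?B\<^esub>" if "x \<in> carrier ?B" for x
      using d_twisted_square that by (simp add: sel)
  qed
qed

end

theorem proposition2p6:
  fixes K :: "('k, 'l) ring_scheme"
    and A :: "('k, 'a, 'n) gmodule_scheme" and dA :: "'a \<Rightarrow> 'a"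
    and C :: "('k, 'c, 'm) gcoalgebra_scheme" and dC :: "'c \<Rightarrow> 'c" and h :: "'c \<Rightarrow> 'k"
    and \<alpha> :: "'c \<Rightarrow> 'a"
  assumes "field K" and "char_zero K"
    and "dg_algebra K A dA"
    and "curved_dg_coalgebra K C dC h"
    and "curved_twisting_morphism K A dA C dC h \<alpha>"
  shows "chain_complex K (free_bimodule K A C) (d_twisted K A dA C dC \<alpha>)"
  by (rule twisted_complex[OF assms(3-5)])

end
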